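(* There is a randomized MPC algorithm with $O(n)$ words of local memory per machine and $O(m)$ words of total memory that finds a $2$-ruling set of the input graph; the algorithm runs in $O(1)$ rounds with high probability.
   Context: A $2$-ruling set of a graph $G=(V,E)$ with $n$ vertices and $m$ edges is a set $S\subseteq V$ of pairwise non-adjacent vertices such that every vertex is within distance at most $2$ of some vertex of $S$. In the MPC model there are $M$ machines, each with $S$ words of memory (a word being $O(\log n)$ bits); the input graph is distributed among the machines (the edges of each vertex on the same machine), and in synchronous rounds machines compute locally and then communicate all-to-all, each machine sending and receiving at most $S$ words per round. Here $S=\Theta(n)$ and total memory $M\cdot S=\Theta(m)$. "With high probability" means with probability at least $1-1/n^{c'}$ for a constant $c'\ge1$ that can be chosen. *)

theory Defs
  imports "HOL-Probability.Probability" "HOL-Library.Extended_Nat" "HOL-Library.Log_Nat"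
begin

section \<open>Graphs and ruling sets\<close>

definition simple_graph :: "'a set \<Rightarrow> 'a set set \<Rightarrow> bool" where
  "simple_graph V E \<longleftrightarrow> finite V \<and> (\<forall>e\<in>E. e \<subseteq> V \<and> card e = 2)"

definition adj :: "'a set set \<Rightarrow> ('a \<times> 'a) set" where
  "adj E = {(u, v). {u, v} \<in> E}"

text \<open>Length of a shortest walk; the infimum of the empty set is \<open>\<infinity>\<close>.\<close>

definition graph_dist :: "'a set set \<Rightarrow> 'a \<Rightarrow> 'a \<Rightarrow> enat" where
  "graph_dist E u v = Inf (enat ` {k. (u, v) \<in> adj E ^^ k})"

definition ruling_set :: "nat \<Rightarrow> 'a set \<Rightarrow> 'a set set \<Rightarrow> 'a set \<Rightarrow> bool" where
  "ruling_set r V E A \<longleftrightarrow>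
     A \<subseteq> V \<and>
     (\<forall>u\<in>A. \<forall>v\<in>A. (u, v) \<notin> adj E) \<and>
     (\<forall>v\<in>V. \<exists>u\<in>A. graph_dist E u v \<le> enat r)"


section \<open>The MPC model\<close>

text \<open>
  The machines are numbered by \<open>{..<M}\<close> and a word of memory is a natural number below
  \<open>2 ^ B\<close>, where \<open>B\<close> is the word size in bits.
  In each round a machine that has not halted chooses an action: either it keeps some words in
  memory and sends a list of words to every machine (empty lists cost nothing), or it halts for
  good with a list of output words. As a machine is determined by its last action, a configuration
  of the whole system just records that action for every machine.
\<close>

type_synonym memory = "nat list"

datatype action =
    Continue memory "nat \<Rightarrow> memory"
  | Halt memory

type_synonym config = "nat \<Rightarrow> action"

fun stored :: "action \<Rightarrow> memory" where
  "stored (Continue mem out) = mem"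
| "stored (Halt res) = res"

fun sent :: "action \<Rightarrow> nat \<Rightarrow> memory" where
  "sent (Continue mem out) = out"
| "sent (Halt res) = (\<lambda>_. [])"

fun halted :: "action \<Rightarrow> bool" where
  "halted (Continue mem out) = False"
| "halted (Halt res) = True"

text \<open>
  An algorithm is one program for all machines. Its arguments are the number \<open>n\<close> of vertices,
  the number \<open>M\<close> of machines, the number of the executing machine, the words in its memory and
  the words just received (as a function of the sender). Local computation is unrestricted, and
  the result is a probability distribution because the machine may toss private coins.
\<close>

type_synonym algorithm =
  "nat \<Rightarrow> nat \<Rightarrow> nat \<Rightarrow> memory \<Rightarrow> (nat \<Rightarrow> memory) \<Rightarrow> action pmf"

text \<open>
  One synchronous round. \<open>Pi_pmf\<close> makes the coins of different machines independent; the
  indices outside \<open>{..<M}\<close> are not machines and get the silent action \<open>Halt []\<close>.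
\<close>

definition mpc_round :: "algorithm \<Rightarrow> nat \<Rightarrow> nat \<Rightarrow> config \<Rightarrow> config pmf" where
  "mpc_round P n M cfg =
     Pi_pmf {..<M} (Halt [])
       (\<lambda>i. case cfg i of
              Halt res \<Rightarrow> return_pmf (Halt res)
            | Continue mem out \<Rightarrow> P n M i mem (\<lambda>k. sent (cfg k) i))"

primrec mpc_run :: "algorithm \<Rightarrow> nat \<Rightarrow> nat \<Rightarrow> (nat \<Rightarrow> memory) \<Rightarrow> nat \<Rightarrow> config pmf" where
  "mpc_run P n M input 0 = return_pmf (\<lambda>i. Continue (input i) (\<lambda>_. []))"
| "mpc_run P n M input (Suc t) = bind_pmf (mpc_run P n M input t) (mpc_round P n M)"

text \<open>
  The resource limits. What a machine keeps and what it receives must together fit into its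
  \<open>S\<close> words of memory.
\<close>

definition within_limits :: "nat \<Rightarrow> nat \<Rightarrow> nat \<Rightarrow> config \<Rightarrow> bool" where
  "within_limits S B M cfg \<longleftrightarrow>
     (\<forall>i<M. length (stored (cfg i)) + (\<Sum>k<M. length (sent (cfg k) i)) \<le> S \<and>
            (\<Sum>j<M. length (sent (cfg i) j)) \<le> S \<and>
            (\<forall>w\<in>set (stored (cfg i)). w < 2 ^ B) \<and>
            (\<forall>j<M. \<forall>w\<in>set (sent (cfg i) j). w < 2 ^ B))"

definition all_halted :: "nat \<Rightarrow> config \<Rightarrow> bool" where
  "all_halted M cfg \<longleftrightarrow> (\<forall>i<M. halted (cfg i))"

text \<open>The output is distributed among the machines, too. Meant for configurations in which all
  machines have halted.\<close>

definition mpc_output :: "nat \<Rightarrow> config \<Rightarrow> nat set" where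
  "mpc_output M cfg = (\<Union>i<M. set (stored (cfg i)))"


section \<open>Graphs as inputs\<close>

text \<open>
  The vertices are \<open>{..<n}\<close>, and machine \<open>i\<close> initially stores the adjacency lists of
  the vertices \<open>v\<close> with \<open>place v = i\<close>. A list is preceded by its vertex and its length.
\<close>

definition adjacency_words :: "nat set set \<Rightarrow> nat \<Rightarrow> memory" where
  "adjacency_words E v =
     (let N = {u. {v, u} \<in> E} in v # card N # sorted_list_of_set N)"

definition input_share :: "nat \<Rightarrow> nat set set \<Rightarrow> (nat \<Rightarrow> nat) \<Rightarrow> nat \<Rightarrow> memory" where
  "input_share n E place i =
     concat (map (adjacency_words E) (filter (\<lambda>v. place v = i) [0..<n]))"

text \<open>The input is placed on \<open>M\<close> machines with at most \<open>L\<close> words on each.\<close>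

definition placement :: "nat \<Rightarrow> nat set set \<Rightarrow> nat \<Rightarrow> nat \<Rightarrow> (nat \<Rightarrow> nat) \<Rightarrow> bool" where
  "placement n E M L place \<longleftrightarrow>
     (\<forall>v<n. place v < M) \<and> (\<forall>i<M. length (input_share n E place i) \<le> L)"

text \<open>
  The algorithm \<open>P\<close> finds an \<open>r\<close>-ruling set on machines with \<open>S\<close> words of \<open>B\<close> bits:
  whatever the coins, the resource limits are respected at all times and the output is correct
  once all machines have halted, which happens almost surely.
\<close>

definition finds_ruling_set ::
  "nat \<Rightarrow> algorithm \<Rightarrow> nat \<Rightarrow> nat \<Rightarrow> nat \<Rightarrow> nat set set \<Rightarrow> nat \<Rightarrow> (nat \<Rightarrow> nat) \<Rightarrow> bool" where
  "finds_ruling_set r P S B n E M place \<longleftrightarrow>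
     (\<forall>t. \<forall>cfg\<in>set_pmf (mpc_run P n M (input_share n E place) t).
        within_limits S B M cfg \<and>
        (all_halted M cfg \<longrightarrow> ruling_set r {..<n} E (mpc_output M cfg))) \<and>
     (\<lambda>t. measure_pmf.prob (mpc_run P n M (input_share n E place) t) {cfg. all_halted M cfg})
       \<longlonglongrightarrow> 1"

text \<open>Halted machines stay halted, so this is the probability of using at most \<open>R\<close> rounds.\<close>

definition prob_halted_within ::
  "nat \<Rightarrow> algorithm \<Rightarrow> nat \<Rightarrow> nat set set \<Rightarrow> nat \<Rightarrow> (nat \<Rightarrow> nat) \<Rightarrow> real" where
  "prob_halted_within R P n E M place =
     measure_pmf.prob (mpc_run P n M (input_share n E place) R) {cfg. all_halted M cfg}"

end

theory Submission
  imports Defs "HOL-Real_Asymp.Real_Asymp"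
begin

text \<open>
  The algorithm works in a constant number of stages. In a stage, each vertex that is not yet within
  distance \<open>2\<close> of the independent set built so far is sampled with a probability \<open>1 / b\<^sup>e\<close>, where
  \<open>b\<close> is about the 27th root of its degree; the sampled subgraph is sent to one machine, which
  adds a maximal independent set of it, chosen so that sampled vertices without a sampled neighbour
  of at least the same \<open>b\<close> are in the set. With exponents \<open>14\<close>, \<open>18\<close> (six times), \<open>5\<close>, \<open>0\<close> all
  sampled subgraphs have \<open>O(n)\<close> edges. After the first stage (up to vertices with \<open>O(n)\<close> edges in
  total) each survivor has most of its neighbours at much larger degrees. A survivor is lucky if some
  neighbour \<open>w\<close> has \<open>b\<^sup>1\<^sup>9\<close> neighbours with the same \<open>b\<close>: one of those is then likely to be sampled and
  to enter the independent set. The unlucky ones are few by double counting, so each of the next six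
  stages improves a bound on the sum of \<open>b\<^sup>j\<close> over the survivors from \<open>j\<close> to \<open>j + 1\<close>. Then a stage with
  larger probabilities leaves each survivor with at most \<open>b\<^sup>6\<close> neighbours of no larger \<open>b\<close>, and hence
  \<open>O(n)\<close> edges altogether.

  Everything is run first for the vertices with \<open>b\<^sup>5\<^sup>8\<^sup>4 \<ge> n\<close>, where expectations have a polynomial
  slack and Markov's inequality suffices, and then for the others, where dependence is local
  and Chebyshev's inequality applies. An attempt thus fails with probability \<open>n\<close> to a negative
  constant power, and constantly many attempts make the failure probability as small as desired.
\<close>

section \<open>Random subsets\<close>

text \<open>How the exponents fit together: an unlucky vertex has at least \<open>b^27\<close>
  neighbours, each adjacent to fewer than \<open>b^19\<close> remaining vertices of that class, so
  with weight \<open>b^6\<close> double counting leaves the convergent sum of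
  \<open>k^(19+6-27)\<close>. The weight \<open>b^6\<close> is what sampling with exponent
  \<open>5\<close> requires; \<open>14\<close> is the least \<open>e\<close> with
  \<open>2 * e > 27\<close>; and \<open>b^19\<close> candidates sampled at rate \<open>b^-18\<close>
  give \<open>b\<close> hits on average. Chebyshev's inequality needs each summand to see few coins
  and each coin to affect few summands. The independent set that is chosen depends on the whole
  sample, so survival is replaced by the weaker condition \<open>alive\<close>, decided by the
  sample near the vertex. The middle vertex \<open>w\<close> of a lucky vertex may have a degree far
  beyond the current range; therefore each lucky vertex watches only \<open>b^19\<close> candidates,
  spread evenly over the neighbours of \<open>w\<close>. The memory limits must hold for every
  outcome of the coins, although a sampled subgraph is only likely to be small. Hence the volume of
  a transmission is announced first, and if it is refused, the stage leaves the independent set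
  unchanged.\<close>

definition random_subset :: "'a set \<Rightarrow> ('a \<Rightarrow> real) \<Rightarrow> 'a set pmf" where
  "random_subset A p = map_pmf (\<lambda>w. {v\<in>A. w v}) (Pi_pmf A False (\<lambda>v. bernoulli_pmf (p v)))"

abbreviation expect :: "'a pmf \<Rightarrow> ('a \<Rightarrow> real) \<Rightarrow> real" where
  "expect M f \<equiv> measure_pmf.expectation M f"

abbreviation pr :: "'a pmf \<Rightarrow> 'a set \<Rightarrow> real" where
  "pr M X \<equiv> measure_pmf.prob M X"

lemma set_random_subset: "set_pmf (random_subset A p) \<subseteq> Pow A"
  by (auto simp: random_subset_def)

lemma finite_set_random_subset [simp]: "finite A \<Longrightarrow> finite (set_pmf (random_subset A p))"
  using set_random_subset finite_subset by (metis finite_Pow_iff)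

lemma integrable_random_subset [simp]:
  fixes f :: "'a set \<Rightarrow> real"
  assumes "finite A"
  shows "integrable (measure_pmf (random_subset A p)) f"
  using assms by (intro integrable_measure_pmf_finite) simp

lemma expect_pair_mult:
  fixes f :: "'a \<Rightarrow> real" and g :: "'b \<Rightarrow> real"
  assumes "finite (set_pmf P)" "finite (set_pmf Q)"
  shows "expect (pair_pmf P Q) (\<lambda>z. f (fst z) * g (snd z)) = expect P f * expect Q g"
proof -
  have "expect (pair_pmf P Q) (\<lambda>z. f (fst z) * g (snd z))
      = (\<Sum>z\<in>set_pmf P \<times> set_pmf Q. f (fst z) * g (snd z) * pmf (pair_pmf P Q) z)"
    using assms by (subst integral_measure_pmf_real[where A = "set_pmf P \<times> set_pmf Q"]) auto
  also have "\<dots> = (\<Sum>x\<in>set_pmf P. \<Sum>y\<in>set_pmf Q. (f x * pmf P x) * (g y * pmf Q y))"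
    unfolding sum.cartesian_product by (intro sum.cong) (auto simp: pmf_pair mult_ac)
  also have "\<dots> = (\<Sum>x\<in>set_pmf P. f x * pmf P x) * (\<Sum>y\<in>set_pmf Q. g y * pmf Q y)"
    by (simp add: sum_product)
  also have "\<dots> = expect P f * expect Q g"
    using assms by (subst (1 2) integral_measure_pmf_real) auto
  finally show ?thesis .
qed

lemma random_subset_Un:
  assumes "finite A" "finite B" "A \<inter> B = {}"
  shows "random_subset (A \<union> B) p =
    map_pmf (\<lambda>z. fst z \<union> snd z) (pair_pmf (random_subset A p) (random_subset B p))"
proof -
  let ?P = "\<lambda>A. Pi_pmf A False (\<lambda>v. bernoulli_pmf (p v))"
  have "random_subset (A \<union> B) p = map_pmf (\<lambda>z. {v\<in>A. fst z v} \<union> {v\<in>B. snd z v}) (pair_pmf (?P A) (?P B))"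
    unfolding random_subset_def Pi_pmf_union[OF assms] map_pmf_comp
    using assms(3) by (intro map_pmf_cong) auto
  also have "\<dots> = map_pmf (\<lambda>z. fst z \<union> snd z) (map_pmf (\<lambda>(a, b). ({v\<in>A. a v}, {v\<in>B. b v})) (pair_pmf (?P A) (?P B)))"
    by (simp add: map_pmf_comp case_prod_beta)
  also have "\<dots> = map_pmf (\<lambda>z. fst z \<union> snd z) (pair_pmf (random_subset A p) (random_subset B p))"
    by (simp add: map_pair random_subset_def)
  finally show ?thesis .
qed

lemma expect_random_subset_mono:
  assumes "finite A" "\<And>S. S \<subseteq> A \<Longrightarrow> f S \<le> g S"
  shows "expect (random_subset A p) f \<le> expect (random_subset A p) g"
  using assms set_random_subset[of A p]
  by (intro integral_mono_AE) (auto simp: AE_measure_pmf_iff)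

lemma expect_random_subset_Un:
  assumes "finite A" "finite B" "A \<inter> B = {}"
    and f: "\<And>S. S \<subseteq> A \<union> B \<Longrightarrow> f S = f (S \<inter> A)"
    and g: "\<And>S. S \<subseteq> A \<union> B \<Longrightarrow> g S = g (S \<inter> B)"
  shows "expect (random_subset (A \<union> B) p) (\<lambda>S. f S * g S) =
    expect (random_subset A p) f * expect (random_subset B p) g"
proof -
  have "expect (random_subset (A \<union> B) p) (\<lambda>S. f S * g S) =
     expect (pair_pmf (random_subset A p) (random_subset B p)) (\<lambda>z. f (fst z \<union> snd z) * g (fst z \<union> snd z))"
    by (simp add: random_subset_Un[OF assms(1-3)])
  also have "\<dots> = expect (pair_pmf (random_subset A p) (random_subset B p)) (\<lambda>z. f (fst z) * g (snd z))"
  proof (intro integral_cong_AE; simp add: AE_measure_pmf_iff; safe)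
    fix S T assume "S \<in> set_pmf (random_subset A p)" "T \<in> set_pmf (random_subset B p)"
    then have ST: "S \<subseteq> A" "T \<subseteq> B" using set_random_subset by blast+
    then have "(S \<union> T) \<inter> A = S" "(S \<union> T) \<inter> B = T" using assms(3) by auto
    then show "f (S \<union> T) * g (S \<union> T) = f S * g T"
      using f[of "S \<union> T"] g[of "S \<union> T"] ST by (metis Un_mono)
  qed
  also have "\<dots> = expect (random_subset A p) f * expect (random_subset B p) g"
    using assms(1,2) by (intro expect_pair_mult) auto
  finally show ?thesis .
qed

text \<open>Splitting the coins into \<open>D\<close> and its complement puts the factors on
  independent parts. The product rule with the constant \<open>1\<close> as one factor identifies
  the expectations over the parts with those over all of \<open>A\<close>.\<close>

lemma expect_random_subset_indep:
  assumes "finite A" "D \<subseteq> A" "D' \<subseteq> A" "D \<inter> D' = {}"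
    and f: "\<And>S. S \<subseteq> A \<Longrightarrow> f S = f (S \<inter> D)"
    and g: "\<And>S. S \<subseteq> A \<Longrightarrow> g S = g (S \<inter> D')"
  shows "expect (random_subset A p) (\<lambda>S. f S * g S) =
    expect (random_subset A p) f * expect (random_subset A p) g"
proof -
  define B where "B = A - D"
  have A: "A = D \<union> B" "finite D" "finite B" "D \<inter> B = {}"
    using assms finite_subset by (auto simp: B_def)
  have g': "g S = g (S \<inter> B)" if "S \<subseteq> D \<union> B" for S
  proof -
    have "S \<inter> B \<inter> D' = S \<inter> D'" using assms(3,4) that by (auto simp: B_def)
    moreover have "S \<inter> B \<subseteq> A" "S \<subseteq> A" using that A(1) by auto
    ultimately show ?thesis using g \<open>S \<inter> B \<inter> D' = S \<inter> D'\<close> by metis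
  qed
  have f': "f S = f (S \<inter> D)" if "S \<subseteq> D \<union> B" for S using f that A(1) by auto
  have 1: "expect (random_subset A p) (\<lambda>S. f S * g S) = expect (random_subset D p) f * expect (random_subset B p) g"
    unfolding A(1) by (intro expect_random_subset_Un A(2-4) f' g')
  have 2: "expect (random_subset A p) (\<lambda>S. f S * 1) = expect (random_subset D p) f * expect (random_subset B p) (\<lambda>_. 1)"
    unfolding A(1) by (intro expect_random_subset_Un A(2-4) f' refl)
  have 3: "expect (random_subset A p) (\<lambda>S. 1 * g S) = expect (random_subset D p) (\<lambda>_. 1) * expect (random_subset B p) g"
    unfolding A(1) by (intro expect_random_subset_Un A(2-4) g' refl)
  show ?thesis using 1 2 3 by simp
qed

section \<open>Hitting probabilities and moments of a random subset\<close>

lemma pr_random_subset_disjoint: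
  assumes "finite A" "D \<subseteq> A" "\<And>v. v \<in> D \<Longrightarrow> 0 \<le> p v \<and> p v \<le> 1"
  shows "pr (random_subset A p) {S. D \<inter> S = {}} = (\<Prod>v\<in>D. 1 - p v)"
proof -
  let ?M = "Pi_pmf A False (\<lambda>v. bernoulli_pmf (p v))"
  have "pr (random_subset A p) {S. D \<inter> S = {}} = pr ?M (Pi A (\<lambda>v. if v \<in> D then {False} else UNIV))"
    unfolding random_subset_def measure_map_pmf
    using assms(2) by (intro arg_cong[where f = "pr ?M"]) (auto simp: Pi_def)
  also have "\<dots> = (\<Prod>v\<in>A. pr (bernoulli_pmf (p v)) (if v \<in> D then {False} else UNIV))"
    by (rule measure_Pi_pmf_Pi) fact
  also have "\<dots> = (\<Prod>v\<in>A. if v \<in> D then 1 - p v else 1)"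
    using assms(3) by (intro prod.cong) (auto simp: measure_pmf_single)
  also have "\<dots> = (\<Prod>v\<in>D. 1 - p v)"
    using assms(1,2) by (simp add: prod.If_cases Int_absorb1)
  finally show ?thesis .
qed

lemma pr_random_subset_disjoint_le:
  assumes "finite A" "D \<subseteq> A" "\<And>v. v \<in> D \<Longrightarrow> 0 \<le> p v \<and> p v \<le> 1"
  shows "pr (random_subset A p) {S. D \<inter> S = {}} \<le> exp (- (\<Sum>v\<in>D. p v))"
proof -
  have "finite D" using assms finite_subset by blast
  have "(\<Prod>v\<in>D. 1 - p v) \<le> (\<Prod>v\<in>D. exp (- p v))"
  proof (intro prod_mono conjI)
    fix v assume "v \<in> D"
    show "1 - p v \<le> exp (- p v)" using exp_ge_add_one_self[of "- p v"] by simp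
    show "0 \<le> 1 - p v" using assms(3)[OF \<open>v \<in> D\<close>] by simp
  qed
  also have "\<dots> = exp (- (\<Sum>v\<in>D. p v))"
    using \<open>finite D\<close> by (simp add: exp_sum sum_negf flip: sum_negf)
  finally show ?thesis using pr_random_subset_disjoint[OF assms] by simp
qed

lemma pr_expect: "pr M X = expect M (indicator X)"
  by simp

lemma expect_random_subset_elem:
  assumes "finite A" "v \<in> A" "0 \<le> p v" "p v \<le> 1"
  shows "expect (random_subset A p) (\<lambda>S. indicator S v) = p v"
proof -
  have "pr (random_subset A p) {S. {v} \<inter> S = {}} = 1 - p v"
    using pr_random_subset_disjoint[OF assms(1), of "{v}" p] assms by simp
  moreover have "pr (random_subset A p) {S. v \<in> S} = 1 - pr (random_subset A p) {S. {v} \<inter> S = {}}"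
    by (subst measure_pmf.prob_compl[symmetric]) (auto intro!: arg_cong[where f = "pr _"])
  moreover have "pr (random_subset A p) {S. v \<in> S} = expect (random_subset A p) (\<lambda>S. indicator S v)"
    unfolding pr_expect by (intro Bochner_Integration.integral_cong) (auto simp: indicator_def)
  ultimately show ?thesis by simp
qed

lemma expect_random_subset_elem2:
  assumes "finite A" "u \<in> A" "v \<in> A" "u \<noteq> v" "\<And>v. v \<in> A \<Longrightarrow> 0 \<le> p v \<and> p v \<le> 1"
  shows "expect (random_subset A p) (\<lambda>S. indicator S u * indicator S v) = p u * p v"
proof -
  have "expect (random_subset A p) (\<lambda>S. indicator S u * indicator S v) =
    expect (random_subset A p) (\<lambda>S. indicator S u) * expect (random_subset A p) (\<lambda>S. indicator S v)"
    by (rule expect_random_subset_indep[of A "{u}" "{v}"]) (use assms in \<open>auto simp: indicator_def\<close>)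
  then show ?thesis using assms by (simp add: expect_random_subset_elem)
qed

section \<open>Tail bounds\<close>

lemma markov_random_subset:
  assumes "finite A" "\<And>S. S \<subseteq> A \<Longrightarrow> 0 \<le> f S" "expect (random_subset A p) f \<le> e" "c > 0"
  shows "pr (random_subset A p) {S. f S > c} \<le> e / c"
proof -
  let ?M = "random_subset A p"
  have "pr ?M {S. f S > c} = expect ?M (indicator {S. f S > c})" by simp
  also have "\<dots> \<le> expect ?M (\<lambda>S. f S / c)"
    using assms by (intro expect_random_subset_mono) (auto simp: indicator_def field_simps)
  also have "\<dots> \<le> e / c" using assms by (simp add: divide_right_mono)
  finally show ?thesis .
qed

text \<open>The pairs that are not independent are counted by choosing \<open>v\<close>, a coin in \<open>D v\<close>, and
  another \<open>v'\<close> affected by that coin.\<close>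

lemma chebyshev_random_subset:
  fixes f :: "'a \<Rightarrow> 'b set \<Rightarrow> real" and K n :: real
  assumes "finite A" "finite I" "card I \<le> n" "n > 0" "K \<ge> 0"
    and D: "\<And>v. v \<in> I \<Longrightarrow> D v \<subseteq> A" "\<And>v. v \<in> I \<Longrightarrow> card (D v) \<le> K"
    and D': "\<And>y. y \<in> A \<Longrightarrow> card {v\<in>I. y \<in> D v} \<le> K"
    and loc: "\<And>v S. v \<in> I \<Longrightarrow> S \<subseteq> A \<Longrightarrow> f v S = f v (S \<inter> D v)"
    and f: "\<And>v S. v \<in> I \<Longrightarrow> S \<subseteq> A \<Longrightarrow> 0 \<le> f v S \<and> f v S \<le> K"
  shows "pr (random_subset A p) {S. (\<Sum>v\<in>I. f v S) > expect (random_subset A p) (\<lambda>S. \<Sum>v\<in>I. f v S) + n}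
    \<le> K ^ 4 / n"
proof -
  let ?M = "random_subset A p"
  define m where "m v = expect ?M (f v)" for v
  define X where "X S = (\<Sum>v\<in>I. f v S)" for S
  have mX: "expect ?M X = (\<Sum>v\<in>I. m v)"
    unfolding X_def m_def using assms(1) by (intro Bochner_Integration.integral_sum) auto
  have m0: "m v \<ge> 0" if "v \<in> I" for v
    unfolding m_def using expect_random_subset_mono[OF assms(1), of "\<lambda>_. 0" "f v" p] f[OF that] by simp
  define C where "C v v' = expect ?M (\<lambda>S. (f v S - m v) * (f v' S - m v'))" for v v'
  have Ceq: "C v v' = expect ?M (\<lambda>S. f v S * f v' S) - m v * m v'" for v v'
  proof -
    have "C v v' = expect ?M (\<lambda>S. f v S * f v' S - m v * f v' S - m v' * f v S + m v * m v')"
      unfolding C_def by (intro Bochner_Integration.integral_cong) (auto simp: algebra_simps)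
    then show ?thesis using assms(1) by (simp add: m_def)
  qed
  have C0: "C v v' = 0" if "v \<in> I" "v' \<in> I" "D v \<inter> D v' = {}" for v v'
    unfolding Ceq m_def
    using expect_random_subset_indep[OF assms(1) D(1)[OF that(1)] D(1)[OF that(2)] that(3), of "f v" "f v'" p] loc that
    by auto
  have CK: "C v v' \<le> K\<^sup>2" if "v \<in> I" "v' \<in> I" for v v'
  proof -
    have "expect ?M (\<lambda>S. f v S * f v' S) \<le> expect ?M (\<lambda>_. K * K)"
      using f that assms(1,5) by (intro expect_random_subset_mono mult_mono) auto
    then show ?thesis unfolding Ceq using mult_nonneg_nonneg[OF m0[OF that(1)] m0[OF that(2)]] by (simp add: power2_eq_square)
  qed
  have var: "expect ?M (\<lambda>S. (X S - expect ?M X)\<^sup>2) \<le> n * K ^ 4"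
  proof -
    have "expect ?M (\<lambda>S. (X S - expect ?M X)\<^sup>2) = expect ?M (\<lambda>S. \<Sum>v\<in>I. \<Sum>v'\<in>I. (f v S - m v) * (f v' S - m v'))"
      unfolding mX X_def sum_subtractf[symmetric] power2_eq_square sum_product ..
    also have "\<dots> = (\<Sum>v\<in>I. \<Sum>v'\<in>I. C v v')"
      unfolding C_def using assms(1) by (simp add: Bochner_Integration.integral_sum)
    also have "\<dots> \<le> (\<Sum>v\<in>I. K ^ 4)"
    proof (intro sum_mono)
      fix v assume v: "v \<in> I"
      have fD: "finite (D v)" using D(1)[OF v] assms(1) finite_subset by blast
      define J where "J = (\<Union>y\<in>D v. {v'\<in>I. y \<in> D v'})"
      have "(\<Sum>v'\<in>I. C v v') = (\<Sum>v'\<in>J. C v v')"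
        using assms(2) C0[OF v] by (intro sum.mono_neutral_right) (auto simp: J_def)
      also have "\<dots> \<le> card J * K\<^sup>2"
        using CK[OF v] by (intro sum_bounded_above) (auto simp: J_def)
      also have "\<dots> \<le> (K * K) * K\<^sup>2"
      proof (intro mult_right_mono)
        have "card J \<le> (\<Sum>y\<in>D v. card {v'\<in>I. y \<in> D v'})"
          unfolding J_def by (rule card_UN_le[OF fD])
        then have "real (card J) \<le> (\<Sum>y\<in>D v. real (card {v'\<in>I. y \<in> D v'}))"
          unfolding of_nat_sum[symmetric] by (rule of_nat_mono)
        also have "\<dots> \<le> (\<Sum>y\<in>D v. K)"
          using D' D(1)[OF v] by (intro sum_mono) auto
        also have "\<dots> \<le> K * K" using D(2)[OF v] assms(5) by (simp add: mult_right_mono)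
        finally show "real (card J) \<le> K * K" .
      qed simp
      finally show "(\<Sum>v'\<in>I. C v v') \<le> K ^ 4"
        by (simp add: power2_eq_square power4_eq_xxxx mult.assoc)
    qed
    also have "\<dots> \<le> n * K ^ 4" using assms(3,5) by (simp add: mult_right_mono)
    finally show ?thesis .
  qed
  have "pr ?M {S. X S > expect ?M X + n} \<le> pr ?M {S. (X S - expect ?M X)\<^sup>2 / n\<^sup>2 \<ge> 1}"
  proof (intro measure_pmf.finite_measure_mono)
    show "{S. X S > expect ?M X + n} \<subseteq> {S. (X S - expect ?M X)\<^sup>2 / n\<^sup>2 \<ge> 1}"
      using assms(4) by (auto intro!: power_mono)
  qed simp
  also have "\<dots> = expect ?M (indicator {S. (X S - expect ?M X)\<^sup>2 / n\<^sup>2 \<ge> 1})" by simp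
  also have "\<dots> \<le> expect ?M (\<lambda>S. (X S - expect ?M X)\<^sup>2 / n\<^sup>2)"
    using assms(1) by (intro expect_random_subset_mono) (auto simp: indicator_def)
  also have "\<dots> = expect ?M (\<lambda>S. (X S - expect ?M X)\<^sup>2) / n\<^sup>2" by simp
  also have "\<dots> \<le> n * K ^ 4 / n\<^sup>2" using var by (intro divide_right_mono) auto
  also have "\<dots> = K ^ 4 / n" using assms(4) by (simp add: power2_eq_square)
  finally show ?thesis unfolding X_def[abs_def] .
qed

section \<open>Concentration in a graph with degree scales\<close>

text \<open>A single term of the exponential series. It turns a failure probability
  \<open>exp (- b)\<close> into any desired negative power of \<open>b\<close>.\<close>

lemma power_over_fact_le_exp:
  fixes x :: real
  assumes "x \<ge> 0"
  shows "x ^ k / fact k \<le> exp x"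
proof -
  have "(\<Sum>i\<in>{k}. x ^ i /\<^sub>R fact i) \<le> (\<Sum>i. x ^ i /\<^sub>R fact i)"
    using assms by (intro sum_le_suminf) (auto simp: summable_exp)
  then show ?thesis by (simp add: exp_def divide_inverse mult.commute)
qed

lemma sum_inverse_squares_le:
  assumes "finite B" "\<And>k. k \<in> B \<Longrightarrow> k \<ge> 1"
  shows "(\<Sum>k\<in>B. 1 / real k ^ 2) \<le> 2"
proof -
  \<comment> \<open>The induction needs the stronger bound \<open>2 - 1/m\<close>: the next term is
    at most \<open>1/m - 1/(m+1)\<close>, which telescopes.\<close>
  have *: "(\<Sum>k=1..Suc m. 1 / real k ^ 2) \<le> 2 - 1 / real (Suc m)" for m
  proof (induction m)
    case (Suc m)
    have "(\<Sum>k=1..Suc (Suc m). 1 / real k ^ 2) = (\<Sum>k=1..Suc m. 1 / real k ^ 2) + 1 / real (Suc (Suc m)) ^ 2"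
      by simp
    also have "\<dots> \<le> 2 - 1 / real (Suc m) + 1 / real (Suc (Suc m)) ^ 2" using Suc by simp
    also have "1 / real (Suc (Suc m)) ^ 2 \<le> 1 / (real (Suc m) * real (Suc (Suc m)))"
      by (intro divide_left_mono) (auto simp: power2_eq_square)
    also have "1 / (real (Suc m) * real (Suc (Suc m))) = 1 / real (Suc m) - 1 / real (Suc (Suc m))"
      by (simp add: field_simps)
    finally show ?case by simp
  qed simp
  have "B \<subseteq> {1..Suc (Max (insert 0 B))}" using assms by (auto intro!: le_SucI)
  then have "(\<Sum>k\<in>B. 1 / real k ^ 2) \<le> (\<Sum>k=1..Suc (Max (insert 0 B)). 1 / real k ^ 2)"
    by (intro sum_mono2) auto
  also have "\<dots> \<le> 2 - 1 / real (Suc (Max (insert 0 B)))" by (rule *)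
  also have "\<dots> \<le> 2" by simp
  finally show ?thesis .
qed

text \<open>The sets are the cyclic intervals of length \<open>t\<close> in an enumeration of \<open>Q\<close>.\<close>

lemma uniform_subsets:
  assumes "finite Q" "t \<le> card Q"
  obtains T where "\<And>v. v \<in> Q \<Longrightarrow> T v \<subseteq> Q" "\<And>v. v \<in> Q \<Longrightarrow> card (T v) = t"
    "\<And>x. card {v\<in>Q. x \<in> T v} \<le> t"
proof -
  define m where "m = card Q"
  obtain h where h: "bij_betw h {..<m} Q"
    using ex_bij_betw_nat_finite[OF assms(1)] by (auto simp: m_def atLeast0LessThan)
  define g where "g = inv_into {..<m} h"
  have g: "g v < m" "h (g v) = v" if "v \<in> Q" for v
    using h that by (auto simp: g_def bij_betw_def inv_into_into f_inv_into_f)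
  have gh: "g (h i) = i" if "i < m" for i
    using h that by (auto simp: g_def bij_betw_def)
  have hQ: "h i \<in> Q" if "i < m" for i using h that by (auto simp: bij_betw_def)
  have tm: "t \<le> m" using assms(2) by (simp add: m_def)
  define T where "T v = (\<lambda>j. h ((g v + j) mod m)) ` {..<t}" for v
  show ?thesis
  proof
    fix v assume v: "v \<in> Q"
    then have m0: "m > 0" using g(1)[OF v] by simp
    then show "T v \<subseteq> Q" using hQ by (auto simp: T_def)
    have "inj_on (\<lambda>j. h ((g v + j) mod m)) {..<t}"
    proof (rule inj_onI)
      fix i j assume ij: "i \<in> {..<t}" "j \<in> {..<t}" "h ((g v + i) mod m) = h ((g v + j) mod m)"
      have "g (h ((g v + i) mod m)) = g (h ((g v + j) mod m))" using ij(3) by (rule arg_cong)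
      then have "(g v + i) mod m = (g v + j) mod m" using m0 by (simp add: gh)
      then show "i = j" using ij(1,2) tm g(1)[OF v] by (auto simp: mod_if split: if_splits)
    qed
    then show "card (T v) = t" by (simp add: T_def card_image)
  next
    fix x
    \<comment> \<open>An interval containing \<open>x\<close> starts at one of the \<open>t\<close>
      cyclic positions ending at that of \<open>x\<close>; adding \<open>m - j\<close> is
      subtracting \<open>j\<close> modulo \<open>m\<close>.\<close>
    have "{v\<in>Q. x \<in> T v} \<subseteq> (\<lambda>j. h ((g x + (m - j)) mod m)) ` {..<t}"
    proof
      fix v assume v: "v \<in> {v\<in>Q. x \<in> T v}"
      then obtain j where j: "j < t" "x = h ((g v + j) mod m)" by (auto simp: T_def)
      have vQ: "v \<in> Q" using v by simp
      have "m > 0" using g(1)[OF vQ] by simp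
      then have "g x = (g v + j) mod m" unfolding j(2) by (intro gh) simp
      then have "(g x + (m - j)) mod m = g v"
        using g(1)[OF vQ] j(1) tm by (auto simp: mod_if split: if_splits)
      then show "v \<in> (\<lambda>j. h ((g x + (m - j)) mod m)) ` {..<t}"
        using j(1) g(2)[OF vQ] by (intro image_eqI[of _ _ j]) auto
    qed
    then have "card {v\<in>Q. x \<in> T v} \<le> card ((\<lambda>j. h ((g x + (m - j)) mod m)) ` {..<t})"
      by (intro card_mono) auto
    also have "\<dots> \<le> t" using card_image_le[of "{..<t}"] by simp
    finally show "card {v\<in>Q. x \<in> T v} \<le> t" .
  qed
qed

text \<open>Twice the number of edges inside \<open>S\<close> if \<open>N\<close> is a symmetric
  neighbourhood function.\<close>

definition degree_sum :: "('a \<Rightarrow> 'a set) \<Rightarrow> 'a set \<Rightarrow> nat" where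
  "degree_sum N S = (\<Sum>v\<in>S. card (N v \<inter> S))"

text \<open>A common bound for the loss in the constant at each stage. The largest loss,
  \<open>2^27 * fact 28 + 2\<close>, comes from the dense vertices at the stage with exponent
  \<open>5\<close>.\<close>

definition growth :: real where "growth = 2 ^ 28 * fact 28"

text \<open>Sampling is restricted to vertices with \<open>b\<close> between \<open>lo\<close> and \<open>hi\<close>. The two cases of the last
  assumption are those of Markov's and of Chebyshev's inequality.\<close>

locale degree_scale =
  fixes V :: "'a set" and N :: "'a \<Rightarrow> 'a set" and b :: "'a \<Rightarrow> nat" and lo hi eps :: real
  assumes finV: "finite V" and V_ne: "V \<noteq> {}"
    and N_sub: "\<And>v. N v \<subseteq> V"
    and N_sym: "\<And>u v. u \<in> N v \<Longrightarrow> v \<in> N u"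
    and N_irrefl: "\<And>v. v \<notin> N v"
    and b_pos: "\<And>v. b v \<ge> 1"
    and b_le: "\<And>v. N v \<noteq> {} \<Longrightarrow> b v ^ 27 \<le> card (N v)"
    and deg_le: "\<And>v. card (N v) \<le> 2 ^ 27 * b v ^ 27"
    and lo: "lo \<ge> 1" and hi: "hi \<ge> 1"
    and regime: "1 / lo \<le> eps \<or> (2 ^ 55 * hi ^ 73) ^ 4 / real (card V) \<le> eps"
begin

definition scale :: "'a set \<Rightarrow> bool" where
  "scale A \<longleftrightarrow> A \<subseteq> V \<and> (\<forall>v\<in>A. lo \<le> b v \<and> b v \<le> hi)"

abbreviation deg :: "'a \<Rightarrow> real" where
  "deg v \<equiv> real (card (N v))"

definition sprob :: "nat \<Rightarrow> 'a \<Rightarrow> real" where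
  "sprob e v = 1 / real (b v) ^ e"

abbreviation ecount :: "'a set \<Rightarrow> nat" where
  "ecount \<equiv> degree_sum N"

abbreviation sampled :: "nat \<Rightarrow> 'a set \<Rightarrow> 'a set pmf" where
  "sampled e A \<equiv> random_subset A (sprob e)"

text \<open>A superset of the survivors that depends only on the sample. A vertex near a sampled one
  is covered by any maximal independent set of the sample; at distance \<open>2\<close>, coverage is
  certain only if \<open>x\<close> is forced into the set because all its sampled neighbours have
  smaller \<open>b\<close>.\<close>

definition alive :: "'a set \<Rightarrow> 'a set \<Rightarrow> 'a set" where
  "alive A S = {v\<in>A. v \<notin> S \<and> N v \<inter> S = {} \<and>
     (\<forall>w\<in>N v. \<forall>x\<in>N w \<inter> S. \<exists>u\<in>N x \<inter> S. b x \<le> b u)}"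

abbreviation n :: real where "n \<equiv> real (card V)"

text \<open>One bound for the locality and for the size of all summands. The extreme case is the
  number of lucky vertices affected by one coin, where \<open>55 = 28 + 27\<close> and
  \<open>73 = 27 + 27 + 19\<close>.\<close>

abbreviation K :: real where "K \<equiv> 2 ^ 55 * hi ^ 73"

lemma n_pos: "n > 0" using finV V_ne by (simp add: card_gt_0_iff)

lemma finN [simp]: "finite (N v)" using N_sub finV finite_subset by blast

lemma scale_finite: "scale A \<Longrightarrow> finite A" using finV finite_subset by (auto simp: scale_def)

lemma scale_sub: "scale A \<Longrightarrow> A \<subseteq> V" by (simp add: scale_def)

lemma b_ge1: "real (b v) \<ge> 1" using b_pos[of v] by linarith

lemma sprob_pos: "sprob e v > 0" using b_ge1[of v] by (simp add: sprob_def)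

lemma sprob_le1: "sprob e v \<le> 1" using b_ge1[of v] by (simp add: sprob_def)

lemma sprob_ok: "0 \<le> sprob e v \<and> sprob e v \<le> 1" using sprob_pos[of e v] sprob_le1[of e v] by simp

lemma sprob_antimono: "e \<le> e' \<Longrightarrow> sprob e' v \<le> sprob e v"
  unfolding sprob_def using b_ge1[of v] by (intro divide_left_mono power_increasing mult_pos_pos zero_less_power) auto

lemma sprob_add: "sprob (e + e') v = sprob e v * sprob e' v" by (simp add: sprob_def power_add)

lemma sprob_mono: "b u \<le> b v \<Longrightarrow> sprob e v \<le> sprob e u"
  unfolding sprob_def using b_pos[of u] b_pos[of v]
  by (intro divide_left_mono power_mono mult_pos_pos zero_less_power) auto

lemma deg_hi: "scale A \<Longrightarrow> v \<in> A \<Longrightarrow> deg v \<le> 2 ^ 27 * hi ^ 27"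
proof -
  assume "scale A" "v \<in> A"
  have "deg v \<le> 2 ^ 27 * real (b v) ^ 27"
    using of_nat_mono[OF deg_le[of v], where ?'a = real] by simp
  also have "\<dots> \<le> 2 ^ 27 * hi ^ 27"
    using \<open>scale A\<close> \<open>v \<in> A\<close> by (intro mult_left_mono power_mono) (auto simp: scale_def)
  finally show ?thesis .
qed

lemma hi_K: "c \<le> 2 ^ 55 \<Longrightarrow> k \<le> 73 \<Longrightarrow> c * hi ^ k \<le> K"
  using hi by (intro mult_mono power_increasing) auto

lemma K_nonneg: "K \<ge> 0" using hi by simp

text \<open>Every application proves its mean bound with a spare factor \<open>lo\<close>. Markov's
  inequality compares a mean of at most \<open>C * n / lo\<close> with \<open>(C + 1) * n\<close>
  and fails with probability at most \<open>1 / lo\<close>. For Chebyshev's inequality a mean of at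
  most \<open>C * n\<close> is enough, and the deviation \<open>n\<close> costs
  \<open>K^4 / n\<close>.\<close>

lemma concentration:
  fixes f :: "'a \<Rightarrow> 'a set \<Rightarrow> real"
  assumes A: "scale A" and I: "I \<subseteq> A" and C: "C \<ge> 0"
    and D: "\<And>v. v \<in> I \<Longrightarrow> D v \<subseteq> A" "\<And>v. v \<in> I \<Longrightarrow> card (D v) \<le> K"
    and D': "\<And>y. y \<in> A \<Longrightarrow> card {v\<in>I. y \<in> D v} \<le> K"
    and loc: "\<And>v S. v \<in> I \<Longrightarrow> S \<subseteq> A \<Longrightarrow> f v S = f v (S \<inter> D v)"
    and f: "\<And>v S. v \<in> I \<Longrightarrow> S \<subseteq> A \<Longrightarrow> 0 \<le> f v S \<and> f v S \<le> K"
    and E: "lo * (\<Sum>v\<in>I. expect (random_subset A p) (f v)) \<le> C * n"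
  shows "pr (random_subset A p) {S. (\<Sum>v\<in>I. f v S) > (C + 1) * n} \<le> eps"
proof -
  let ?M = "random_subset A p" and ?X = "\<lambda>S. \<Sum>v\<in>I. f v S"
  have fA: "finite A" "finite I" using scale_finite[OF A] I finite_subset by auto
  have EX: "expect ?M ?X = (\<Sum>v\<in>I. expect ?M (f v))"
    using fA by (intro Bochner_Integration.integral_sum) auto
  have X0: "0 \<le> ?X S" if "S \<subseteq> A" for S using f that by (intro sum_nonneg) auto
  have E0: "expect ?M ?X \<ge> 0"
    using expect_random_subset_mono[OF fA(1), of "\<lambda>_. 0" ?X p] X0 by simp
  from regime show ?thesis
  proof
    assume r: "1 / lo \<le> eps"
    have "expect ?M ?X \<le> C * n / lo" using E lo unfolding EX by (simp add: field_simps)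
    then have "pr ?M {S. ?X S > (C + 1) * n} \<le> (C * n / lo) / ((C + 1) * n)"
      using C n_pos X0 by (intro markov_random_subset fA) auto
    also have "\<dots> \<le> 1 / lo"
    proof -
      have "C * n / lo \<le> 1 / lo * ((C + 1) * n)" using C lo n_pos by (simp add: divide_right_mono)
      then show ?thesis using C n_pos by (subst pos_divide_le_eq) auto
    qed
    finally show ?thesis using r by simp
  next
    assume r: "K ^ 4 / n \<le> eps"
    have "expect ?M ?X \<le> lo * expect ?M ?X" using lo E0 by (simp add: mult_le_cancel_right1)
    also have "\<dots> \<le> C * n" using E by (simp add: EX)
    finally have "{S. ?X S > (C + 1) * n} \<subseteq> {S. ?X S > expect ?M ?X + n}" by (auto simp: algebra_simps)
    then have "pr ?M {S. ?X S > (C + 1) * n} \<le> pr ?M {S. ?X S > expect ?M ?X + n}"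
      by (intro measure_pmf.finite_measure_mono) auto
    also have "\<dots> \<le> K ^ 4 / n"
    proof (rule chebyshev_random_subset[where f = f and D = D and K = K, OF fA(1,2) _ n_pos K_nonneg D D' loc f])
      show "real (card I) \<le> n" using I scale_sub[OF A] finV by (auto intro!: card_mono)
    qed auto
    finally show ?thesis using r by simp
  qed
qed

text \<open>An edge meeting \<open>X\<close> is charged to an end in \<open>X\<close>, any other
  edge to an end of larger \<open>b\<close>. Each edge gives two ordered pairs, whence the factors
  \<open>2\<close>.\<close>

lemma ecount_le:
  assumes "S \<subseteq> V" "X \<subseteq> V"
  shows "ecount S \<le> 2 * (\<Sum>v\<in>X. card (N v)) + 2 * (\<Sum>v\<in>S - X. card {u\<in>N v \<inter> S - X. b u \<le> b v})"
proof -
  have fin: "finite S" "finite X" using assms finV finite_subset by auto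
  define P where "P = (SIGMA v:X. N v)"
  define Q where "Q = (SIGMA v:S - X. {u\<in>N v \<inter> S - X. b u \<le> b v})"
  have fPQ: "finite P" "finite Q" unfolding P_def Q_def using fin by auto
  have "ecount S = card (SIGMA v:S. N v \<inter> S)" using fin by (simp add: degree_sum_def)
  also have "\<dots> \<le> card ((P \<union> prod.swap ` P) \<union> (Q \<union> prod.swap ` Q))"
  proof (rule card_mono)
    show "(SIGMA v:S. N v \<inter> S) \<subseteq> (P \<union> prod.swap ` P) \<union> (Q \<union> prod.swap ` Q)"
    proof (rule subrelI)
      fix v u assume "(v, u) \<in> (SIGMA v:S. N v \<inter> S)"
      then have *: "v \<in> S" "u \<in> N v" "u \<in> S" "v \<in> N u" using N_sym by auto
      consider "v \<in> X" | "u \<in> X" | "v \<notin> X" "u \<notin> X" "b u \<le> b v" | "v \<notin> X" "u \<notin> X" "b v \<le> b u" by linarith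
      then show "(v, u) \<in> (P \<union> prod.swap ` P) \<union> (Q \<union> prod.swap ` Q)"
      proof cases
        case 1 then have "(v, u) \<in> P" using * by (simp add: P_def)
        then show ?thesis by simp
      next
        case 2 then have "(u, v) \<in> P" using * by (simp add: P_def)
        then show ?thesis by (simp add: pair_in_swap_image)
      next
        case 3 then have "(v, u) \<in> Q" using * by (simp add: Q_def)
        then show ?thesis by simp
      next
        case 4 then have "(u, v) \<in> Q" using * by (simp add: Q_def)
        then show ?thesis by (simp add: pair_in_swap_image)
      qed
    qed
  qed (use fPQ in auto)
  also have "\<dots> \<le> (card P + card (prod.swap ` P)) + (card Q + card (prod.swap ` Q))"
    by (meson add_mono card_Un_le order_trans)
  also have "\<dots> \<le> 2 * card P + 2 * card Q"
    using card_image_le[OF fPQ(1), of prod.swap] card_image_le[OF fPQ(2), of prod.swap] by linarith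
  finally show ?thesis using fin by (simp add: P_def Q_def)
qed

lemma card_touching:
  assumes "\<And>v. v \<in> I \<Longrightarrow> Q v \<subseteq> N v" "scale A" "y \<in> A"
  shows "card {v\<in>I. y \<in> insert v (Q v)} \<le> 2 ^ 28 * hi ^ 27"
proof -
  have "{v\<in>I. y \<in> insert v (Q v)} \<subseteq> insert y (N y)" using assms(1) N_sym by auto
  then have "card {v\<in>I. y \<in> insert v (Q v)} \<le> card (insert y (N y))" by (intro card_mono) auto
  also have "\<dots> \<le> 1 + card (N y)" by (simp add: card_insert_if)
  finally have "real (card {v\<in>I. y \<in> insert v (Q v)}) \<le> 1 + card (N y)" by linarith
  also have "\<dots> \<le> hi ^ 27 + 2 ^ 27 * hi ^ 27"
    using deg_hi[OF assms(2,3)] one_le_power[OF hi, of 27] by linarith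
  also have "\<dots> \<le> 2 ^ 28 * hi ^ 27" using hi by simp
  finally show ?thesis .
qed

text \<open>The vertices of \<open>X\<close> are exempt from probabilistic estimates because their
  total degree is already affordable. The other edges are counted at the end of larger
  \<open>b\<close>, from which the estimate for exponent \<open>5\<close> can be made.\<close>

lemma ecount_concentration:
  assumes A: "scale A" and X: "X \<subseteq> A" and C: "C1 \<ge> 0" "C2 \<ge> 0"
    and X1: "(\<Sum>v\<in>X. deg v) \<le> C1 * n"
    and E: "lo * (\<Sum>v\<in>A - X. \<Sum>u\<in>{u\<in>N v \<inter> A - X. b u \<le> b v}. sprob e u * sprob e v) \<le> C2 * n"
  shows "pr (sampled e A) {S. S \<subseteq> A \<and> real (ecount S) > (2 * C1 + 2 * C2 + 2) * n} \<le> eps"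
proof -
  let ?M = "sampled e A"
  define Q where "Q v = {u\<in>N v \<inter> A - X. b u \<le> b v}" for v
  have fA: "finite A" using A by (rule scale_finite)
  have fQ: "finite (Q v)" for v by (simp add: Q_def)
  define f where "f v S = indicator S v * (\<Sum>u\<in>Q v. indicator S u :: real)" for v S
  have cQ: "real (card (Q v)) \<le> 2 ^ 27 * hi ^ 27" if "v \<in> A" for v
  proof -
    have "card (Q v) \<le> card (N v)" by (intro card_mono) (auto simp: Q_def)
    then show ?thesis using deg_hi[OF A that] by linarith
  qed
  have "{S. S \<subseteq> A \<and> real (ecount S) > (2 * C1 + 2 * C2 + 2) * n} \<subseteq> {S. (\<Sum>v\<in>A - X. f v S) > (C2 + 1) * n}"
  proof safe
    fix S assume S: "S \<subseteq> A" "real (ecount S) > (2 * C1 + 2 * C2 + 2) * n"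
    have "S \<subseteq> V" "X \<subseteq> V" using S(1) X scale_sub[OF A] by auto
    from of_nat_mono[OF ecount_le[OF this], where ?'a = real]
    have "real (ecount S) \<le> 2 * (\<Sum>v\<in>X. deg v) + 2 * (\<Sum>v\<in>S - X. real (card {u\<in>N v \<inter> S - X. b u \<le> b v}))"
      by simp
    also have "(\<Sum>v\<in>S - X. real (card {u\<in>N v \<inter> S - X. b u \<le> b v})) = (\<Sum>v\<in>A - X. f v S)"
    proof -
      have "(\<Sum>v\<in>A - X. f v S) = (\<Sum>v\<in>S - X. f v S)"
        using fA S(1) by (intro sum.mono_neutral_right) (auto simp: f_def indicator_def split: if_splits)
      also have "\<dots> = (\<Sum>v\<in>S - X. real (card {u\<in>N v \<inter> S - X. b u \<le> b v}))"
      proof (intro sum.cong refl)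
        fix v assume "v \<in> S - X"
        have "Q v \<inter> S = {u\<in>N v \<inter> S - X. b u \<le> b v}" using S(1) by (auto simp: Q_def)
        moreover have "(\<Sum>u\<in>Q v. indicator S u :: real) = real (card (Q v \<inter> S))"
          using fQ[of v] by (simp add: indicator_def Int_def)
        ultimately show "f v S = real (card {u\<in>N v \<inter> S - X. b u \<le> b v})"
          using \<open>v \<in> S - X\<close> by (simp add: f_def)
      qed
      finally show ?thesis by simp
    qed
    finally show "(\<Sum>v\<in>A - X. f v S) > (C2 + 1) * n" using S(2) X1 by (simp add: algebra_simps)
  qed
  then have "pr ?M {S. S \<subseteq> A \<and> real (ecount S) > (2 * C1 + 2 * C2 + 2) * n}
      \<le> pr ?M {S. (\<Sum>v\<in>A - X. f v S) > (C2 + 1) * n}"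
    by (intro measure_pmf.finite_measure_mono) auto
  also have "\<dots> \<le> eps"
  proof (rule concentration[OF A, where D = "\<lambda>v. insert v (Q v)"])
    show "A - X \<subseteq> A" by auto
    show "insert v (Q v) \<subseteq> A" if "v \<in> A - X" for v using that by (auto simp: Q_def)
    show "real (card (insert v (Q v))) \<le> K" if "v \<in> A - X" for v
    proof -
      have "real (card (insert v (Q v))) \<le> 1 + card (Q v)" using fQ[of v] by (simp add: card_insert_if)
      also have "\<dots> \<le> hi ^ 27 + 2 ^ 27 * hi ^ 27"
        using cQ[of v] that one_le_power[OF hi, of 27] by auto
      also have "\<dots> \<le> 2 ^ 28 * hi ^ 27" using hi by simp
      also have "\<dots> \<le> K" by (rule hi_K) auto
      finally show ?thesis .
    qed
    show "real (card {v\<in>A - X. y \<in> insert v (Q v)}) \<le> K" if "y \<in> A" for y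
    proof -
      have "real (card {v\<in>A - X. y \<in> insert v (Q v)}) \<le> 2 ^ 28 * hi ^ 27"
        by (rule card_touching[OF _ A that]) (auto simp: Q_def)
      also have "\<dots> \<le> K" by (rule hi_K) auto
      finally show ?thesis .
    qed
    show "f v S = f v (S \<inter> insert v (Q v))" if "S \<subseteq> A" for v S
      by (auto simp: f_def indicator_def intro!: sum.cong)
    show "0 \<le> f v S \<and> f v S \<le> K" if v: "v \<in> A - X" for v S
    proof
      show "0 \<le> f v S" by (auto simp: f_def intro!: mult_nonneg_nonneg sum_nonneg)
      have "f v S \<le> 1 * (\<Sum>u\<in>Q v. 1)"
        unfolding f_def by (intro mult_mono sum_mono sum_nonneg) (auto simp: indicator_def)
      also have "\<dots> \<le> 2 ^ 27 * hi ^ 27" using cQ[of v] v by simp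
      also have "\<dots> \<le> K" by (rule hi_K) auto
      finally show "f v S \<le> K" .
    qed
    have "expect ?M (f v) = (\<Sum>u\<in>Q v. sprob e u * sprob e v)" if v: "v \<in> A - X" for v
    proof -
      have "expect ?M (f v) = (\<Sum>u\<in>Q v. expect ?M (\<lambda>S. indicator S u * indicator S v))"
        unfolding f_def sum_distrib_left using fA
        by (subst Bochner_Integration.integral_sum[symmetric]) (auto simp: mult.commute)
      also have "\<dots> = (\<Sum>u\<in>Q v. sprob e u * sprob e v)"
        using v N_irrefl sprob_ok by (intro sum.cong refl expect_random_subset_elem2 fA) (auto simp: Q_def)
      finally show ?thesis .
    qed
    then show "lo * (\<Sum>v\<in>A - X. expect ?M (f v)) \<le> C2 * n" using E by (simp add: Q_def)
  qed (use C in auto)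
  finally show ?thesis .
qed

text \<open>By \<open>x * y <= (x^2 + y^2) / 2\<close> and symmetry, the mean is at most the sum of
  \<open>deg v * (sprob e v)^2\<close>. Each term is at most \<open>2^27 * b^27 / b^28\<close>, and
  the remaining \<open>1 / b\<close> supplies the factor \<open>1 / lo\<close>.\<close>

lemma ecount_concentration_basic:
  assumes A: "scale A" and "e \<ge> 14"
  shows "pr (sampled e A) {S. S \<subseteq> A \<and> real (ecount S) > (2 * 2 ^ 27 + 2) * n} \<le> eps"
proof -
  have fA: "finite A" using A by (rule scale_finite)
  have "(\<Sum>v\<in>A. \<Sum>u\<in>{u\<in>N v \<inter> A. b u \<le> b v}. sprob e u * sprob e v) \<le> (\<Sum>v\<in>A. \<Sum>u\<in>N v \<inter> A. sprob e u * sprob e v)"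
    using sprob_ok by (intro sum_mono sum_mono2) (auto intro!: mult_nonneg_nonneg)
  also have "\<dots> \<le> (\<Sum>v\<in>A. \<Sum>u\<in>N v \<inter> A. ((sprob e u)\<^sup>2 + (sprob e v)\<^sup>2) / 2)"
  proof (intro sum_mono)
    fix u v show "sprob e u * sprob e v \<le> ((sprob e u)\<^sup>2 + (sprob e v)\<^sup>2) / 2"
      using sum_squares_bound[of "sprob e u" "sprob e v"] by simp
  qed
  also have "\<dots> = (\<Sum>v\<in>A. \<Sum>u\<in>N v \<inter> A. (sprob e u)\<^sup>2 / 2) + (\<Sum>v\<in>A. \<Sum>u\<in>N v \<inter> A. (sprob e v)\<^sup>2 / 2)"
    by (simp add: sum.distrib add_divide_distrib)
  also have "(\<Sum>v\<in>A. \<Sum>u\<in>N v \<inter> A. (sprob e u)\<^sup>2 / 2) = (\<Sum>v\<in>A. \<Sum>u\<in>N v \<inter> A. (sprob e v)\<^sup>2 / 2)"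
  proof -
    have "(\<Sum>v\<in>A. \<Sum>u\<in>N v \<inter> A. (sprob e u)\<^sup>2 / 2) = (\<Sum>v\<in>A. \<Sum>u\<in>{u\<in>A. u \<in> N v}. (sprob e u)\<^sup>2 / 2)"
      by (intro sum.cong) auto
    also have "\<dots> = (\<Sum>u\<in>A. \<Sum>v\<in>{v\<in>A. u \<in> N v}. (sprob e u)\<^sup>2 / 2)"
      by (rule sum.swap_restrict[OF fA fA])
    also have "\<dots> = (\<Sum>u\<in>A. \<Sum>v\<in>N u \<inter> A. (sprob e u)\<^sup>2 / 2)"
      using N_sym by (intro sum.cong) auto
    finally show ?thesis .
  qed
  also have "(\<Sum>v\<in>A. \<Sum>u\<in>N v \<inter> A. (sprob e v)\<^sup>2 / 2) + (\<Sum>v\<in>A. \<Sum>u\<in>N v \<inter> A. (sprob e v)\<^sup>2 / 2) = (\<Sum>v\<in>A. card (N v \<inter> A) * (sprob e v)\<^sup>2)"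
    unfolding sum.distrib[symmetric] by (intro sum.cong) auto
  also have "\<dots> \<le> (\<Sum>v\<in>A. 2 ^ 27 / lo)"
  proof (intro sum_mono)
    fix v assume v: "v \<in> A"
    have "card (N v \<inter> A) \<le> card (N v)" by (intro card_mono) auto
    then have "card (N v \<inter> A) \<le> 2 ^ 27 * b v ^ 27" using deg_le[of v] by linarith
    from of_nat_mono[OF this, where ?'a = real]
    have 1: "real (card (N v \<inter> A)) \<le> 2 ^ 27 * real (b v) ^ 27" by simp
    have "real (card (N v \<inter> A)) * (sprob e v)\<^sup>2 \<le> (2 ^ 27 * real (b v) ^ 27) * (sprob 14 v)\<^sup>2"
      using 1 sprob_ok sprob_antimono[OF assms(2)] by (intro mult_mono power_mono) auto
    also have "\<dots> = 2 ^ 27 / real (b v)"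
      using b_ge1[of v] by (simp add: sprob_def power_divide power_mult[symmetric] field_simps flip: power_Suc power_Suc2)
    also have "\<dots> \<le> 2 ^ 27 / lo" using A v lo by (intro divide_left_mono) (auto simp: scale_def)
    finally show "real (card (N v \<inter> A)) * (sprob e v)\<^sup>2 \<le> 2 ^ 27 / lo" .
  qed
  also have "\<dots> = card A * (2 ^ 27 / lo)" by simp
  also have "\<dots> \<le> n * (2 ^ 27 / lo)"
    using scale_sub[OF A] finV lo by (intro mult_right_mono) (auto intro!: card_mono)
  finally have "lo * (\<Sum>v\<in>A. \<Sum>u\<in>{u\<in>N v \<inter> A. b u \<le> b v}. sprob e u * sprob e v) \<le> 2 ^ 27 * n"
    using lo by (simp add: field_simps)
  then show ?thesis
    using ecount_concentration[OF A, of "{}" 0 "2 ^ 27" e] by simp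
qed

section \<open>Vertices that expect many sampled neighbours\<close>

definition dense :: "nat \<Rightarrow> 'a set \<Rightarrow> 'a set" where
  "dense e A = {v\<in>A. (\<Sum>u\<in>N v \<inter> A. sprob e u) \<ge> b v}"

text \<open>A dense vertex sees no sampled neighbour with probability at most
  \<open>exp (- b) <= fact 28 / b^28\<close>. This beats its degree, at most
  \<open>2^27 * b^27\<close>, by one power of \<open>b\<close>, again the spare factor.\<close>

lemma dense_concentration:
  assumes A: "scale A"
  shows "pr (sampled e A)
    {S. S \<subseteq> A \<and> (\<Sum>v\<in>{v\<in>dense e A. N v \<inter> S = {}}. deg v) > (2 ^ 27 * fact 28 + 1) * n} \<le> eps"
proof -
  let ?M = "sampled e A"
  have fA: "finite A" using A by (rule scale_finite)
  have GA: "dense e A \<subseteq> A" "finite (dense e A)" using fA by (auto simp: dense_def)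
  define f where "f v S = (if (N v \<inter> A) \<inter> S = {} then deg v else 0)" for v S
  have "{S. S \<subseteq> A \<and> (\<Sum>v\<in>{v\<in>dense e A. N v \<inter> S = {}}. deg v) > (2 ^ 27 * fact 28 + 1) * n}
      \<subseteq> {S. (\<Sum>v\<in>dense e A. f v S) > (2 ^ 27 * fact 28 + 1) * n}"
  proof safe
    fix S assume S: "S \<subseteq> A" "(\<Sum>v\<in>{v\<in>dense e A. N v \<inter> S = {}}. deg v) > (2 ^ 27 * fact 28 + 1) * n"
    have "(\<Sum>v\<in>dense e A. f v S) = (\<Sum>v\<in>{v\<in>dense e A. (N v \<inter> A) \<inter> S = {}}. deg v)"
      unfolding f_def using GA(2) by (simp add: sum.If_cases Int_def)
    also have "{v\<in>dense e A. (N v \<inter> A) \<inter> S = {}} = {v\<in>dense e A. N v \<inter> S = {}}" using S(1) by auto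
    finally show "(\<Sum>v\<in>dense e A. f v S) > (2 ^ 27 * fact 28 + 1) * n" using S(2) by simp
  qed
  then have "pr ?M {S. S \<subseteq> A \<and> (\<Sum>v\<in>{v\<in>dense e A. N v \<inter> S = {}}. deg v) > (2 ^ 27 * fact 28 + 1) * n}
      \<le> pr ?M {S. (\<Sum>v\<in>dense e A. f v S) > (2 ^ 27 * fact 28 + 1) * n}"
    by (intro measure_pmf.finite_measure_mono) auto
  also have "\<dots> \<le> eps"
  proof (rule concentration[OF A GA(1), where D = "\<lambda>v. N v \<inter> A"])
    show "real (card (N v \<inter> A)) \<le> K" if "v \<in> dense e A" for v
    proof -
      have "card (N v \<inter> A) \<le> card (N v)" by (intro card_mono) auto
      then have "real (card (N v \<inter> A)) \<le> 2 ^ 27 * hi ^ 27" using deg_hi[OF A, of v] that GA(1) by fastforce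
      also have "\<dots> \<le> K" by (rule hi_K) auto
      finally show ?thesis .
    qed
    show "real (card {v\<in>dense e A. y \<in> N v \<inter> A}) \<le> K" if "y \<in> A" for y
    proof -
      have "card {v\<in>dense e A. y \<in> N v \<inter> A} \<le> card (N y)" using N_sym by (intro card_mono) auto
      then have "real (card {v\<in>dense e A. y \<in> N v \<inter> A}) \<le> 2 ^ 27 * hi ^ 27" using deg_hi[OF A that] by linarith
      also have "\<dots> \<le> K" by (rule hi_K) auto
      finally show ?thesis .
    qed
    show "f v S = f v (S \<inter> (N v \<inter> A))" for v S by (simp add: f_def Int_ac)
    show "0 \<le> f v S \<and> f v S \<le> K" if "v \<in> dense e A" for v S
    proof -
      have "deg v \<le> 2 ^ 27 * hi ^ 27" using deg_hi[OF A, of v] that GA(1) by auto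
      also have "\<dots> \<le> K" by (rule hi_K) auto
      finally show ?thesis using K_nonneg by (auto simp: f_def)
    qed
    have "expect ?M (f v) \<le> 2 ^ 27 * fact 28 / lo" if v: "v \<in> dense e A" for v
    proof -
      have "expect ?M (f v) = expect ?M (\<lambda>S. deg v * indicator {S. (N v \<inter> A) \<inter> S = {}} S)"
        by (intro Bochner_Integration.integral_cong) (auto simp: f_def indicator_def)
      also have "\<dots> = deg v * pr ?M {S. (N v \<inter> A) \<inter> S = {}}" by simp
      also have "\<dots> \<le> (2 ^ 27 * real (b v) ^ 27) * exp (- (\<Sum>u\<in>N v \<inter> A. sprob e u))"
        using of_nat_mono[OF deg_le[of v], where ?'a = real] sprob_ok fA
        by (intro mult_mono pr_random_subset_disjoint_le) auto
      also have "\<dots> \<le> (2 ^ 27 * real (b v) ^ 27) * (fact 28 / real (b v) ^ 28)"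
      proof (intro mult_left_mono)
        have "exp (- (\<Sum>u\<in>N v \<inter> A. sprob e u)) \<le> exp (- real (b v))" using v by (simp add: dense_def)
        also have "\<dots> = 1 / exp (real (b v))" by (simp add: exp_minus divide_inverse)
        also have "\<dots> \<le> 1 / (real (b v) ^ 28 / fact 28)"
          using b_ge1[of v] by (intro divide_left_mono power_over_fact_le_exp mult_pos_pos divide_pos_pos zero_less_power) auto
        finally show "exp (- (\<Sum>u\<in>N v \<inter> A. sprob e u)) \<le> fact 28 / real (b v) ^ 28" by simp
      qed auto
      also have "\<dots> = 2 ^ 27 * fact 28 / real (b v)"
        using b_ge1[of v] by (simp add: field_simps flip: power_Suc power_Suc2)
      also have "\<dots> \<le> 2 ^ 27 * fact 28 / lo"
        using A v lo GA(1) b_ge1[of v] by (intro divide_left_mono mult_pos_pos) (auto simp: scale_def)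
      finally show ?thesis .
    qed
    then have "(\<Sum>v\<in>dense e A. expect ?M (f v)) \<le> (\<Sum>v\<in>dense e A. 2 ^ 27 * fact 28 / lo)" by (rule sum_mono)
    also have "\<dots> = card (dense e A) * (2 ^ 27 * fact 28 / lo)" by simp
    also have "\<dots> \<le> n * (2 ^ 27 * fact 28 / lo)"
      using GA(1) scale_sub[OF A] finV lo by (intro mult_right_mono) (auto intro!: card_mono)
    finally show "lo * (\<Sum>v\<in>dense e A. expect ?M (f v)) \<le> 2 ^ 27 * fact 28 * n" using lo by (simp add: field_simps)
  qed auto
  finally show ?thesis .
qed

end

section \<open>Lucky vertices\<close>

context degree_scale begin

text \<open>The middle vertex \<open>w\<close> ranges over all neighbours, not only over
  \<open>R\<close>: a vertex that is already covered can still connect \<open>v\<close> to a new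
  member of the independent set.\<close>

definition lucky :: "'a set \<Rightarrow> 'a set" where
  "lucky R = {v\<in>R. \<exists>w\<in>N v. b v ^ 19 \<le> card {x\<in>N w \<inter> R. b x = b v}}"

text \<open>Each unlucky \<open>v\<close> hands \<open>c v\<close> to all its neighbours, of which
  there are at least \<open>b^27\<close>, and so hands out at least its weight. A vertex
  \<open>w\<close> has fewer than \<open>k^19\<close> unlucky neighbours of class \<open>k\<close>,
  each giving at most \<open>k^-21\<close>, so it receives at most the sum of
  \<open>k^-2\<close>.\<close>

lemma sum_unlucky_le:
  assumes R: "R \<subseteq> V" and deg: "\<And>v. v \<in> R \<Longrightarrow> N v \<noteq> {}" and j: "j \<le> 5"
  shows "(\<Sum>v\<in>R - lucky R. real (b v) ^ Suc j) \<le> 2 * n"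
proof -
  define U where "U = R - lucky R"
  have fU: "finite U" using R finV finite_subset by (auto simp: U_def)
  define c where "c v = real (b v) ^ Suc j / real (b v) ^ 27" for v
  \<comment> \<open>The restriction \<open>j <= 5\<close> enters here:
    \<open>6 + 21 = 27\<close>.\<close>
  have c: "c v \<le> 1 / real (b v) ^ 21" "c v \<ge> 0" for v
  proof -
    have "real (b v) ^ Suc j * real (b v) ^ 21 \<le> real (b v) ^ 27"
      unfolding power_add[symmetric] using j b_ge1 by (intro power_increasing) auto
    then show "c v \<le> 1 / real (b v) ^ 21"
      using b_ge1[of v] by (simp add: c_def divide_simps)
    show "c v \<ge> 0" by (simp add: c_def)
  qed
  have "(\<Sum>v\<in>U. real (b v) ^ Suc j) \<le> (\<Sum>v\<in>U. \<Sum>w\<in>{w\<in>V. w \<in> N v}. c v)"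
  proof (intro sum_mono)
    fix v assume "v \<in> U"
    then have "N v \<noteq> {}" using deg by (auto simp: U_def)
    from of_nat_mono[OF b_le[OF this], where ?'a = real]
    have "real (b v) ^ 27 \<le> card (N v)" by simp
    then have "real (b v) ^ 27 * c v \<le> card (N v) * c v" using c(2) by (intro mult_right_mono)
    moreover have "{w\<in>V. w \<in> N v} = N v" using N_sub by auto
    ultimately show "real (b v) ^ Suc j \<le> (\<Sum>w\<in>{w\<in>V. w \<in> N v}. c v)"
      using b_ge1[of v] by (simp add: c_def)
  qed
  also have "\<dots> = (\<Sum>w\<in>V. \<Sum>v\<in>{v\<in>U. w \<in> N v}. c v)" by (rule sum.swap_restrict[OF fU finV])
  also have "\<dots> \<le> (\<Sum>w\<in>V. 2)"
  proof (intro sum_mono)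
    fix w
    define Q where "Q = {v\<in>U. w \<in> N v}"
    have fQ: "finite Q" using fU by (simp add: Q_def)
    have "(\<Sum>v\<in>Q. c v) \<le> (\<Sum>v\<in>Q. 1 / real (b v) ^ 21)" using c by (intro sum_mono)
    also have "\<dots> = (\<Sum>k\<in>b ` Q. \<Sum>v\<in>{v\<in>Q. b v = k}. 1 / real (b v) ^ 21)"
      by (rule sum.image_gen[OF fQ])
    also have "\<dots> \<le> (\<Sum>k\<in>b ` Q. 1 / real k ^ 2)"
    proof (intro sum_mono)
      fix k assume "k \<in> b ` Q"
      then obtain v where v: "v \<in> Q" "b v = k" by auto
      have k: "real k \<ge> 1" using b_ge1[of v] v(2) by simp
      have "card {v\<in>Q. b v = k} \<le> card {x\<in>N w \<inter> R. b x = b v}"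
        using v N_sym by (intro card_mono) (auto simp: Q_def U_def)
      also have "\<dots> \<le> b v ^ 19" using v(1) by (auto simp: Q_def U_def lucky_def)
      finally have "card {v\<in>Q. b v = k} \<le> k ^ 19" using v(2) by simp
      then have "real (card {v\<in>Q. b v = k}) \<le> real k ^ 19" unfolding of_nat_power[symmetric] by (rule of_nat_mono)
      then have "real (card {v\<in>Q. b v = k}) * (1 / real k ^ 21) \<le> real k ^ 19 * (1 / real k ^ 21)"
        by (intro mult_right_mono) auto
      also have "\<dots> = 1 / real k ^ 2" using k by (simp add: divide_simps flip: power_add)
      finally show "(\<Sum>v\<in>{v\<in>Q. b v = k}. 1 / real (b v) ^ 21) \<le> 1 / real k ^ 2" by simp
    qed
    also have "\<dots> \<le> 2" using fQ b_pos by (intro sum_inverse_squares_le) auto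
    finally show "(\<Sum>v\<in>{v\<in>U. w \<in> N v}. c v) \<le> 2" by (simp add: Q_def)
  qed
  finally show ?thesis by (simp add: U_def)
qed

text \<open>Each lucky vertex gets a set of \<open>b^19\<close> candidates behind one common
  neighbour. If all lucky neighbours of some \<open>w\<close> used the same candidates, one coin
  could affect as many vertices as \<open>w\<close> has neighbours; balanced families make the load
  of \<open>x\<close> depend only on the degree and class of \<open>x\<close>.\<close>

lemma lucky_sets:
  assumes R: "R \<subseteq> V"
  obtains T where "\<And>v. v \<in> lucky R \<Longrightarrow> T v \<subseteq> R" "\<And>v x. v \<in> lucky R \<Longrightarrow> x \<in> T v \<Longrightarrow> b x = b v"
    "\<And>v. v \<in> lucky R \<Longrightarrow> card (T v) = b v ^ 19" "\<And>v. v \<in> lucky R \<Longrightarrow> \<exists>w\<in>N v. T v \<subseteq> N w"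
    "\<And>x. card {v\<in>lucky R. x \<in> T v} \<le> card (N x) * b x ^ 19"
proof -
  define Q where "Q w k = {x\<in>N w \<inter> R. b x = k}" for w k
  have fQ: "finite (Q w k)" for w k by (simp add: Q_def)
  define P where "P w k T \<longleftrightarrow> (\<forall>v\<in>Q w k. T v \<subseteq> Q w k \<and> card (T v) = k ^ 19) \<and>
      (\<forall>x. card {v\<in>Q w k. x \<in> T v} \<le> k ^ 19)" for w k and T :: "'a \<Rightarrow> 'a set"
  \<comment> \<open>One family for each pair of a middle vertex and a class, so that all vertices
    using this pair share its balance.\<close>
  define T where "T w k = (SOME T. P w k T)" for w k
  have "P w k (T w k)" if large: "k ^ 19 \<le> card (Q w k)" for w k
  proof -
    obtain T where T: "\<And>v. v \<in> Q w k \<Longrightarrow> T v \<subseteq> Q w k" "\<And>v. v \<in> Q w k \<Longrightarrow> card (T v) = k ^ 19"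
      "\<And>x. card {v\<in>Q w k. x \<in> T v} \<le> k ^ 19"
      by (rule uniform_subsets[OF fQ large], rule that)
    have "P w k T" unfolding P_def using T by (intro conjI ballI allI)
    then show ?thesis unfolding T_def by (rule someI[of "P w k"])
  qed
  then have T: "v \<in> Q w k \<Longrightarrow> T w k v \<subseteq> Q w k" "v \<in> Q w k \<Longrightarrow> card (T w k v) = k ^ 19"
      "card {v\<in>Q w k. x \<in> T w k v} \<le> k ^ 19" if "k ^ 19 \<le> card (Q w k)" for w k v x
    using that by (auto simp: P_def)
  have "\<exists>w. w \<in> N v \<and> b v ^ 19 \<le> card (Q w (b v))" if "v \<in> lucky R" for v
    using that by (auto simp: lucky_def Q_def)
  then obtain g where g: "\<And>v. v \<in> lucky R \<Longrightarrow> g v \<in> N v \<and> b v ^ 19 \<le> card (Q (g v) (b v))" by metis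
  have vQ: "v \<in> Q (g v) (b v)" if "v \<in> lucky R" for v
    using g[OF that] that N_sym by (auto simp: Q_def lucky_def)
  define T' where "T' v = T (g v) (b v) v" for v
  have T': "T' v \<subseteq> Q (g v) (b v)" "card (T' v) = b v ^ 19" if "v \<in> lucky R" for v
    using T g[OF that] vQ[OF that] by (auto simp: T'_def)
  show thesis
  proof
    show "T' v \<subseteq> R" if "v \<in> lucky R" for v using T'(1)[OF that] by (auto simp: Q_def)
    show "b x = b v" if "v \<in> lucky R" "x \<in> T' v" for v x using T'(1) that by (auto simp: Q_def)
    show "card (T' v) = b v ^ 19" if "v \<in> lucky R" for v using T' that by simp
    show "\<exists>w\<in>N v. T' v \<subseteq> N w" if "v \<in> lucky R" for v
      using T'(1)[OF that] g[OF that] by (auto simp: Q_def)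
    fix x
    \<comment> \<open>Only the families at neighbours of \<open>x\<close> and of its own class can
      contain \<open>x\<close>, and each uses it at most \<open>b x ^ 19\<close> times.\<close>
    define W where "W = {w\<in>N x. b x ^ 19 \<le> card (Q w (b x))}"
    have fW: "finite W" by (simp add: W_def)
    have "{v\<in>lucky R. x \<in> T' v} \<subseteq> (\<Union>w\<in>W. {v\<in>Q w (b x). x \<in> T w (b x) v})"
    proof
      fix v assume "v \<in> {v\<in>lucky R. x \<in> T' v}"
      then have v: "v \<in> lucky R" "x \<in> T' v" by auto
      then have "x \<in> Q (g v) (b v)" using T' by auto
      then have "x \<in> N (g v)" "b x = b v" by (auto simp: Q_def)
      then show "v \<in> (\<Union>w\<in>W. {v\<in>Q w (b x). x \<in> T w (b x) v})"
        using g[OF v(1)] vQ[OF v(1)] N_sym v(2) by (intro UN_I[of "g v"]) (auto simp: W_def T'_def)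
    qed
    then have "card {v\<in>lucky R. x \<in> T' v} \<le> card (\<Union>w\<in>W. {v\<in>Q w (b x). x \<in> T w (b x) v})"
      using fW fQ by (intro card_mono) auto
    also have "\<dots> \<le> (\<Sum>w\<in>W. card {v\<in>Q w (b x). x \<in> T w (b x) v})" by (rule card_UN_le[OF fW])
    also have "\<dots> \<le> (\<Sum>w\<in>W. b x ^ 19)" using T by (intro sum_mono) (auto simp: W_def)
    also have "\<dots> \<le> card (N x) * b x ^ 19"
      using card_mono[of "N x" W] by (simp add: W_def Collect_restrict)
    finally show "card {v\<in>lucky R. x \<in> T' v} \<le> card (N x) * b x ^ 19" .
  qed
qed

text \<open>The set \<open>T\<close> expects \<open>k\<close> sampled members and so is missed with
  probability at most \<open>exp (- k) <= 2 / k^2\<close>. For a conflict, one of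
  \<open>k^19\<close> members is sampled at rate \<open>k^-18\<close> together with a neighbour of
  at least its class. There \<open>sprob 18 u <= k^-4 * sprob 14 u\<close>, so thinness bounds the
  expected number of sampled such neighbours by \<open>k^-3\<close>, and the product is
  \<open>k^-2\<close>.\<close>

lemma lucky_fail_le:
  assumes A: "scale A" and R: "R \<subseteq> A" and T: "T \<subseteq> R" "\<And>x. x \<in> T \<Longrightarrow> b x = k" "card T = k ^ 19"
    and thin: "\<And>v. v \<in> R \<Longrightarrow> (\<Sum>u\<in>N v \<inter> A. sprob 14 u) \<le> b v" and k: "k \<ge> 1"
  shows "pr (sampled 18 A) {S. T \<inter> S = {} \<or> (\<exists>x\<in>T \<inter> S. \<exists>u\<in>N x \<inter> A \<inter> S. b x \<le> b u)} \<le> 3 / real k ^ 2"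
proof -
  let ?M = "sampled 18 A"
  have fA: "finite A" using A by (rule scale_finite)
  have fT: "finite T" using finite_subset[OF T(1) finite_subset[OF R fA]] .
  define B where "B x = {u\<in>N x \<inter> A. b x \<le> b u}" for x
  have k0: "real k > 0" using k by linarith
  have 1: "pr ?M {S. T \<inter> S = {}} \<le> 2 / real k ^ 2"
  proof -
    have "pr ?M {S. T \<inter> S = {}} \<le> exp (- (\<Sum>x\<in>T. sprob 18 x))"
      using T(1) R sprob_ok fA by (intro pr_random_subset_disjoint_le) auto
    also have "(\<Sum>x\<in>T. sprob 18 x) = (\<Sum>x\<in>T. 1 / real k ^ 18)" using T(2) by (intro sum.cong) (auto simp: sprob_def)
    also have "\<dots> = real k" using T(3) k0 by (simp add: field_simps flip: power_Suc power_Suc2)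
    also have "exp (- real k) = 1 / exp (real k)" by (simp add: exp_minus divide_inverse)
    also have "\<dots> \<le> 1 / (real k ^ 2 / fact 2)"
      using k0 by (intro divide_left_mono power_over_fact_le_exp mult_pos_pos divide_pos_pos zero_less_power) auto
    finally show ?thesis by (simp add: fact_2)
  qed
  have 2: "pr ?M {S. \<exists>x\<in>T \<inter> S. \<exists>u\<in>N x \<inter> A \<inter> S. b x \<le> b u} \<le> 1 / real k ^ 2"
  proof -
    have fB: "finite (B x)" for x by (simp add: B_def)
    have "pr ?M {S. \<exists>x\<in>T \<inter> S. \<exists>u\<in>N x \<inter> A \<inter> S. b x \<le> b u} = expect ?M (indicator {S. \<exists>x\<in>T \<inter> S. \<exists>u\<in>N x \<inter> A \<inter> S. b x \<le> b u})"
      by simp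
    also have "\<dots> \<le> expect ?M (\<lambda>S. \<Sum>x\<in>T. \<Sum>u\<in>B x. indicator S x * indicator S u)"
    proof (intro expect_random_subset_mono fA)
      fix S
      show "indicator {S. \<exists>x\<in>T \<inter> S. \<exists>u\<in>N x \<inter> A \<inter> S. b x \<le> b u} S \<le> (\<Sum>x\<in>T. \<Sum>u\<in>B x. indicator S x * indicator S u :: real)"
      proof (cases "\<exists>x\<in>T \<inter> S. \<exists>u\<in>N x \<inter> A \<inter> S. b x \<le> b u")
        case True
        then obtain x u where xu: "x \<in> T" "x \<in> S" "u \<in> B x" "u \<in> S" by (auto simp: B_def)
        have "1 = (indicator S x * indicator S u :: real)" using xu by simp
        also have "\<dots> \<le> (\<Sum>u\<in>B x. indicator S x * indicator S u)"
          using xu fB by (intro member_le_sum[of u]) auto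
        also have "\<dots> \<le> (\<Sum>x\<in>T. \<Sum>u\<in>B x. indicator S x * indicator S u)"
          using xu fT by (intro member_le_sum[of x "T" "\<lambda>x. \<Sum>u\<in>B x. indicator S x * indicator S u"] sum_nonneg) auto
        finally show ?thesis using True by simp
      next
        case False then show ?thesis by (simp add: sum_nonneg)
      qed
    qed
    also have "\<dots> = (\<Sum>x\<in>T. \<Sum>u\<in>B x. expect ?M (\<lambda>S. indicator S x * indicator S u))"
      using fA by (simp add: Bochner_Integration.integral_sum)
    also have "\<dots> = (\<Sum>x\<in>T. \<Sum>u\<in>B x. sprob 18 x * sprob 18 u)"
    proof (intro sum.cong refl expect_random_subset_elem2 fA)
      fix x u assume "x \<in> T" "u \<in> B x"
      then show "x \<in> A" "u \<in> A" "x \<noteq> u" using T(1) R N_irrefl by (auto simp: B_def)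
    qed (use sprob_ok in auto)
    also have "\<dots> \<le> (\<Sum>x\<in>T. (1 / real k ^ 18) * (1 / real k ^ 4 * real k))"
    proof (intro sum_mono)
      fix x assume x: "x \<in> T"
      have bx: "b x = k" using T(2) x by simp
      have "(\<Sum>u\<in>B x. sprob 18 u) \<le> (\<Sum>u\<in>B x. 1 / real k ^ 4 * sprob 14 u)"
      proof (intro sum_mono)
        fix u assume "u \<in> B x"
        then have "sprob 4 u \<le> 1 / real k ^ 4" using sprob_mono[of x u 4] bx by (simp add: B_def sprob_def)
        then have "sprob 4 u * sprob 14 u \<le> 1 / real k ^ 4 * sprob 14 u"
          using sprob_ok[of 14 u] by (intro mult_right_mono) auto
        then show "sprob 18 u \<le> 1 / real k ^ 4 * sprob 14 u"
          using sprob_add[of 4 14 u] by simp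
      qed
      also have "\<dots> = 1 / real k ^ 4 * (\<Sum>u\<in>B x. sprob 14 u)" by (simp add: sum_distrib_left)
      also have "\<dots> \<le> 1 / real k ^ 4 * (\<Sum>u\<in>N x \<inter> A. sprob 14 u)"
        using sprob_ok by (intro mult_left_mono sum_mono2) (auto simp: B_def)
      also have "\<dots> \<le> 1 / real k ^ 4 * real k"
        using thin[of x] x T(1) bx by (intro mult_left_mono) auto
      finally have "(\<Sum>u\<in>B x. sprob 18 u) \<le> 1 / real k ^ 4 * real k" .
      moreover have "sprob 18 x = 1 / real k ^ 18" by (simp add: sprob_def bx)
      ultimately show "(\<Sum>u\<in>B x. sprob 18 x * sprob 18 u) \<le> (1 / real k ^ 18) * (1 / real k ^ 4 * real k)"
        unfolding sum_distrib_left[symmetric] by (simp only:) (intro mult_left_mono, auto)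
    qed
    also have "\<dots> = real k ^ 19 * ((1 / real k ^ 18) * (1 / real k ^ 4 * real k))" using T(3) by simp
    also have "\<dots> = 1 / real k ^ 2"
      using k0 by (simp add: divide_simps power_add[symmetric] flip: power_Suc power_Suc2)
    finally show ?thesis .
  qed
  have "pr ?M {S. T \<inter> S = {} \<or> (\<exists>x\<in>T \<inter> S. \<exists>u\<in>N x \<inter> A \<inter> S. b x \<le> b u)}
    \<le> pr ?M {S. T \<inter> S = {}} + pr ?M {S. \<exists>x\<in>T \<inter> S. \<exists>u\<in>N x \<inter> A \<inter> S. b x \<le> b u}"
    unfolding Collect_disj_eq by (rule measure_Un_le) auto
  then show ?thesis using 1 2 by simp
qed

text \<open>The failure probability \<open>3 / b^2\<close> turns the weight \<open>b^(j+1)\<close>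
  into \<open>3 * b^(j-1)\<close>. Compared with the known bound for \<open>b^j\<close> this leaves
  the spare factor \<open>1 / b\<close>.\<close>

lemma lucky_concentration:
  assumes A: "scale A" and R: "R \<subseteq> A"
    and thin: "\<And>v. v \<in> R \<Longrightarrow> (\<Sum>u\<in>N v \<inter> A. sprob 14 u) \<le> b v"
    and j: "j \<le> 5" and C: "C \<ge> 0" and pot: "(\<Sum>v\<in>R. real (b v) ^ j) \<le> C * n"
  shows "pr (sampled 18 A)
    {S. S \<subseteq> A \<and> (\<Sum>v\<in>lucky R \<inter> alive A S. real (b v) ^ Suc j) > (3 * C + 1) * n} \<le> eps"
proof -
  let ?M = "sampled 18 A"
  have fA: "finite A" using A by (rule scale_finite)
  obtain T where T: "\<And>v. v \<in> lucky R \<Longrightarrow> T v \<subseteq> R" "\<And>v x. v \<in> lucky R \<Longrightarrow> x \<in> T v \<Longrightarrow> b x = b v"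
    "\<And>v. v \<in> lucky R \<Longrightarrow> card (T v) = b v ^ 19" "\<And>v. v \<in> lucky R \<Longrightarrow> \<exists>w\<in>N v. T v \<subseteq> N w"
    "\<And>x. card {v\<in>lucky R. x \<in> T v} \<le> card (N x) * b x ^ 19"
    by (rule lucky_sets[OF order_trans[OF R scale_sub[OF A]]], rule that)
  have L: "lucky R \<subseteq> R" "lucky R \<subseteq> A" "finite (lucky R)" "finite R"
    using R fA by (auto simp: lucky_def intro: finite_subset[OF _ fA])
  define F where "F v = {S. T v \<inter> S = {} \<or> (\<exists>x\<in>T v \<inter> S. \<exists>u\<in>N x \<inter> A \<inter> S. b x \<le> b u)}" for v
  define f where "f v S = real (b v) ^ Suc j * indicator (F v) S" for v S
  \<comment> \<open>The event \<open>F v\<close> is decided by the coins of the candidates and of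
    their neighbours in \<open>A\<close>.\<close>
  define D where "D v = T v \<union> (\<Union>x\<in>T v. N x \<inter> A)" for v
  have fT: "finite (T v)" if "v \<in> lucky R" for v using finite_subset[OF T(1)[OF that] L(4)] .
  have bhi: "real (b v) ^ k \<le> hi ^ k" if "v \<in> A" for v k
    using A that by (intro power_mono) (auto simp: scale_def)
  have deg1: "1 + deg x \<le> 2 ^ 28 * hi ^ 27" if "x \<in> A" for x
  proof -
    have "1 + deg x \<le> hi ^ 27 + 2 ^ 27 * hi ^ 27"
      using deg_hi[OF A that] one_le_power[OF hi, of 27] by linarith
    also have "\<dots> \<le> 2 ^ 28 * hi ^ 27" using hi by simp
    finally show ?thesis .
  qed
  have "{S. S \<subseteq> A \<and> (\<Sum>v\<in>lucky R \<inter> alive A S. real (b v) ^ Suc j) > (3 * C + 1) * n}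
      \<subseteq> {S. (\<Sum>v\<in>lucky R. f v S) > (3 * C + 1) * n}"
  proof safe
    fix S assume S: "S \<subseteq> A" "(\<Sum>v\<in>lucky R \<inter> alive A S. real (b v) ^ Suc j) > (3 * C + 1) * n"
    have "S \<in> F v" if v: "v \<in> lucky R" "v \<in> alive A S" for v
    proof (cases "T v \<inter> S = {}")
      case False
      then obtain x where x: "x \<in> T v" "x \<in> S" by auto
      obtain w where w: "w \<in> N v" "T v \<subseteq> N w" using T(4)[OF v(1)] by auto
      then have "\<exists>u\<in>N x \<inter> S. b x \<le> b u" using v(2) x by (auto simp: alive_def)
      then show ?thesis using x S(1) by (auto simp: F_def)
    qed (simp add: F_def)
    then have "(\<Sum>v\<in>lucky R \<inter> alive A S. real (b v) ^ Suc j) = (\<Sum>v\<in>lucky R \<inter> alive A S. f v S)"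
      by (intro sum.cong) (auto simp: f_def)
    also have "\<dots> \<le> (\<Sum>v\<in>lucky R. f v S)" using L by (intro sum_mono2) (auto simp: f_def)
    finally show "(\<Sum>v\<in>lucky R. f v S) > (3 * C + 1) * n" using S(2) by simp
  qed
  then have "pr ?M {S. S \<subseteq> A \<and> (\<Sum>v\<in>lucky R \<inter> alive A S. real (b v) ^ Suc j) > (3 * C + 1) * n}
      \<le> pr ?M {S. (\<Sum>v\<in>lucky R. f v S) > (3 * C + 1) * n}"
    by (intro measure_pmf.finite_measure_mono) auto
  also have "\<dots> \<le> eps"
  proof (rule concentration[OF A L(2), where D = D])
    show "D v \<subseteq> A" if "v \<in> lucky R" for v using T(1)[OF that] R by (auto simp: D_def)
    show "real (card (D v)) \<le> K" if v: "v \<in> lucky R" for v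
    proof -
      have "card (D v) \<le> card (T v) + card (\<Union>x\<in>T v. N x \<inter> A)" unfolding D_def by (rule card_Un_le)
      also have "\<dots> \<le> card (T v) + (\<Sum>x\<in>T v. card (N x \<inter> A))"
        using card_UN_le[OF fT[OF v]] by (intro add_left_mono)
      also have "\<dots> = (\<Sum>x\<in>T v. 1 + card (N x \<inter> A))" by (simp only: sum.distrib sum_constant mult_1_right of_nat_id)
      finally have "real (card (D v)) \<le> (\<Sum>x\<in>T v. real (1 + card (N x \<inter> A)))"
        unfolding of_nat_sum[symmetric] by (rule of_nat_mono)
      also have "\<dots> \<le> (\<Sum>x\<in>T v. 2 ^ 28 * hi ^ 27)"
      proof (intro sum_mono)
        fix x assume "x \<in> T v"
        then have "x \<in> A" using T(1)[OF v] R by auto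
        moreover have "card (N x \<inter> A) \<le> card (N x)" by (intro card_mono) auto
        ultimately show "real (1 + card (N x \<inter> A)) \<le> 2 ^ 28 * hi ^ 27" using deg1[of x] by linarith
      qed
      also have "\<dots> = real (b v) ^ 19 * (2 ^ 28 * hi ^ 27)" using T(3)[OF v] by simp
      also have "\<dots> \<le> hi ^ 19 * (2 ^ 28 * hi ^ 27)" using bhi[of v 19] v L hi by (intro mult_right_mono) auto
      also have "\<dots> = 2 ^ 28 * hi ^ 46" by (simp flip: power_add)
      also have "\<dots> \<le> K" by (rule hi_K) auto
      finally show ?thesis .
    qed
    show "real (card {v\<in>lucky R. y \<in> D v}) \<le> K" if y: "y \<in> A" for y
    proof -
      have cT: "real (card {v\<in>lucky R. x \<in> T v}) \<le> 2 ^ 27 * hi ^ 46" if "x \<in> A" for x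
      proof -
        have "real (card {v\<in>lucky R. x \<in> T v}) \<le> deg x * real (b x) ^ 19"
          using of_nat_mono[OF T(5)[of x], where ?'a = real] by simp
        also have "\<dots> \<le> (2 ^ 27 * hi ^ 27) * hi ^ 19" using deg_hi[OF A that] bhi[OF that] hi by (intro mult_mono) auto
        also have "\<dots> = 2 ^ 27 * hi ^ 46" by (simp flip: power_add)
        finally show ?thesis .
      qed
      \<comment> \<open>A coin \<open>y\<close> concerns \<open>v\<close> only if \<open>y\<close>
        or one of its neighbours is a candidate of \<open>v\<close>. There are at most
        \<open>2^28 * hi^27\<close> such candidates, each serving at most
        \<open>2^27 * hi^46\<close> vertices, and the product is exactly \<open>K\<close>.\<close>
      have "{v\<in>lucky R. y \<in> D v} \<subseteq> (\<Union>x\<in>insert y (N y \<inter> A). {v\<in>lucky R. x \<in> T v})"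
      proof
        fix v assume "v \<in> {v\<in>lucky R. y \<in> D v}"
        then have v: "v \<in> lucky R" and "y \<in> T v \<or> (\<exists>x\<in>T v. y \<in> N x)" by (auto simp: D_def)
        moreover have "T v \<subseteq> A" using T(1)[OF v] R by auto
        ultimately show "v \<in> (\<Union>x\<in>insert y (N y \<inter> A). {v\<in>lucky R. x \<in> T v})" using N_sym[of y] by auto
      qed
      then have "card {v\<in>lucky R. y \<in> D v} \<le> card (\<Union>x\<in>insert y (N y \<inter> A). {v\<in>lucky R. x \<in> T v})"
        using L by (intro card_mono) auto
      also have "\<dots> \<le> (\<Sum>x\<in>insert y (N y \<inter> A). card {v\<in>lucky R. x \<in> T v})" by (intro card_UN_le) auto
      finally have "real (card {v\<in>lucky R. y \<in> D v}) \<le> (\<Sum>x\<in>insert y (N y \<inter> A). real (card {v\<in>lucky R. x \<in> T v}))"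
        unfolding of_nat_sum[symmetric] by (rule of_nat_mono)
      also have "\<dots> \<le> (\<Sum>x\<in>insert y (N y \<inter> A). 2 ^ 27 * hi ^ 46)" using cT y by (intro sum_mono) auto
      also have "\<dots> = card (insert y (N y \<inter> A)) * (2 ^ 27 * hi ^ 46)" by simp
      also have "\<dots> \<le> (2 ^ 28 * hi ^ 27) * (2 ^ 27 * hi ^ 46)"
      proof (intro mult_right_mono)
        have "card (N y \<inter> A) \<le> card (N y)" by (intro card_mono) auto
        then show "real (card (insert y (N y \<inter> A))) \<le> 2 ^ 28 * hi ^ 27"
          using deg1[OF y] by (auto simp: card_insert_if)
      qed (use hi in auto)
      also have "\<dots> = K" by (simp flip: power_add)
      finally show ?thesis .
    qed
    show "f v S = f v (S \<inter> D v)" for v S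
    proof -
      have "(S \<in> F v) = (S \<inter> D v \<in> F v)" unfolding F_def D_def by blast
      then show ?thesis by (simp add: f_def indicator_def)
    qed
    show "0 \<le> f v S \<and> f v S \<le> K" if v: "v \<in> lucky R" for v S
    proof -
      have "f v S \<le> real (b v) ^ Suc j" by (auto simp: f_def indicator_def)
      also have "\<dots> \<le> 1 * hi ^ Suc j" using bhi[of v "Suc j"] v L by auto
      also have "\<dots> \<le> K" using j by (intro hi_K) auto
      finally show ?thesis by (simp add: f_def)
    qed
    have "lo * (\<Sum>v\<in>lucky R. expect ?M (f v)) \<le> (\<Sum>v\<in>lucky R. 3 * real (b v) ^ j)"
      unfolding sum_distrib_left
    proof (intro sum_mono)
      fix v assume v: "v \<in> lucky R"
      have "pr ?M (F v) \<le> 3 / real (b v) ^ 2"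
        unfolding F_def using T(1-3)[OF v] by (intro lucky_fail_le[OF A R _ _ _ thin b_pos]) auto
      then have "real (b v) ^ Suc j * pr ?M (F v) \<le> real (b v) ^ Suc j * (3 / real (b v) ^ 2)"
        by (intro mult_left_mono) auto
      then have "expect ?M (f v) \<le> real (b v) ^ Suc j * (3 / real (b v) ^ 2)"
        unfolding f_def by simp
      then have "lo * expect ?M (f v) \<le> real (b v) * (real (b v) ^ Suc j * (3 / real (b v) ^ 2))"
        using A v L lo by (intro mult_mono) (auto simp: scale_def f_def)
      also have "\<dots> = 3 * real (b v) ^ j" using b_ge1[of v] by (simp add: power2_eq_square)
      finally show "lo * expect ?M (f v) \<le> 3 * real (b v) ^ j" .
    qed
    also have "\<dots> \<le> (\<Sum>v\<in>R. 3 * real (b v) ^ j)" using L by (intro sum_mono2) auto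
    also have "\<dots> \<le> 3 * C * n" using pot by (simp add: sum_distrib_left[symmetric])
    finally show "lo * (\<Sum>v\<in>lucky R. expect ?M (f v)) \<le> 3 * C * n" .
  qed (use C in auto)
  finally show ?thesis .
qed

end

section \<open>One stage\<close>

lemma pr_le_two:
  assumes "B \<subseteq> E1 \<union> E2" "pr M E1 \<le> e" "pr M E2 \<le> e"
  shows "pr M B \<le> 2 * e"
proof -
  have "pr M B \<le> pr M (E1 \<union> E2)" using assms(1) by (intro measure_pmf.finite_measure_mono) auto
  also have "\<dots> \<le> pr M E1 + pr M E2" by (rule measure_Un_le) auto
  finally show ?thesis using assms by linarith
qed

lemma growth_ge: "growth \<ge> 2 ^ 27 * fact 28 + 2 ^ 29"
  unfolding growth_def by (simp add: fact_numeral)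

lemma growth_bounds: "growth \<ge> 1" "growth \<ge> 2 * 2 ^ 27 + 2" "growth \<ge> 2 ^ 27 * fact 28 + 2" "growth \<ge> 6"
  using growth_ge fact_ge_zero[where ?'a = real, of 28] by (auto simp: growth_def fact_numeral)

lemma bernoulli_1: "bernoulli_pmf 1 = return_pmf True"
  by (rule pmf_eqI) (auto simp: indicator_def split: bool.splits)

definition stage_exp :: "nat \<Rightarrow> nat" where
  "stage_exp i = (if i = 0 then 14 else if i \<le> 6 then 18 else if i = 7 then 5 else 0)"

context degree_scale begin

text \<open>The exceptional set \<open>X\<close> absorbs vertices about which nothing is known
  except that all their edges together are affordable.\<close>

definition inv_up_to :: "('a set \<Rightarrow> 'a \<Rightarrow> bool) \<Rightarrow> real \<Rightarrow> nat \<Rightarrow> 'a set \<Rightarrow> bool" where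
  "inv_up_to Q C j A \<longleftrightarrow> (\<exists>X\<subseteq>A. (\<Sum>v\<in>X. deg v) \<le> C * n \<and> (\<forall>v\<in>A - X. Q A v) \<and>
     (\<Sum>v\<in>A - X. real (b v) ^ j) \<le> C * n)"

definition inv_reg :: "real \<Rightarrow> nat \<Rightarrow> 'a set \<Rightarrow> bool" where
  "inv_reg = inv_up_to (\<lambda>A v. N v \<noteq> {} \<and> (\<Sum>u\<in>N v \<inter> A. sprob 14 u) \<le> b v)"

definition inv_down :: "real \<Rightarrow> 'a set \<Rightarrow> bool" where
  "inv_down C = inv_up_to (\<lambda>A v. card {u\<in>N v \<inter> A. b u \<le> b v} \<le> b v ^ 6) C 6"

text \<open>What holds after \<open>i\<close> stages, with constants that grow by a fixed factor per stage.\<close>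

definition stage_inv :: "real \<Rightarrow> nat \<Rightarrow> 'a set \<Rightarrow> bool" where
  "stage_inv C i A = (if i = 0 then True else if i \<le> 7 then inv_reg C (i - 1) A
     else if i = 8 then inv_down C A else A = {})"

lemma eps_nonneg: "eps \<ge> 0"
proof -
  have "1 / lo \<ge> 0" "K ^ 4 / n \<ge> 0" using lo by auto
  then show ?thesis using regime by linarith
qed

lemma alive_subset: "alive A S \<subseteq> A" by (auto simp: alive_def)

lemma sum_nbrs_mono:
  assumes "A' \<subseteq> A" "(\<Sum>u\<in>N v \<inter> A. sprob e u) \<le> c"
  shows "(\<Sum>u\<in>N v \<inter> A'. sprob e u) \<le> c"
proof -
  have "(\<Sum>u\<in>N v \<inter> A'. sprob e u) \<le> (\<Sum>u\<in>N v \<inter> A. sprob e u)"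
    using assms(1) sprob_ok by (intro sum_mono2) auto
  then show ?thesis using assms(2) by linarith
qed

lemma inv_up_to_antimono:
  assumes inv: "inv_up_to Q C j A" and A: "A' \<subseteq> A" "finite A"
    and Q: "\<And>v. Q A v \<Longrightarrow> Q A' v"
  shows "inv_up_to Q C j A'"
proof -
  obtain X where X: "X \<subseteq> A" "(\<Sum>v\<in>X. deg v) \<le> C * n" "\<forall>v\<in>A - X. Q A v"
      "(\<Sum>v\<in>A - X. real (b v) ^ j) \<le> C * n"
    using inv by (auto simp: inv_up_to_def)
  show ?thesis
    unfolding inv_up_to_def
  proof (intro exI[of _ "X \<inter> A'"] conjI)
    have "(\<Sum>v\<in>X \<inter> A'. deg v) \<le> (\<Sum>v\<in>X. deg v)"
      using finite_subset[OF X(1) A(2)] by (intro sum_mono2) auto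
    then show "(\<Sum>v\<in>X \<inter> A'. deg v) \<le> C * n" using X(2) by linarith
    have "(\<Sum>v\<in>A' - X \<inter> A'. real (b v) ^ j) \<le> (\<Sum>v\<in>A - X. real (b v) ^ j)"
      using A by (intro sum_mono2) auto
    then show "(\<Sum>v\<in>A' - X \<inter> A'. real (b v) ^ j) \<le> C * n" using X(4) by linarith
  qed (use A(1) X(3) Q in auto)
qed

lemma stage_inv_antimono:
  assumes "stage_inv C i A" "A' \<subseteq> A" "A \<subseteq> V"
  shows "stage_inv C i A'"
proof -
  have fA: "finite A" using finite_subset[OF assms(3) finV] .
  have "inv_reg C j A'" if "inv_reg C j A" for j
    using that sum_nbrs_mono[OF assms(2)] unfolding inv_reg_def
    by (rule_tac inv_up_to_antimono[OF _ assms(2) fA]) auto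
  moreover have "inv_down C A'" if "inv_down C A"
    using that unfolding inv_down_def
  proof (rule inv_up_to_antimono[OF _ assms(2) fA])
    fix v assume "card {u\<in>N v \<inter> A. b u \<le> b v} \<le> b v ^ 6"
    moreover have "card {u\<in>N v \<inter> A'. b u \<le> b v} \<le> card {u\<in>N v \<inter> A. b u \<le> b v}"
      using assms(2) by (intro card_mono) auto
    ultimately show "card {u\<in>N v \<inter> A'. b u \<le> b v} \<le> b v ^ 6" by linarith
  qed
  ultimately show ?thesis using assms(1,2) by (auto simp: stage_inv_def split: if_splits)
qed

section \<open>The effect of each kind of stage\<close>

definition bad :: "real \<Rightarrow> nat \<Rightarrow> 'a set \<Rightarrow> 'a set set" where
  "bad C i A = {S. S \<subseteq> A \<and> \<not> (real (ecount S) \<le> C * n \<and> stage_inv C i (alive A S))}"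

lemma stage_first:
  assumes A: "scale A" and C: "C \<ge> 1"
  shows "pr (sampled 14 A) (bad (growth * C) 1 A) \<le> 2 * eps"
proof (rule pr_le_two[OF _ ecount_concentration_basic[OF A] dense_concentration[OF A]])
  have fA: "finite A" using A by (rule scale_finite)
  show "bad (growth * C) 1 A \<subseteq> {S. S \<subseteq> A \<and> real (ecount S) > (2 * 2 ^ 27 + 2) * n} \<union>
      {S. S \<subseteq> A \<and> (\<Sum>v\<in>{v\<in>dense 14 A. N v \<inter> S = {}}. deg v) > (2 ^ 27 * fact 28 + 1) * n}" (is "_ \<subseteq> ?E")
  proof (rule subsetI, rule ccontr)
    fix S assume bad: "S \<in> bad (growth * C) 1 A" and "S \<notin> ?E"
    then have S: "S \<subseteq> A" "real (ecount S) \<le> (2 * 2 ^ 27 + 2) * n"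
      "(\<Sum>v\<in>{v\<in>dense 14 A. N v \<inter> S = {}}. deg v) \<le> (2 ^ 27 * fact 28 + 1) * n"
      by (auto simp: bad_def dense_def)
    have kC: "growth \<le> growth * C" using C growth_bounds(1) by auto
    have "real (ecount S) \<le> growth * n"
      using S(2) by (rule order_trans) (intro mult_right_mono growth_bounds, simp)
    also have "\<dots> \<le> (growth * C) * n" using kC by (rule mult_right_mono) simp
    finally have e: "real (ecount S) \<le> (growth * C) * n" .
    let ?A = "alive A S"
    \<comment> \<open>Isolated vertices add nothing to the degree sum, and excluding them makes
      \<open>b_le\<close> available for the others.\<close>
    define X where "X = {v\<in>?A. v \<in> dense 14 A \<or> N v = {}}"
    have "inv_reg (growth * C) 0 ?A"
      unfolding inv_reg_def inv_up_to_def
    proof (intro exI[of _ X] conjI ballI)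
      show "X \<subseteq> ?A" by (auto simp: X_def)
      have "(\<Sum>v\<in>X. deg v) = (\<Sum>v\<in>X \<inter> dense 14 A. deg v)"
        using fA alive_subset[of A S] by (intro sum.mono_neutral_right) (auto simp: X_def intro: finite_subset[OF _ fA])
      also have "\<dots> \<le> (\<Sum>v\<in>{v\<in>dense 14 A. N v \<inter> S = {}}. deg v)"
        using fA by (intro sum_mono2) (auto simp: X_def dense_def alive_def)
      also have "\<dots> \<le> (2 ^ 27 * fact 28 + 1) * n" by (rule S(3))
      also have "\<dots> \<le> (growth * C) * n" using growth_bounds(3) kC by (intro mult_right_mono) auto
      finally show "(\<Sum>v\<in>X. deg v) \<le> growth * C * n" .
      have "(\<Sum>v\<in>?A - X. real (b v) ^ 0) \<le> n"
      proof -
        have "card (?A - X) \<le> card V"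
          using alive_subset[of A S] scale_sub[OF A] finV by (intro card_mono) auto
        then show ?thesis by simp
      qed
      also have "\<dots> \<le> (growth * C) * n"
        using mult_right_mono[of 1 "growth * C" n] growth_bounds(1) kC by simp
      finally show "(\<Sum>v\<in>?A - X. real (b v) ^ 0) \<le> growth * C * n" .
      fix v assume v: "v \<in> ?A - X"
      then show "N v \<noteq> {}" by (auto simp: X_def)
      have "v \<in> A" "v \<notin> dense 14 A" using v alive_subset[of A S] by (auto simp: X_def)
      then show "(\<Sum>u\<in>N v \<inter> ?A. sprob 14 u) \<le> b v"
        by (intro sum_nbrs_mono[OF alive_subset]) (auto simp: dense_def)
    qed
    then show False using bad e by (simp add: bad_def stage_inv_def)
  qed
qed simp

lemma stage_lucky:
  assumes A: "scale A" and C: "C \<ge> 1" and j: "j \<le> 5" and inv: "inv_reg C j A"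
  shows "pr (sampled 18 A) (bad (growth * C) (Suc (Suc j)) A) \<le> 2 * eps"
proof -
  have fA: "finite A" using A by (rule scale_finite)
  obtain X where X: "X \<subseteq> A" "(\<Sum>v\<in>X. deg v) \<le> C * n"
      "\<And>v. v \<in> A - X \<Longrightarrow> N v \<noteq> {}" "\<And>v. v \<in> A - X \<Longrightarrow> (\<Sum>u\<in>N v \<inter> A. sprob 14 u) \<le> b v"
      "(\<Sum>v\<in>A - X. real (b v) ^ j) \<le> C * n"
    using inv by (auto simp: inv_reg_def inv_up_to_def)
  define R where "R = A - X"
  have R: "R \<subseteq> A" "finite R" using fA by (auto simp: R_def)
  have c: "pr (sampled 18 A)
    {S. S \<subseteq> A \<and> (\<Sum>v\<in>lucky R \<inter> alive A S. real (b v) ^ Suc j) > (3 * C + 1) * n} \<le> eps"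
    using X C by (intro lucky_concentration[OF A R(1) _ j]) (auto simp: R_def)
  have unlucky: "(\<Sum>v\<in>R - lucky R. real (b v) ^ Suc j) \<le> 2 * n"
    using X(3) scale_sub[OF A] R by (intro sum_unlucky_le j) (auto simp: R_def)
  show ?thesis
  proof (rule pr_le_two[OF _ ecount_concentration_basic[OF A] c])
    show "bad (growth * C) (Suc (Suc j)) A \<subseteq> {S. S \<subseteq> A \<and> real (ecount S) > (2 * 2 ^ 27 + 2) * n} \<union>
      {S. S \<subseteq> A \<and> (\<Sum>v\<in>lucky R \<inter> alive A S. real (b v) ^ Suc j) > (3 * C + 1) * n}" (is "_ \<subseteq> ?E")
    proof (rule subsetI, rule ccontr)
      fix S assume bad: "S \<in> bad (growth * C) (Suc (Suc j)) A" and "S \<notin> ?E"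
      then have S: "S \<subseteq> A" "real (ecount S) \<le> (2 * 2 ^ 27 + 2) * n"
        "(\<Sum>v\<in>lucky R \<inter> alive A S. real (b v) ^ Suc j) \<le> (3 * C + 1) * n"
        by (auto simp: bad_def)
      have kC: "growth \<le> growth * C" "C \<le> growth * C" "6 * C \<le> growth * C"
        using C growth_bounds(1,4) by (auto simp: mult_le_cancel_right1)
      have "real (ecount S) \<le> growth * n"
        using S(2) by (rule order_trans) (intro mult_right_mono growth_bounds, simp)
      also have "\<dots> \<le> (growth * C) * n" using kC(1) by (rule mult_right_mono) simp
      finally have e: "real (ecount S) \<le> (growth * C) * n" .
      let ?A = "alive A S"
      have "inv_reg (growth * C) (Suc j) ?A"
        unfolding inv_reg_def inv_up_to_def
      proof (intro exI[of _ "X \<inter> ?A"] conjI ballI)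
        have "(\<Sum>v\<in>X \<inter> ?A. deg v) \<le> (\<Sum>v\<in>X. deg v)"
          using finite_subset[OF X(1) fA] by (intro sum_mono2) auto
        also have "\<dots> \<le> C * n" by (rule X(2))
        also have "\<dots> \<le> (growth * C) * n" using kC by (intro mult_right_mono) auto
        finally show "(\<Sum>v\<in>X \<inter> ?A. deg v) \<le> growth * C * n" .
        \<comment> \<open>A survivor outside \<open>X\<close> is either unlucky, which is rare for
          every sample, or lucky and nevertheless alive.\<close>
        have "(\<Sum>v\<in>?A - X \<inter> ?A. real (b v) ^ Suc j)
            \<le> (\<Sum>v\<in>(lucky R \<inter> alive A S) \<union> (R - lucky R). real (b v) ^ Suc j)"
          using R alive_subset[of A S]
          by (intro sum_mono2) (auto simp: R_def lucky_def intro: finite_subset[OF _ fA])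
        also have "\<dots> = (\<Sum>v\<in>lucky R \<inter> alive A S. real (b v) ^ Suc j) + (\<Sum>v\<in>R - lucky R. real (b v) ^ Suc j)"
          using R by (intro sum.union_disjoint) (auto simp: lucky_def)
        also have "\<dots> \<le> (3 * C + 1) * n + 2 * n" using S(3) unlucky by linarith
        also have "\<dots> = (3 * C + 3) * n" by (simp add: algebra_simps)
        also have "\<dots> \<le> (growth * C) * n"
        proof (rule mult_right_mono)
          show "3 * C + 3 \<le> growth * C" using kC(3) C by linarith
        qed simp
        finally show "(\<Sum>v\<in>?A - X \<inter> ?A. real (b v) ^ Suc j) \<le> growth * C * n" .
        fix v assume "v \<in> ?A - X \<inter> ?A"
        then have v: "v \<in> A - X" using alive_subset[of A S] by auto
        then show "N v \<noteq> {}" by (rule X(3))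
        show "(\<Sum>u\<in>N v \<inter> ?A. sprob 14 u) \<le> b v"
          by (rule sum_nbrs_mono[OF alive_subset X(4)[OF v]])
      qed auto
      then show False using bad e j by (simp add: bad_def stage_inv_def)
    qed
  qed simp
qed

text \<open>For neighbours with \<open>b u <= b v\<close>,
  \<open>sprob 5 u <= b v ^ 9 * sprob 14 u\<close>; thinness bounds their sum by
  \<open>b^10\<close>. Multiplying by \<open>sprob 5 v\<close> leaves \<open>b^5\<close>, and
  \<open>lo <= b\<close> gives the \<open>b^6\<close> of the invariant. Afterwards a vertex that is
  not dense has at most \<open>b * b^5\<close> such neighbours left.\<close>

lemma stage_down:
  assumes A: "scale A" and C: "C \<ge> 1" and inv: "inv_reg C 6 A"
  shows "pr (sampled 5 A) (bad (growth * C) 8 A) \<le> 2 * eps"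
proof -
  have fA: "finite A" using A by (rule scale_finite)
  obtain X where X: "X \<subseteq> A" "(\<Sum>v\<in>X. deg v) \<le> C * n"
      "\<And>v. v \<in> A - X \<Longrightarrow> (\<Sum>u\<in>N v \<inter> A. sprob 14 u) \<le> b v"
      "(\<Sum>v\<in>A - X. real (b v) ^ 6) \<le> C * n"
    using inv by (auto simp: inv_reg_def inv_up_to_def)
  have "lo * (\<Sum>v\<in>A - X. \<Sum>u\<in>{u\<in>N v \<inter> A - X. b u \<le> b v}. sprob 5 u * sprob 5 v) \<le> (\<Sum>v\<in>A - X. real (b v) ^ 6)"
    unfolding sum_distrib_left
  proof (intro sum_mono)
    fix v assume v: "v \<in> A - X"
    let ?Q = "{u\<in>N v \<inter> A - X. b u \<le> b v}"
    have "(\<Sum>u\<in>?Q. sprob 5 u) \<le> (\<Sum>u\<in>?Q. real (b v) ^ 9 * sprob 14 u)"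
    proof (intro sum_mono)
      fix u assume "u \<in> ?Q"
      then have "real (b u) ^ 9 \<le> real (b v) ^ 9" by (intro power_mono) auto
      then have "real (b u) ^ 9 * sprob 14 u \<le> real (b v) ^ 9 * sprob 14 u" using sprob_ok by (intro mult_right_mono) auto
      moreover have "sprob 5 u = real (b u) ^ 9 * sprob 14 u"
        using b_ge1[of u] by (simp add: sprob_def divide_simps flip: power_add)
      ultimately show "sprob 5 u \<le> real (b v) ^ 9 * sprob 14 u" by simp
    qed
    also have "\<dots> = real (b v) ^ 9 * (\<Sum>u\<in>?Q. sprob 14 u)" by (simp add: sum_distrib_left)
    also have "\<dots> \<le> real (b v) ^ 9 * (\<Sum>u\<in>N v \<inter> A. sprob 14 u)"
      using sprob_ok by (intro mult_left_mono sum_mono2) auto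
    also have "\<dots> \<le> real (b v) ^ 9 * real (b v)" using X(3)[OF v] by (intro mult_left_mono) auto
    finally have *: "(\<Sum>u\<in>?Q. sprob 5 u) \<le> real (b v) ^ 10" by (simp flip: power_Suc2)
    have "(\<Sum>u\<in>?Q. lo * (sprob 5 u * sprob 5 v)) = (lo * sprob 5 v) * (\<Sum>u\<in>?Q. sprob 5 u)"
      by (simp add: sum_distrib_left mult_ac)
    also have "\<dots> \<le> (real (b v) * sprob 5 v) * real (b v) ^ 10"
      using * v A lo sprob_ok by (intro mult_mono) (auto simp: scale_def intro!: sum_nonneg)
    also have "\<dots> = real (b v) ^ 6"
      using b_ge1[of v] by (simp add: sprob_def divide_simps flip: power_add power_Suc power_Suc2)
    finally show "(\<Sum>u\<in>?Q. lo * (sprob 5 u * sprob 5 v)) \<le> real (b v) ^ 6" .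
  qed
  also have "\<dots> \<le> C * n" by (rule X(4))
  finally have E: "lo * (\<Sum>v\<in>A - X. \<Sum>u\<in>{u\<in>N v \<inter> A - X. b u \<le> b v}. sprob 5 u * sprob 5 v) \<le> C * n" .
  have edges: "pr (sampled 5 A) {S. S \<subseteq> A \<and> real (ecount S) > (2 * C + 2 * C + 2) * n} \<le> eps"
    using C by (intro ecount_concentration[OF A X(1) _ _ X(2) E]) auto
  show ?thesis
  proof (rule pr_le_two[OF _ edges dense_concentration[OF A]])
    show "bad (growth * C) 8 A \<subseteq> {S. S \<subseteq> A \<and> real (ecount S) > (2 * C + 2 * C + 2) * n} \<union>
      {S. S \<subseteq> A \<and> (\<Sum>v\<in>{v\<in>dense 5 A. N v \<inter> S = {}}. deg v) > (2 ^ 27 * fact 28 + 1) * n}" (is "_ \<subseteq> ?E")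
    proof (rule subsetI, rule ccontr)
      fix S assume bad: "S \<in> bad (growth * C) 8 A" and "S \<notin> ?E"
      then have S: "S \<subseteq> A" "real (ecount S) \<le> (2 * C + 2 * C + 2) * n"
        "(\<Sum>v\<in>{v\<in>dense 5 A. N v \<inter> S = {}}. deg v) \<le> (2 ^ 27 * fact 28 + 1) * n"
        by (auto simp: bad_def)
      have kC: "growth \<le> growth * C" "C \<le> growth * C" "6 * C \<le> growth * C" "(2 ^ 27 * fact 28 + 2) * C \<le> growth * C"
        using C growth_bounds(1,3,4) by (auto intro!: mult_right_mono simp: mult_le_cancel_right1)
      have "real (ecount S) \<le> (6 * C) * n"
        using S(2) C by (elim order_trans) (intro mult_right_mono, auto)
      also have "\<dots> \<le> (growth * C) * n" using kC(3) by (rule mult_right_mono) simp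
      finally have e: "real (ecount S) \<le> (growth * C) * n" .
      let ?A = "alive A S"
      define X' where "X' = (X \<union> dense 5 A) \<inter> ?A"
      have "inv_down (growth * C) ?A"
        unfolding inv_down_def inv_up_to_def
      proof (intro exI[of _ X'] conjI ballI)
        show "X' \<subseteq> ?A" by (auto simp: X'_def)
        have fX: "finite X" "finite (dense 5 A)" using finite_subset[OF X(1) fA] fA by (auto simp: dense_def)
        have "(\<Sum>v\<in>X'. deg v) \<le> (\<Sum>v\<in>X \<union> {v\<in>dense 5 A. N v \<inter> S = {}}. deg v)"
          using fX by (intro sum_mono2) (auto simp: X'_def alive_def)
        also have "\<dots> \<le> (\<Sum>v\<in>X. deg v) + (\<Sum>v\<in>{v\<in>dense 5 A. N v \<inter> S = {}}. deg v)"
          using fX by (subst sum_Un) (auto intro!: sum_nonneg)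
        also have "\<dots> \<le> C * n + (2 ^ 27 * fact 28 + 1) * n" using X(2) S(3) by linarith
        also have "\<dots> = (C + (2 ^ 27 * fact 28 + 1) * 1) * n" by (simp add: algebra_simps)
        also have "\<dots> \<le> (C + (2 ^ 27 * fact 28 + 1) * C) * n"
          using C by (intro mult_right_mono add_left_mono mult_left_mono) auto
        also have "\<dots> = ((2 ^ 27 * fact 28 + 2) * C) * n" by (simp add: algebra_simps)
        also have "\<dots> \<le> (growth * C) * n" using kC(4) by (rule mult_right_mono) simp
        finally show "(\<Sum>v\<in>X'. deg v) \<le> growth * C * n" .
        have "(\<Sum>v\<in>?A - X'. real (b v) ^ 6) \<le> (\<Sum>v\<in>A - X. real (b v) ^ 6)"
          using fA alive_subset[of A S] by (intro sum_mono2) (auto simp: X'_def)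
        also have "\<dots> \<le> C * n" by (rule X(4))
        also have "\<dots> \<le> (growth * C) * n" using kC by (intro mult_right_mono) auto
        finally show "(\<Sum>v\<in>?A - X'. real (b v) ^ 6) \<le> growth * C * n" .
        fix v assume "v \<in> ?A - X'"
        then have "v \<in> A" "v \<notin> dense 5 A" using alive_subset[of A S] by (auto simp: X'_def)
        then have "(\<Sum>u\<in>N v \<inter> A. sprob 5 u) \<le> b v" by (auto simp: dense_def)
        let ?Q = "{u\<in>N v \<inter> ?A. b u \<le> b v}"
        have "real (card ?Q) * sprob 5 v = (\<Sum>u\<in>?Q. sprob 5 v)" by simp
        also have "\<dots> \<le> (\<Sum>u\<in>?Q. sprob 5 u)" by (intro sum_mono sprob_mono) auto
        also have "\<dots> \<le> (\<Sum>u\<in>N v \<inter> A. sprob 5 u)"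
          using sprob_ok alive_subset[of A S] by (intro sum_mono2) auto
        also have "\<dots> \<le> b v" by fact
        finally have "real (card ?Q) \<le> real (b v) * real (b v) ^ 5"
          using b_ge1[of v] by (simp add: sprob_def field_simps)
        then have "real (card ?Q) \<le> real (b v ^ 6)" by (simp flip: power_Suc)
        then show "card ?Q \<le> b v ^ 6" by (simp only: of_nat_le_iff)
      qed
      then show False using bad e by (simp add: bad_def stage_inv_def)
    qed
  qed
qed

lemma stage_last:
  assumes A: "scale A" and C: "C \<ge> 1" and inv: "inv_down C A"
  shows "pr (sampled 0 A) (bad (growth * C) 9 A) \<le> 2 * eps"
proof -
  have fA: "finite A" using A by (rule scale_finite)
  obtain X where X: "X \<subseteq> A" "(\<Sum>v\<in>X. deg v) \<le> C * n"
     "\<And>v. v \<in> A - X \<Longrightarrow> card {u\<in>N v \<inter> A. b u \<le> b v} \<le> b v ^ 6"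
     "(\<Sum>v\<in>A - X. real (b v) ^ 6) \<le> C * n"
    using inv by (auto simp: inv_down_def inv_up_to_def)
  have "A \<subseteq> V" "X \<subseteq> V" using X(1) scale_sub[OF A] by auto
  from of_nat_mono[OF ecount_le[OF this], where ?'a = real]
  have "real (ecount A) \<le> 2 * (\<Sum>v\<in>X. deg v) + 2 * (\<Sum>v\<in>A - X. real (card {u\<in>N v \<inter> A - X. b u \<le> b v}))"
    by simp
  also have "(\<Sum>v\<in>A - X. real (card {u\<in>N v \<inter> A - X. b u \<le> b v})) \<le> (\<Sum>v\<in>A - X. real (b v) ^ 6)"
  proof (intro sum_mono)
    fix v assume v: "v \<in> A - X"
    have "card {u\<in>N v \<inter> A - X. b u \<le> b v} \<le> card {u\<in>N v \<inter> A. b u \<le> b v}" by (intro card_mono) auto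
    also have "\<dots> \<le> b v ^ 6" by (rule X(3)[OF v])
    finally show "real (card {u\<in>N v \<inter> A - X. b u \<le> b v}) \<le> real (b v) ^ 6"
      unfolding of_nat_power[symmetric] by (rule of_nat_mono)
  qed
  also have "2 * (\<Sum>v\<in>X. deg v) + 2 * (\<Sum>v\<in>A - X. real (b v) ^ 6) \<le> (4 * C) * n"
    using X(2,4) by linarith
  also have "\<dots> \<le> (growth * C) * n" using growth_bounds(4) C by (intro mult_right_mono) auto
  finally have e: "real (ecount A) \<le> growth * C * n" by simp
  \<comment> \<open>Exponent \<open>0\<close> means probability \<open>1\<close>: everything is
    sampled, so nothing stays alive and the edge bound is deterministic.\<close>
  have "sampled 0 A = return_pmf A"
    unfolding random_subset_def using fA by (simp add: sprob_def bernoulli_1)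
  moreover have "A \<notin> bad (growth * C) 9 A" using e by (auto simp: bad_def stage_inv_def alive_def)
  ultimately show ?thesis using eps_nonneg by (simp add: measure_return_pmf)
qed

lemma stage:
  assumes A: "scale A" and C: "C \<ge> 1" and i: "i < 9" and inv: "stage_inv C i A"
  shows "pr (sampled (stage_exp i) A) (bad (growth * C) (Suc i) A) \<le> 2 * eps"
proof -
  consider "i = 0" | j where "i = Suc j" "j \<le> 5" | "i = 7" | "i = 8"
    using i by (cases i) force+
  then show ?thesis
  proof cases
    case 1 then show ?thesis using stage_first[OF A C] by (simp add: stage_exp_def)
  next
    case (2 j) then show ?thesis using stage_lucky[OF A C, of j] inv by (simp add: stage_exp_def stage_inv_def)
  next
    case 3 then show ?thesis using stage_down[OF A C] inv by (simp add: stage_exp_def stage_inv_def)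
  next
    case 4 then show ?thesis using stage_last[OF A C] inv by (simp add: stage_exp_def stage_inv_def)
  qed
qed

end

section \<open>Simulating a hub in the MPC model\<close>

definition nbrs :: "nat set set \<Rightarrow> nat \<Rightarrow> nat set" where
  "nbrs E v = {u. {v, u} \<in> E}"

fun parse :: "memory \<Rightarrow> (nat \<times> nat set) list" where
  "parse (v # c # xs) = (v, set (take c xs)) # parse (drop c xs)"
| "parse xs = []"

lemma parse_adjacency:
  assumes "\<And>v. v \<in> set vs \<Longrightarrow> finite (nbrs E v)"
  shows "parse (concat (map (adjacency_words E) vs)) = map (\<lambda>v. (v, nbrs E v)) vs"
  using assms by (induction vs) (auto simp: adjacency_words_def Let_def nbrs_def)

definition block :: "nat \<Rightarrow> nat \<Rightarrow> nat set \<Rightarrow> memory" where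
  "block q j g = sorted_list_of_set {x\<in>g. x div q = j}"

lemma set_block: "finite g \<Longrightarrow> set (block q j g) = {x\<in>g. x div q = j}"
  by (simp add: block_def)

lemma length_block_le:
  assumes "q > 0"
  shows "length (block q j g) \<le> q"
proof -
  have "{x\<in>g. x div q = j} \<subseteq> {j * q..<j * q + q}"
  proof
    fix x assume "x \<in> {x\<in>g. x div q = j}"
    then have "x = j * q + x mod q" using div_mult_mod_eq[of x q] by auto
    then show "x \<in> {j * q..<j * q + q}" using mod_less_divisor[OF assms, of x] by auto
  qed
  then have "card {x\<in>g. x div q = j} \<le> card {j * q..<j * q + q}" by (intro card_mono) auto
  then show ?thesis by (simp add: block_def)
qed

lemma UN_block:
  assumes "finite g" "\<And>x. x \<in> g \<Longrightarrow> x < M * q"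
  shows "(\<Union>j<M. set (block q j g)) = g"
  using assms by (auto simp: set_block less_mult_imp_div_less)

lemma sum_length_block_le:
  assumes "finite g"
  shows "(\<Sum>j<M. length (block q j g)) \<le> card g"
proof -
  have "(\<Sum>j<M. length (block q j g)) = (\<Sum>j<M. card {x\<in>g. x div q = j})" by (simp add: block_def)
  also have "\<dots> = card (\<Union>j<M. {x\<in>g. x div q = j})"
    using assms by (subst card_UN_disjoint) auto
  also have "\<dots> \<le> card g" using assms by (intro card_mono) auto
  finally show ?thesis .
qed

section \<open>Rounds in which at most one machine is random\<close>

definition conf :: "nat \<Rightarrow> (nat \<Rightarrow> action) \<Rightarrow> config" where
  "conf M f i = (if i < M then f i else Halt [])"

lemma conf_less [simp]: "i < M \<Longrightarrow> conf M f i = f i"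
  and conf_ge [simp]: "\<not> i < M \<Longrightarrow> conf M f i = Halt []"
  by (auto simp: conf_def)

lemma mpc_round_return:
  assumes "\<And>i. i < M \<Longrightarrow> (case cfg i of Halt res \<Rightarrow> return_pmf (Halt res)
     | Continue mem out \<Rightarrow> P n M i mem (\<lambda>k. sent (cfg k) i)) = return_pmf (f i)"
  shows "mpc_round P n M cfg = return_pmf (conf M f)"
proof -
  have "mpc_round P n M cfg = Pi_pmf {..<M} (Halt []) (\<lambda>i. return_pmf (f i))"
    unfolding mpc_round_def using assms by (intro Pi_pmf_cong) auto
  also have "\<dots> = return_pmf (conf M f)"
    by (subst Pi_pmf_return_pmf) (auto simp: conf_def fun_eq_iff)
  finally show ?thesis .
qed

lemma Pi_pmf_single_random:
  assumes "finite A" "a \<in> A" "p a = map_pmf h Q" "\<And>x. x \<in> A \<Longrightarrow> x \<noteq> a \<Longrightarrow> p x = return_pmf (f x)"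
  shows "Pi_pmf A d p = map_pmf (\<lambda>y x. if x = a then h y else if x \<in> A then f x else d) Q"
proof -
  have A: "A = insert a (A - {a})" using assms(2) by auto
  have "Pi_pmf A d p = Pi_pmf (insert a (A - {a})) d p" using A by simp
  also have "\<dots> = do {y \<leftarrow> p a; g \<leftarrow> Pi_pmf (A - {a}) d p; return_pmf (g(a := y))}"
    using assms(1) by (intro Pi_pmf_insert') auto
  also have "Pi_pmf (A - {a}) d p = Pi_pmf (A - {a}) d (\<lambda>x. return_pmf (f x))"
    using assms(4) by (intro Pi_pmf_cong) auto
  also have "\<dots> = return_pmf (\<lambda>x. if x \<in> A - {a} then f x else d)"
    using assms(1) by (subst Pi_pmf_return_pmf) auto
  finally have "Pi_pmf A d p = p a \<bind> (\<lambda>y. return_pmf ((\<lambda>x. if x \<in> A - {a} then f x else d)(a := y)))"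
    unfolding bind_return_pmf .
  also have "\<dots> = map_pmf (\<lambda>y. (\<lambda>x. if x \<in> A - {a} then f x else d)(a := y)) (p a)"
    by (simp add: map_pmf_def)
  also have "\<dots> = map_pmf (\<lambda>y x. if x = a then h y else if x \<in> A then f x else d) Q"
    unfolding assms(3) map_pmf_comp by (intro map_pmf_cong) (auto simp: fun_eq_iff assms(2))
  finally show ?thesis .
qed

section \<open>Composition of random steps and persistence of halting\<close>

lemma pr_bind: "pr (bind_pmf M f) X = expect M (\<lambda>x. pr (f x) X)"
  unfolding measure_pmf_bind
  by (subst measure_pmf.measure_bind[where N = "count_space UNIV"]) (auto simp: space_subprob_algebra prob_space_imp_subprob_space measure_pmf.prob_space_axioms)

lemma pr_bind_le:
  assumes "\<And>x. x \<in> set_pmf M \<Longrightarrow> x \<in> G \<Longrightarrow> pr (f x) X \<le> q" "q \<ge> 0"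
  shows "pr (bind_pmf M f) X \<le> pr M (- G) + q"
proof -
  have "expect M (\<lambda>x. pr (f x) X) \<le> expect M (\<lambda>x. indicator (- G) x + q)"
  proof (intro integral_mono_AE)
    show "integrable (measure_pmf M) (\<lambda>x. pr (f x) X)"
      by (intro measure_pmf.integrable_const_bound[where B = 1]) auto
    show "integrable (measure_pmf M) (\<lambda>x. indicator (- G) x + q)"
      using assms(2) by (intro measure_pmf.integrable_const_bound[where B = "1 + q"]) (auto simp: indicator_def)
    show "AE x in measure_pmf M. pr (f x) X \<le> indicator (- G) x + q"
    proof (simp add: AE_measure_pmf_iff, safe)
      fix x assume x: "x \<in> set_pmf M"
      show "pr (f x) X \<le> indicator (- G) x + q"
      proof (cases "x \<in> G")
        case True then show ?thesis using assms(1)[OF x] by simp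
      next
        case False
        have "pr (f x) X \<le> 1 + q" using measure_pmf.prob_le_1[of "f x" X] assms(2) by linarith
        then show ?thesis using False by (simp add: indicator_def)
      qed
    qed
  qed
  also have "\<dots> = pr M (- G) + q"
    by (subst Bochner_Integration.integral_add)
      (auto intro!: measure_pmf.integrable_const_bound[where B = 1])
  finally show ?thesis by (simp add: pr_bind)
qed

primrec iterate_pmf :: "('a \<Rightarrow> 'a pmf) \<Rightarrow> nat \<Rightarrow> 'a \<Rightarrow> 'a pmf" where
  "iterate_pmf k 0 x = return_pmf x"
| "iterate_pmf k (Suc t) x = bind_pmf (iterate_pmf k t x) k"

lemma iterate_pmf_add: "iterate_pmf k (s + t) x = bind_pmf (iterate_pmf k s x) (iterate_pmf k t)"
  by (induction t) (simp_all add: bind_return_pmf' bind_assoc_pmf)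

lemma all_halted_mpc_round:
  assumes "all_halted M cfg" "cfg' \<in> set_pmf (mpc_round P n M cfg)"
  shows "all_halted M cfg'"
proof -
  have "mpc_round P n M cfg = return_pmf (conf M cfg)"
  proof (rule mpc_round_return)
    fix i assume "i < M"
    then have "halted (cfg i)" using assms(1) by (simp add: all_halted_def)
    then show "(case cfg i of Halt res \<Rightarrow> return_pmf (Halt res)
       | Continue mem out \<Rightarrow> P n M i mem (\<lambda>k. sent (cfg k) i)) = return_pmf (cfg i)"
      by (cases "cfg i") auto
  qed
  then show ?thesis using assms by (auto simp: all_halted_def)
qed

lemma prob_halted_mono:
  assumes "s \<le> t"
  shows "pr (mpc_run P n M inp s) {cfg. all_halted M cfg} \<le> pr (mpc_run P n M inp t) {cfg. all_halted M cfg}"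
  using assms
proof (induction t rule: dec_induct)
  case (step t)
  let ?H = "{cfg. all_halted M cfg}"
  have "pr (mpc_run P n M inp (Suc t)) (- ?H) \<le> pr (mpc_run P n M inp t) (- ?H) + 0"
    unfolding mpc_run.simps
  proof (rule pr_bind_le)
    fix cfg assume "cfg \<in> set_pmf (mpc_run P n M inp t)" "cfg \<in> ?H"
    then have "set_pmf (mpc_round P n M cfg) \<subseteq> ?H" using all_halted_mpc_round by auto
    then have "pr (mpc_round P n M cfg) (- ?H) = 0" by (subst measure_pmf_zero_iff) auto
    then show "pr (mpc_round P n M cfg) (- ?H) \<le> 0" by simp
  qed simp
  then show ?case using step by (simp add: measure_pmf.prob_compl[of ?H, simplified] Compl_eq_Diff_UNIV)
qed simp

section \<open>The program of the hub and the other machines\<close>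

definition pack :: "nat \<Rightarrow> nat \<Rightarrow> nat set \<Rightarrow> memory \<Rightarrow> memory" where
  "pack n ph g inp = (n + ph) # card g # sorted_list_of_set g @ inp"

type_synonym post_rule = "nat \<Rightarrow> nat set \<Rightarrow> nat \<Rightarrow> nat set \<Rightarrow> nat list"

type_synonym update_rule = "nat \<Rightarrow> nat set \<Rightarrow> nat set option \<Rightarrow> nat set pmf"

definition posts :: "post_rule \<Rightarrow> nat \<Rightarrow> nat set \<Rightarrow> memory \<Rightarrow> nat list" where
  "posts post n g inp = concat (map (\<lambda>(v, Nv). post n g v Nv) (parse inp))"

text \<open>The summand \<open>1\<close> makes \<open>M\<close> blocks cover all of
  \<open>{..<K * n}\<close>, while their total capacity exceeds \<open>K * n\<close> by at most
  \<open>M\<close>.\<close>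

definition block_size :: "nat \<Rightarrow> nat \<Rightarrow> nat \<Rightarrow> nat" where
  "block_size K n M = K * n div M + 1"

text \<open>In the very first round nothing has been received, so the union is empty; the empty set
  thereby serves as the initial state.\<close>

definition hub_start ::
  "post_rule \<Rightarrow> (nat \<Rightarrow> nat set \<Rightarrow> bool) \<Rightarrow> (nat \<Rightarrow> nat set \<Rightarrow> nat set) \<Rightarrow>
   nat \<Rightarrow> nat \<Rightarrow> memory \<Rightarrow> (nat \<Rightarrow> memory) \<Rightarrow> action pmf" where
  "hub_start post fin res n M mem recv =
    (let g = (\<Union>k<M. set (recv k)) in return_pmf (
       if fin n g then Halt (sorted_list_of_set (res n g))
       else Continue (pack n 0 g mem) (\<lambda>j. if j = 0 then [length (posts post n g mem)] else [])))"

text \<open>Phases \<open>2\<close> and \<open>3\<close> record whether posting was allowed, since a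
  refusal and empty posts both leave the hub without messages. The new state is distributed in two
  hops because sending all of it from the hub to every machine could exceed the hub's bandwidth.
  Phase \<open>4\<close> restores the bare input share, so the next round begins with
  \<open>hub_start\<close>.\<close>

definition hub_phase ::
  "post_rule \<Rightarrow> update_rule \<Rightarrow>
   nat \<Rightarrow> nat \<Rightarrow> nat \<Rightarrow> nat \<Rightarrow> nat \<Rightarrow> nat \<Rightarrow> nat set \<Rightarrow> memory \<Rightarrow> (nat \<Rightarrow> memory) \<Rightarrow> action pmf" where
  "hub_phase post upd L K n M i ph g inp recv =
    (if ph = 0 then return_pmf (Continue (pack n 1 g inp)
       (\<lambda>j. if i = 0 then [if (\<Sum>k<M. sum_list (recv k)) \<le> L * n then 1 else 0] else []))
     else if ph = 1 then return_pmf (Continue (pack n (if recv 0 = [1] then 2 else 3) g inp)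
       (\<lambda>j. if j = 0 then (if recv 0 = [1] then posts post n g inp else []) else []))
     else if ph = 2 \<or> ph = 3 then
       (if i = 0 then map_pmf (\<lambda>g'. Continue (pack n 4 {} inp) (\<lambda>j. block (block_size K n M) j g'))
          (upd n g (if ph = 2 then Some (\<Union>k<M. set (recv k)) else None))
        else return_pmf (Continue (pack n 4 {} inp) (\<lambda>_. [])))
     else return_pmf (Continue inp (\<lambda>_. recv 0)))"

text \<open>The first word of an input share, if any, is a vertex, so that a first word \<open>n + ph\<close> marks
  a packed memory in phase \<open>ph\<close>. Machine \<open>0\<close> is the hub. A superstep takes five rounds: every
  machine reports how much it wants to post, the hub allows it or not, the machines post, the hub
  distributes the blocks of the new state, the blocks are broadcast.\<close>

definition hub_algorithm ::
  "post_rule \<Rightarrow> update_rule \<Rightarrow>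
   (nat \<Rightarrow> nat set \<Rightarrow> bool) \<Rightarrow> (nat \<Rightarrow> nat set \<Rightarrow> nat set) \<Rightarrow> nat \<Rightarrow> nat \<Rightarrow> algorithm" where
  "hub_algorithm post upd fin res L K n M i mem recv =
    (if mem = [] \<or> hd mem < n then hub_start post fin res n M mem recv
     else hub_phase post upd L K n M i (hd mem - n)
       (set (take (mem ! 1) (drop 2 mem))) (drop (2 + mem ! 1) mem) recv)"

lemma hub_algorithm_pack:
  assumes "finite g"
  shows "hub_algorithm post upd fin res L K n M i (pack n ph g inp) recv = hub_phase post upd L K n M i ph g inp recv"
proof -
  have "set (take (card g) (sorted_list_of_set g @ inp)) = g" using assms by simp
  then show ?thesis by (simp add: hub_algorithm_def pack_def numeral_2_eq_2)
qed

locale hub_run =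
  fixes post :: post_rule
    and upd :: update_rule
    and fin :: "nat \<Rightarrow> nat set \<Rightarrow> bool" and res :: "nat \<Rightarrow> nat set \<Rightarrow> nat set"
    and L K lam kap n :: nat and E :: "nat set set" and M :: nat and place :: "nat \<Rightarrow> nat"
    and good :: "nat set \<Rightarrow> bool" and S B :: nat
  assumes n1: "n \<ge> 1" and graph: "simple_graph {..<n} E" and M_le: "M \<le> kap * n"
    and placed: "placement n E M (lam * n) place"
    and S_ge: "(lam + 3 * K + L + kap + 6) * n \<le> S" and B_ge: "(K + 6) * n ^ 2 < 2 ^ B" and K1: "K \<ge> 1"
  assumes good_init: "good {}"
    and good_bound: "\<And>g. good g \<Longrightarrow> g \<subseteq> {..<K * n}"
    and post_length: "\<And>g v. good g \<Longrightarrow> v < n \<Longrightarrow> length (post n g v (nbrs E v)) \<le> K * n"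
    and post_words: "\<And>g v. good g \<Longrightarrow> v < n \<Longrightarrow> set (post n g v (nbrs E v)) \<subseteq> {..<K * n ^ 2}"
    and res: "\<And>g. good g \<Longrightarrow> fin n g \<Longrightarrow> ruling_set 2 {..<n} E (res n g)"
  assumes good_step: "\<And>g g'. good g \<Longrightarrow> \<not> fin n g \<Longrightarrow>
      g' \<in> set_pmf (upd n g (if (\<Sum>v<n. length (post n g v (nbrs E v))) \<le> L * n
         then Some (\<Union>v<n. set (post n g v (nbrs E v))) else None)) \<Longrightarrow> good g'"
begin

definition fits :: "nat set \<Rightarrow> bool" where
  "fits g \<longleftrightarrow> (\<Sum>v<n. length (post n g v (nbrs E v))) \<le> L * n"

text \<open>The Markov chain on states that is simulated, one step per superstep. Finished states
  are absorbing, matching machines that have halted.\<close>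

definition kern :: "nat set \<Rightarrow> nat set pmf" where
  "kern g = (if fin n g then return_pmf g
     else upd n g (if fits g then Some (\<Union>v<n. set (post n g v (nbrs E v))) else None))"

abbreviation chain :: "nat \<Rightarrow> nat set pmf" where
  "chain t \<equiv> iterate_pmf kern t {}"

lemma good_kern: "good g \<Longrightarrow> g' \<in> set_pmf (kern g) \<Longrightarrow> good g'"
  using good_step by (auto simp: kern_def fits_def split: if_splits)

lemma good_chain: "g \<in> set_pmf (chain t) \<Longrightarrow> good g"
  by (induction t arbitrary: g) (auto simp: good_init intro: good_kern)

abbreviation alg :: algorithm where "alg \<equiv> hub_algorithm post upd fin res L K"

abbreviation inp :: "nat \<Rightarrow> memory" where "inp \<equiv> input_share n E place"

abbreviation q :: nat where "q \<equiv> block_size K n M"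

definition cfg_blocks :: "nat set \<Rightarrow> config" where
  "cfg_blocks g = conf M (\<lambda>i. Continue (inp i) (\<lambda>_. block q i g))"

definition cfg_report :: "nat set \<Rightarrow> config" where
  "cfg_report g = conf M (\<lambda>i. if fin n g then Halt (sorted_list_of_set (res n g))
     else Continue (pack n 0 g (inp i)) (\<lambda>j. if j = 0 then [length (posts post n g (inp i))] else []))"

definition cfg_permit :: "nat set \<Rightarrow> config" where
  "cfg_permit g = conf M (\<lambda>i. Continue (pack n 1 g (inp i)) (\<lambda>j. if i = 0 then [if fits g then 1 else 0] else []))"

definition cfg_post :: "nat set \<Rightarrow> config" where
  "cfg_post g = conf M (\<lambda>i. Continue (pack n (if fits g then 2 else 3) g (inp i))
     (\<lambda>j. if j = 0 then (if fits g then posts post n g (inp i) else []) else []))"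

definition cfg_split :: "nat set \<Rightarrow> config" where
  "cfg_split g = conf M (\<lambda>i. Continue (pack n 4 {} (inp i)) (\<lambda>j. if i = 0 then block q j g else []))"

section \<open>From single rounds to supersteps\<close>

lemma M_pos: "M > 0" using placed n1 by (auto simp: placement_def)

lemma finite_nbrs: "finite (nbrs E v)"
proof -
  have "nbrs E v \<subseteq> {..<n}" using graph by (auto simp: simple_graph_def nbrs_def)
  then show ?thesis by (rule finite_subset) simp
qed

lemma good_finite: "good g \<Longrightarrow> finite g"
  using finite_subset[OF good_bound] by simp

lemma good_card: "good g \<Longrightarrow> card g \<le> K * n"
  using card_mono[OF _ good_bound, of g] by simp

lemma inp_hd: "inp i = [] \<or> hd (inp i) < n"
proof -
  let ?vs = "filter (\<lambda>v. place v = i) [0..<n]"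
  show ?thesis
  proof (cases ?vs)
    case (Cons v vs)
    then have "v \<in> set ?vs" by simp
    then have "v < n" by simp
    then show ?thesis unfolding input_share_def Cons by (simp add: adjacency_words_def Let_def)
  qed (simp add: input_share_def)
qed

lemma parse_inp: "parse (inp i) = map (\<lambda>v. (v, nbrs E v)) (filter (\<lambda>v. place v = i) [0..<n])"
  unfolding input_share_def by (rule parse_adjacency) (rule finite_nbrs)

lemma posts_inp: "posts post n g (inp i) =
   concat (map (\<lambda>v. post n g v (nbrs E v)) (filter (\<lambda>v. place v = i) [0..<n]))"
  by (simp add: posts_def parse_inp comp_def)

lemma length_posts: "length (posts post n g (inp i)) = (\<Sum>v\<in>{v\<in>{..<n}. place v = i}. length (post n g v (nbrs E v)))"
proof -
  have "length (posts post n g (inp i)) = sum_list (map (\<lambda>v. length (post n g v (nbrs E v))) (filter (\<lambda>v. place v = i) [0..<n]))"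
    by (simp add: posts_inp length_concat comp_def)
  also have "\<dots> = (\<Sum>v\<in>set (filter (\<lambda>v. place v = i) [0..<n]). length (post n g v (nbrs E v)))"
    by (rule sum_list_distinct_conv_sum_set) simp
  also have "set (filter (\<lambda>v. place v = i) [0..<n]) = {v\<in>{..<n}. place v = i}" by auto
  finally show ?thesis .
qed

lemma sum_length_posts: "(\<Sum>i<M. length (posts post n g (inp i))) = (\<Sum>v<n. length (post n g v (nbrs E v)))"
  unfolding length_posts using placed by (intro sum.group) (auto simp: placement_def)

lemma set_posts: "(\<Union>i<M. set (posts post n g (inp i))) = (\<Union>v<n. set (post n g v (nbrs E v)))"
  using placed by (auto simp: posts_inp placement_def)

lemma q_pos: "q > 0" by (simp add: block_size_def)

lemma less_M_q: "x < K * n \<Longrightarrow> x < M * q"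
proof -
  assume "x < K * n"
  moreover have "K * n = M * (K * n div M) + K * n mod M" by simp
  moreover have "K * n mod M < M" using M_pos by simp
  ultimately have "x < M * (K * n div M) + M" by linarith
  then show ?thesis by (simp add: block_size_def)
qed

lemma UN_block_good: "good g \<Longrightarrow> (\<Union>k<M. set (block q k g)) = g"
  using good_finite good_bound less_M_q by (intro UN_block) auto

lemma start_inp:
  assumes "good g" "\<And>k. k < M \<Longrightarrow> recv k = block q k g"
  shows "alg n M i (inp i) recv = return_pmf (if fin n g then Halt (sorted_list_of_set (res n g))
     else Continue (pack n 0 g (inp i)) (\<lambda>j. if j = 0 then [length (posts post n g (inp i))] else []))"
proof -
  have "(\<Union>k<M. set (recv k)) = g" using UN_block_good[OF assms(1)] assms(2) by auto
  then show ?thesis using inp_hd[of i] by (auto simp: hub_algorithm_def hub_start_def)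
qed

lemma round_init: "mpc_round alg n M (\<lambda>i. Continue (inp i) (\<lambda>_. [])) = return_pmf (cfg_report {})"
  unfolding cfg_report_def by (rule mpc_round_return) (simp add: start_inp[OF good_init] block_def)

lemma round_blocks: "good g \<Longrightarrow> mpc_round alg n M (cfg_blocks g) = return_pmf (cfg_report g)"
  unfolding cfg_report_def by (rule mpc_round_return) (simp add: start_inp[of g] cfg_blocks_def)

lemma round_fin: "fin n g \<Longrightarrow> mpc_round alg n M (cfg_report g) = return_pmf (cfg_report g)"
  by (subst (2) cfg_report_def, rule mpc_round_return) (simp add: cfg_report_def)

lemma round_report: "good g \<Longrightarrow> \<not> fin n g \<Longrightarrow> mpc_round alg n M (cfg_report g) = return_pmf (cfg_permit g)"
  unfolding cfg_permit_def
proof (rule mpc_round_return)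
  fix i assume g: "good g" "\<not> fin n g" and i: "i < M"
  have "(\<Sum>k<M. sum_list (sent (cfg_report g k) 0)) = (\<Sum>k<M. length (posts post n g (inp k)))"
    using g by (intro sum.cong) (auto simp: cfg_report_def)
  then have "((\<Sum>k<M. sum_list (sent (cfg_report g k) 0)) \<le> L * n) = fits g"
    by (simp add: sum_length_posts fits_def)
  then show "(case cfg_report g i of Halt res \<Rightarrow> return_pmf (Halt res)
     | Continue mem out \<Rightarrow> alg n M i mem (\<lambda>k. sent (cfg_report g k) i)) =
     return_pmf (Continue (pack n 1 g (inp i)) (\<lambda>j. if i = 0 then [if fits g then 1 else 0] else []))"
    using g i by (cases "i = 0") (auto simp: cfg_report_def hub_algorithm_pack good_finite hub_phase_def)
qed

lemma round_permit: "good g \<Longrightarrow> mpc_round alg n M (cfg_permit g) = return_pmf (cfg_post g)"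
  unfolding cfg_post_def
  by (rule mpc_round_return) (auto simp: cfg_permit_def hub_algorithm_pack good_finite hub_phase_def M_pos)

lemma round_post:
  assumes g: "good g" "\<not> fin n g"
  shows "mpc_round alg n M (cfg_post g) = map_pmf cfg_split (kern g)"
proof -
  have "(\<Union>k<M. set (sent (cfg_post g k) 0)) = (\<Union>v<n. set (post n g v (nbrs E v)))" if "fits g"
    using that by (simp add: cfg_post_def set_posts[symmetric])
  then have k: "kern g = upd n g (if fits g then Some (\<Union>k<M. set (sent (cfg_post g k) 0)) else None)"
    using g by (simp add: kern_def)
  \<comment> \<open>Only the hub tosses coins, so the product distribution is an image of the hub's
    update.\<close>
  have "mpc_round alg n M (cfg_post g) = map_pmf (\<lambda>y x. if x = 0 then Continue (pack n 4 {} (inp 0)) (\<lambda>j. block q j y)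
       else if x \<in> {..<M} then Continue (pack n 4 {} (inp x)) (\<lambda>_. []) else Halt []) (kern g)"
    unfolding mpc_round_def
  proof (rule Pi_pmf_single_random)
    show "(case cfg_post g 0 of Halt res \<Rightarrow> return_pmf (Halt res)
        | Continue mem out \<Rightarrow> alg n M 0 mem (\<lambda>k. sent (cfg_post g k) 0)) =
      map_pmf (\<lambda>y. Continue (pack n 4 {} (inp 0)) (\<lambda>j. block q j y)) (kern g)"
      unfolding k using g M_pos
      by (simp add: cfg_post_def[of g, THEN fun_cong, of 0] hub_algorithm_pack good_finite hub_phase_def)
    fix x assume "x \<in> {..<M}" "x \<noteq> 0"
    then show "(case cfg_post g x of Halt res \<Rightarrow> return_pmf (Halt res)
        | Continue mem out \<Rightarrow> alg n M x mem (\<lambda>k. sent (cfg_post g k) x)) =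
      return_pmf (Continue (pack n 4 {} (inp x)) (\<lambda>_. []))"
      using g by (simp add: cfg_post_def[of g, THEN fun_cong, of x] hub_algorithm_pack good_finite hub_phase_def)
  qed (use M_pos in auto)
  also have "\<dots> = map_pmf cfg_split (kern g)"
    using M_pos by (intro map_pmf_cong) (auto simp: cfg_split_def conf_def fun_eq_iff)
  finally show ?thesis .
qed

lemma round_split: "mpc_round alg n M (cfg_split g) = return_pmf (cfg_blocks g)"
  unfolding cfg_blocks_def
  by (rule mpc_round_return) (auto simp: cfg_split_def hub_algorithm_pack hub_phase_def M_pos)

text \<open>The extra round is the one that turns the bare input into the report for the empty
  state. Since a report of a finished state is a fixed point of the round, the same count of five
  rounds applies to it.\<close>

lemma mpc_run_chain: "mpc_run alg n M inp (Suc (5 * t)) = map_pmf cfg_report (chain t)"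
proof (induction t)
  case 0
  show ?case by (simp add: bind_return_pmf round_init)
next
  case (Suc t)
  let ?r = "mpc_round alg n M"
  have step: "?r (cfg_report g) \<bind> (\<lambda>c. ?r c \<bind> (\<lambda>c. ?r c \<bind> (\<lambda>c. ?r c \<bind> ?r))) = map_pmf cfg_report (kern g)"
    if "g \<in> set_pmf (chain t)" for g
  proof (cases "fin n g")
    case True
    then show ?thesis by (simp add: round_fin bind_return_pmf kern_def)
  next
    case False
    have g: "good g" using good_chain[OF that] .
    have "?r (cfg_report g) \<bind> (\<lambda>c. ?r c \<bind> (\<lambda>c. ?r c \<bind> (\<lambda>c. ?r c \<bind> ?r)))
      = kern g \<bind> (\<lambda>g'. ?r (cfg_blocks g'))"
      using g False by (simp add: round_report round_permit round_post round_split bind_return_pmf bind_map_pmf)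
    also have "\<dots> = kern g \<bind> (\<lambda>g'. return_pmf (cfg_report g'))"
      using good_kern[OF g] by (intro bind_pmf_cong) (auto simp: round_blocks)
    finally show ?thesis by (simp add: map_pmf_def)
  qed
  have "mpc_run alg n M inp (Suc (5 * Suc t)) =
    mpc_run alg n M inp (Suc (5 * t)) \<bind> (\<lambda>c. ?r c \<bind> (\<lambda>c. ?r c \<bind> (\<lambda>c. ?r c \<bind> (\<lambda>c. ?r c \<bind> ?r))))"
    by (simp add: numeral_eq_Suc bind_assoc_pmf)
  also have "\<dots> = chain t \<bind> (\<lambda>g. ?r (cfg_report g) \<bind> (\<lambda>c. ?r c \<bind> (\<lambda>c. ?r c \<bind> (\<lambda>c. ?r c \<bind> ?r))))"
    unfolding Suc.IH by (simp add: bind_map_pmf)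
  also have "\<dots> = chain t \<bind> (\<lambda>g. map_pmf cfg_report (kern g))"
    using step by (intro bind_pmf_cong) auto
  finally show ?case by (simp add: map_bind_pmf)
qed

text \<open>Resource limits concern every round, so configurations in the middle of a superstep are
  included as well.\<close>

definition reachable :: "config set" where
  "reachable = {c. \<exists>g. good g \<and> (c = cfg_blocks g \<or> c = cfg_report g \<or> c = cfg_split g \<or> (\<not> fin n g \<and> (c = cfg_permit g \<or> c = cfg_post g)))}"

lemma reachable_round:
  assumes "c \<in> reachable" "c' \<in> set_pmf (mpc_round alg n M c)"
  shows "c' \<in> reachable"
proof -
  obtain g where g: "good g" and c: "c = cfg_blocks g \<or> c = cfg_report g \<or> c = cfg_split g \<or> (\<not> fin n g \<and> (c = cfg_permit g \<or> c = cfg_post g))"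
    using assms(1) by (auto simp: reachable_def)
  have R: "cfg_blocks g \<in> reachable" "cfg_report g \<in> reachable" "\<not> fin n g \<Longrightarrow> cfg_permit g \<in> reachable" "\<not> fin n g \<Longrightarrow> cfg_post g \<in> reachable"
    using g by (auto simp: reachable_def)
  have RE: "cfg_split g' \<in> reachable" if "g' \<in> set_pmf (kern g)" for g'
    using good_kern[OF g that] by (auto simp: reachable_def)
  show ?thesis
    using c assms(2) R RE by (cases "fin n g") (auto simp: g round_blocks round_report round_permit round_post round_split round_fin)
qed

lemma reachable_run: "c \<in> set_pmf (mpc_run alg n M inp (Suc t)) \<Longrightarrow> c \<in> reachable"
proof (induction t arbitrary: c)
  case 0
  then have "c = cfg_report {}" by (simp add: bind_return_pmf round_init)
  then show ?case using good_init by (auto simp: reachable_def)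
next
  case (Suc t)
  then show ?case using reachable_round by auto
qed

end

section \<open>Resource limits\<close>

lemma sum_length_if_first: "0 < (M::nat) \<Longrightarrow> (\<Sum>j<M. length (if j = 0 then X else [])) = length X"
  by (simp add: if_distrib[of length] cong: if_cong)

context hub_run begin

lemma word_bounds: "n + 4 < 2 ^ B" "K * n < 2 ^ B" "K * n ^ 2 < 2 ^ B" "1 < (2::nat) ^ B"
proof -
  have "n \<le> n ^ 2" using n1 by (simp add: power2_eq_square)
  then have "n + 5 \<le> (K + 6) * n ^ 2" "K * n \<le> (K + 6) * n ^ 2" "K * n ^ 2 \<le> (K + 6) * n ^ 2"
    using n1 mult_mono[of K "K + 6" n "n ^ 2"] by (auto simp: add_mult_distrib)
  then show "n + 4 < 2 ^ B" "K * n < 2 ^ B" "K * n ^ 2 < 2 ^ B" "1 < (2::nat) ^ B" using B_ge n1 by linarith+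
qed

lemma S_bound: "lam * n + 3 * (K * n) + L * n + kap * n + 6 * n \<le> S"
  using S_ge by (simp add: add_mult_distrib)

lemma length_inp: "i < M \<Longrightarrow> length (inp i) \<le> lam * n"
  using placed by (simp add: placement_def)

lemma words_inp:
  assumes "w \<in> set (inp i)"
  shows "w < 2 ^ B"
proof -
  have sub: "nbrs E v \<subseteq> {..<n}" for v using graph by (auto simp: simple_graph_def nbrs_def)
  have "w \<le> n"
  proof -
    obtain v where v: "v < n" "w \<in> set (adjacency_words E v)"
      using assms by (auto simp: input_share_def)
    then have "w = v \<or> w = card (nbrs E v) \<or> w \<in> nbrs E v"
      using finite_nbrs by (auto simp: adjacency_words_def nbrs_def Let_def)
    then show ?thesis using v(1) sub[of v] card_mono[OF _ sub, of v] by auto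
  qed
  then show ?thesis using word_bounds(1) by linarith
qed

lemma length_pack: "good g \<or> g = {} \<Longrightarrow> i < M \<Longrightarrow> length (pack n ph g (inp i)) \<le> 2 + K * n + lam * n"
  using length_inp[of i] good_card[of g] by (auto simp: pack_def)

lemma words_pack:
  assumes "good g \<or> g = {}" "ph \<le> 4" "w \<in> set (pack n ph g (inp i))"
  shows "w < 2 ^ B"
proof -
  have "finite g" "card g \<le> K * n" "g \<subseteq> {..<K * n}" using assms(1) good_finite good_card good_bound by auto
  then consider "w = n + ph" | "w = card g" | "w < K * n" | "w \<in> set (inp i)"
    using assms(3) by (auto simp: pack_def)
  then show ?thesis using word_bounds \<open>card g \<le> K * n\<close> assms(2) words_inp by cases auto
qed

lemma words_block: "good g \<Longrightarrow> w \<in> set (block q j g) \<Longrightarrow> w < 2 ^ B"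
  using good_bound[of g] good_finite[of g] word_bounds(2) by (auto simp: set_block)

lemma words_posts: "good g \<Longrightarrow> w \<in> set (posts post n g (inp i)) \<Longrightarrow> w < 2 ^ B"
  using post_words[of g] word_bounds(3) by (fastforce simp: posts_inp)

lemma length_posts_le_sum: "i < M \<Longrightarrow> length (posts post n g (inp i)) \<le> (\<Sum>v<n. length (post n g v (nbrs E v)))"
  unfolding sum_length_posts[symmetric] by (rule member_le_sum) auto

lemma length_posts_word:
  assumes "good g" "i < M"
  shows "length (posts post n g (inp i)) < 2 ^ B"
proof -
  have "length (posts post n g (inp i)) \<le> (\<Sum>v<n. K * n)"
    using length_posts_le_sum[OF assms(2)] sum_mono[of "{..<n}" "\<lambda>v. length (post n g v (nbrs E v))" "\<lambda>_. K * n"]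
      post_length[OF assms(1)] by (meson lessThan_iff order_trans)
  also have "\<dots> = K * n ^ 2" by (simp add: power2_eq_square)
  finally show ?thesis using word_bounds(3) by linarith
qed

text \<open>The cost of broadcasting one block; rounding up the block size costs
  \<open>M <= kap * n\<close> words.\<close>

lemma block_total: "M * length (block q i g) \<le> K * n + kap * n"
proof -
  have "M * length (block q i g) \<le> M * q" using length_block_le[OF q_pos] by simp
  also have "M * q = M * (K * n div M) + M" by (simp add: block_size_def)
  also have "\<dots> \<le> K * n + kap * n" using M_le by (intro add_mono) auto
  finally show ?thesis .
qed

lemma sum_block_le: "good g \<Longrightarrow> (\<Sum>k<M. length (block q k g)) \<le> K * n"
  using sum_length_block_le[OF good_finite, of g q M] good_card[of g] by linarith

lemma limits_blocks:
  assumes g: "good g"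
  shows "within_limits S B M (cfg_blocks g)"
  unfolding within_limits_def
proof (intro allI impI conjI ballI)
  fix i assume i: "i < M"
  show "length (stored (cfg_blocks g i)) + (\<Sum>k<M. length (sent (cfg_blocks g k) i)) \<le> S"
    using i sum_block_le[OF g] length_inp[OF i] S_bound by (simp add: cfg_blocks_def)
  show "(\<Sum>j<M. length (sent (cfg_blocks g i) j)) \<le> S"
    using i block_total[of i g] S_bound by (simp add: cfg_blocks_def)
  show "w < 2 ^ B" if "w \<in> set (stored (cfg_blocks g i))" for w
    using i that words_inp[of w i] by (simp add: cfg_blocks_def)
  show "w < 2 ^ B" if "w \<in> set (sent (cfg_blocks g i) j)" for w j
    using i that words_block[OF g, of w i] by (simp add: cfg_blocks_def)
qed

lemma limits_report:
  assumes g: "good g"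
  shows "within_limits S B M (cfg_report g)"
  unfolding within_limits_def
proof (intro allI impI conjI ballI)
  fix i assume i: "i < M"
  have res_sub: "res n g \<subseteq> {..<n}" if "fin n g" using res[OF g that] by (simp add: ruling_set_def)
  show "length (stored (cfg_report g i)) + (\<Sum>k<M. length (sent (cfg_report g k) i)) \<le> S"
  proof (cases "fin n g")
    case True
    then have "length (stored (cfg_report g i)) \<le> n" using i card_mono[OF _ res_sub] by (simp add: cfg_report_def)
    moreover have "(\<Sum>k<M. length (sent (cfg_report g k) i)) = 0" using True by (simp add: cfg_report_def)
    ultimately show ?thesis using S_bound by linarith
  next
    case False
    have "(\<Sum>k<M. length (sent (cfg_report g k) i)) \<le> (\<Sum>k<M. 1)" using False by (intro sum_mono) (simp add: cfg_report_def)
    then have "(\<Sum>k<M. length (sent (cfg_report g k) i)) \<le> kap * n" using M_le by simp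
    moreover have "length (stored (cfg_report g i)) \<le> 2 + K * n + lam * n"
      using i False length_pack g by (simp add: cfg_report_def)
    ultimately show ?thesis using S_bound n1 by linarith
  qed
  show "(\<Sum>j<M. length (sent (cfg_report g i) j)) \<le> S"
    using i M_pos S_bound n1 by (simp add: cfg_report_def sum_length_if_first)
  show "w < 2 ^ B" if "w \<in> set (stored (cfg_report g i))" for w
  proof (cases "fin n g")
    case True
    then have "w < n" using i that res_sub finite_subset[OF res_sub] by (auto simp: cfg_report_def)
    then show ?thesis using word_bounds(1) by linarith
  next
    case False then show ?thesis using i that words_pack[of g 0 w i] g by (simp add: cfg_report_def)
  qed
  show "w < 2 ^ B" if "w \<in> set (sent (cfg_report g i) j)" for w j
    using i that length_posts_word[OF g i] by (simp add: cfg_report_def split: if_splits)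
qed

lemma limits_permit:
  assumes g: "good g"
  shows "within_limits S B M (cfg_permit g)"
  unfolding within_limits_def
proof (intro allI impI conjI ballI)
  fix i assume i: "i < M"
  have "(\<Sum>k<M. length (sent (cfg_permit g k) i)) = (\<Sum>k<M. length (if k = 0 then [0::nat] else []))"
    by (intro sum.cong) (auto simp: cfg_permit_def)
  also have "\<dots> = 1" using M_pos by (subst sum_length_if_first) auto
  moreover have "length (stored (cfg_permit g i)) \<le> 2 + K * n + lam * n"
      using i length_pack g by (simp add: cfg_permit_def)
  ultimately show "length (stored (cfg_permit g i)) + (\<Sum>k<M. length (sent (cfg_permit g k) i)) \<le> S"
    using S_bound n1 by linarith
  have "(\<Sum>j<M. length (sent (cfg_permit g i) j)) \<le> (\<Sum>j<M. 1)" using i by (intro sum_mono) (simp add: cfg_permit_def)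
  then show "(\<Sum>j<M. length (sent (cfg_permit g i) j)) \<le> S" using M_le S_bound by simp
  show "w < 2 ^ B" if "w \<in> set (stored (cfg_permit g i))" for w
    using i that words_pack[of g 1 w i] g by (simp add: cfg_permit_def)
  show "w < 2 ^ B" if "w \<in> set (sent (cfg_permit g i) j)" for w j
    using i that word_bounds(4) by (auto simp: cfg_permit_def split: if_splits)
qed

lemma limits_post:
  assumes g: "good g"
  shows "within_limits S B M (cfg_post g)"
  unfolding within_limits_def
proof (intro allI impI conjI ballI)
  fix i assume i: "i < M"
  have total: "fits g \<Longrightarrow> (\<Sum>k<M. length (posts post n g (inp k))) \<le> L * n"
    by (simp add: sum_length_posts fits_def)
  have "(\<Sum>k<M. length (sent (cfg_post g k) i)) \<le> L * n"
    using total by (cases "i = 0"; cases "fits g") (auto simp: cfg_post_def)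
  moreover have "length (stored (cfg_post g i)) \<le> 2 + K * n + lam * n"
      using i length_pack g by (simp add: cfg_post_def)
  ultimately show "length (stored (cfg_post g i)) + (\<Sum>k<M. length (sent (cfg_post g k) i)) \<le> S"
    using S_bound n1 by linarith
  have "(\<Sum>j<M. length (sent (cfg_post g i) j)) = length (if fits g then posts post n g (inp i) else [])"
    using i M_pos by (simp only: cfg_post_def conf_less sent.simps sum_length_if_first)
  also have "\<dots> \<le> L * n" using length_posts_le_sum[OF i, of g] by (simp add: fits_def)
  finally show "(\<Sum>j<M. length (sent (cfg_post g i) j)) \<le> S" using S_bound by linarith
  show "w < 2 ^ B" if "w \<in> set (stored (cfg_post g i))" for w
    using i that words_pack[of g "if fits g then 2 else 3" w i] g by (simp add: cfg_post_def)
  show "w < 2 ^ B" if "w \<in> set (sent (cfg_post g i) j)" for w j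
    using i that words_posts[OF g] by (auto simp: cfg_post_def split: if_splits)
qed

lemma limits_split:
  assumes g: "good g"
  shows "within_limits S B M (cfg_split g)"
  unfolding within_limits_def
proof (intro allI impI conjI ballI)
  fix i assume i: "i < M"
  have b: "(\<Sum>j<M. length (block q j g)) \<le> K * n" using sum_block_le[OF g] .
  have "(\<Sum>k<M. length (sent (cfg_split g k) i)) = (\<Sum>k<M. length (if k = 0 then block q i g else []))"
    by (intro sum.cong) (auto simp: cfg_split_def)
  also have "\<dots> = length (block q i g)" using M_pos by (rule sum_length_if_first)
  also have "\<dots> \<le> (\<Sum>j<M. length (block q j g))" using i by (intro member_le_sum) auto
  also have "\<dots> \<le> K * n" by (rule b)
  moreover have "length (stored (cfg_split g i)) \<le> 2 + K * n + lam * n"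
      using i length_pack by (simp add: cfg_split_def)
  ultimately show "length (stored (cfg_split g i)) + (\<Sum>k<M. length (sent (cfg_split g k) i)) \<le> S"
    using S_bound n1 by linarith
  have "(\<Sum>j<M. length (sent (cfg_split g i) j)) \<le> K * n" using i b by (cases "i = 0") (auto simp: cfg_split_def)
  then show "(\<Sum>j<M. length (sent (cfg_split g i) j)) \<le> S" using S_bound by linarith
  show "w < 2 ^ B" if "w \<in> set (stored (cfg_split g i))" for w
    using i that words_pack[of "{}" 4 w i] by (simp add: cfg_split_def)
  show "w < 2 ^ B" if "w \<in> set (sent (cfg_split g i) j)" for w j
    using i that words_block[OF g] by (auto simp: cfg_split_def split: if_splits)
qed

section \<open>Correctness of the simulation\<close>

lemma all_halted_cfg_report: "all_halted M (cfg_report g) = fin n g"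
  using M_pos by (auto simp: all_halted_def cfg_report_def)

lemma prob_halted_chain:
  "pr (mpc_run alg n M inp (Suc (5 * t))) {cfg. all_halted M cfg} = pr (chain t) {g. fin n g}"
  unfolding mpc_run_chain measure_map_pmf by (simp add: vimage_def all_halted_cfg_report)

lemma reachable_correct:
  assumes "c \<in> reachable"
  shows "within_limits S B M c \<and> (all_halted M c \<longrightarrow> ruling_set 2 {..<n} E (mpc_output M c))"
proof -
  obtain g where g: "good g" and c: "c = cfg_blocks g \<or> c = cfg_report g \<or> c = cfg_split g \<or> c = cfg_permit g \<or> c = cfg_post g"
    using assms by (auto simp: reachable_def)
  have lim: "within_limits S B M c" using c limits_blocks[OF g] limits_report[OF g] limits_permit[OF g] limits_post[OF g] limits_split[OF g] by auto
  have "ruling_set 2 {..<n} E (mpc_output M c)" if h: "all_halted M c"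
  proof -
    have "halted (c 0)" using h M_pos by (simp add: all_halted_def)
    then have "c = cfg_report g" using c M_pos by (auto simp: cfg_blocks_def cfg_permit_def cfg_post_def cfg_split_def)
    then have f: "fin n g" using h all_halted_cfg_report by simp
    have R: "ruling_set 2 {..<n} E (res n g)" using res[OF g f] .
    then have "finite (res n g)" by (intro finite_subset[of "res n g" "{..<n}"]) (auto simp: ruling_set_def)
    then have "mpc_output M c = res n g" using M_pos f by (auto simp: mpc_output_def \<open>c = cfg_report g\<close> cfg_report_def)
    then show ?thesis using R by simp
  qed
  then show ?thesis using lim by simp
qed

theorem hub_finds_ruling_set:
  assumes lim: "(\<lambda>t. pr (chain t) {g. fin n g}) \<longlonglongrightarrow> 1"
  shows "finds_ruling_set 2 alg S B n E M place"
  unfolding finds_ruling_set_def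
proof (intro conjI allI ballI)
  fix t c assume c: "c \<in> set_pmf (mpc_run alg n M inp t)"
  have "within_limits S B M c \<and> (all_halted M c \<longrightarrow> ruling_set 2 {..<n} E (mpc_output M c))"
  proof (cases t)
    case 0
    then have c0: "c = (\<lambda>i. Continue (inp i) (\<lambda>_. []))" using c by simp
    have "within_limits S B M c"
      using length_inp S_bound by (force simp: within_limits_def c0 intro: words_inp order_trans)
    moreover have "\<not> all_halted M c" using M_pos by (auto simp: all_halted_def c0)
    ultimately show ?thesis by simp
  next
    case (Suc s)
    then show ?thesis using reachable_correct reachable_run c by blast
  qed
  then show "within_limits S B M c" "all_halted M c \<longrightarrow> ruling_set 2 {..<n} E (mpc_output M c)" by auto
next
  let ?p = "\<lambda>t. pr (mpc_run alg n M inp t) {cfg. all_halted M cfg}"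
  \<comment> \<open>The chain describes only every fifth round; monotonicity of the halting
    probability extends the limit to all rounds.\<close>
  have "(\<lambda>t. ?p (Suc (5 * t))) \<longlonglongrightarrow> 1" using lim by (simp only: prob_halted_chain)
  then show "?p \<longlonglongrightarrow> 1"
  proof (rule_tac LIMSEQ_I)
    fix r :: real assume "0 < r" "(\<lambda>t. ?p (Suc (5 * t))) \<longlonglongrightarrow> 1"
    then obtain t0 where t0: "\<And>t. t \<ge> t0 \<Longrightarrow> norm (?p (Suc (5 * t)) - 1) < r" using LIMSEQ_D by blast
    show "\<exists>no. \<forall>t\<ge>no. norm (?p t - 1) < r"
    proof (intro exI allI impI)
      fix t assume "Suc (5 * t0) \<le> t"
      then have "?p (Suc (5 * t0)) \<le> ?p t" by (rule prob_halted_mono)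
      moreover have "norm (?p (Suc (5 * t0)) - 1) < r" using t0 by simp
      moreover have "?p t \<le> 1" by simp
      ultimately show "norm (?p t - 1) < r" by simp
    qed
  qed
qed

end

section \<open>The ruling set protocol\<close>

text \<open>The floor of the 27th root of the degree, with \<open>max 1\<close> putting isolated
  vertices into class \<open>1\<close>.\<close>

definition degree_class :: "nat \<Rightarrow> nat" where
  "degree_class d = (GREATEST k. k ^ 27 \<le> max 1 d)"

lemma degree_class: "degree_class d ^ 27 \<le> max 1 d" "k ^ 27 \<le> max 1 d \<Longrightarrow> k \<le> degree_class d"
proof -
  have bound: "k \<le> max 1 d" if "k ^ 27 \<le> max 1 d" for k
    using that self_le_power[of k 27] by (cases "k = 0") auto
  show "degree_class d ^ 27 \<le> max 1 d"
    unfolding degree_class_def by (rule GreatestI_nat[of _ 1 "max 1 d"]) (use bound in auto)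
  show "k \<le> degree_class d" if "k ^ 27 \<le> max 1 d"
    unfolding degree_class_def by (rule Greatest_le_nat[of _ _ "max 1 d"]) (use bound that in auto)
qed

lemma degree_class_pos: "degree_class d \<ge> 1"
  using degree_class(2)[of 1 d] by simp

lemma le_cls: "d \<le> 2 ^ 27 * degree_class d ^ 27"
proof -
  have "\<not> Suc (degree_class d) ^ 27 \<le> max 1 d" using degree_class(2)[of "Suc (degree_class d)" d] by linarith
  then have "d \<le> Suc (degree_class d) ^ 27" by simp
  also have "\<dots> \<le> (2 * degree_class d) ^ 27" using degree_class_pos[of d] by (intro power_mono) auto
  finally show ?thesis by (simp only: power_mult_distrib)
qed

definition is_indep_ext :: "'a set \<Rightarrow> ('a \<Rightarrow> 'a set) \<Rightarrow> ('a \<Rightarrow> nat) \<Rightarrow> 'a set \<Rightarrow> bool" where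
  "is_indep_ext S N b I \<longleftrightarrow> I \<subseteq> S \<and> (\<forall>x\<in>I. N x \<inter> I = {}) \<and>
     (\<forall>x\<in>S. (\<forall>u\<in>N x \<inter> S. b u < b x) \<longrightarrow> x \<in> I) \<and> (\<forall>x\<in>S. x \<in> I \<or> N x \<inter> I \<noteq> {})"

definition indep_ext :: "'a set \<Rightarrow> ('a \<Rightarrow> 'a set) \<Rightarrow> ('a \<Rightarrow> nat) \<Rightarrow> 'a set" where
  "indep_ext S N b = (SOME I. is_indep_ext S N b I)"

text \<open>Of two adjacent vertices at most one can have the strictly larger \<open>b\<close>, so
  the forced vertices are independent. An inclusion-maximal independent superset within
  \<open>S\<close> then dominates \<open>S\<close>.\<close>

lemma is_indep_ext:
  assumes "finite S" "\<And>u v. u \<in> N v \<Longrightarrow> v \<in> N u" "\<And>v. v \<notin> N v"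
  shows "is_indep_ext S N b (indep_ext S N b)"
  unfolding indep_ext_def
proof (rule someI_ex)
  define S0 where "S0 = {x\<in>S. \<forall>u\<in>N x \<inter> S. b u < b x}"
  define F where "F = {J. S0 \<subseteq> J \<and> J \<subseteq> S \<and> (\<forall>x\<in>J. N x \<inter> J = {})}"
  have "finite F" by (rule finite_subset[of _ "Pow S"]) (use assms(1) in \<open>auto simp: F_def\<close>)
  moreover have "S0 \<in> F"
  proof -
    have "N x \<inter> S0 = {}" if x: "x \<in> S0" for x
    proof (rule ccontr)
      assume "N x \<inter> S0 \<noteq> {}"
      then obtain u where u: "u \<in> N x" "u \<in> S0" by auto
      have "b u < b x" "b x < b u" using x u assms(2)[OF u(1)] by (auto simp: S0_def)
      then show False by simp
    qed
    then show ?thesis by (auto simp: F_def S0_def)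
  qed
  ultimately obtain I where I: "I \<in> F" "\<And>J. J \<in> F \<Longrightarrow> I \<subseteq> J \<Longrightarrow> J = I"
    using finite_has_maximal2[of F S0] by metis
  have "x \<in> I \<or> N x \<inter> I \<noteq> {}" if x: "x \<in> S" for x
  proof (rule ccontr)
    assume *: "\<not> (x \<in> I \<or> N x \<inter> I \<noteq> {})"
    then have "insert x I \<in> F" using I(1) x assms(2,3) by (auto simp: F_def)
    then show False using I(2)[of "insert x I"] * by auto
  qed
  then show "\<exists>I. is_indep_ext S N b I"
    using I(1) by (intro exI[of _ I]) (auto simp: is_indep_ext_def F_def S0_def)
qed

text \<open>The hub knows only adjacency inside the sample and the degrees of sampled vertices. As
  both descriptions give the same predicate, \<open>SOME\<close> selects the same set from
  them.\<close>

lemma indep_ext_cong: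
  assumes "\<And>v. v \<in> S \<Longrightarrow> N v \<inter> S = N' v \<inter> S" "\<And>v. v \<in> S \<Longrightarrow> b v = b' v"
  shows "indep_ext S N b = indep_ext S N' b'"
proof -
  have "is_indep_ext S N b I = is_indep_ext S N' b' I" for I
  proof (cases "I \<subseteq> S")
    case True
    have NI: "N v \<inter> I = N' v \<inter> I" if "v \<in> S" for v using assms(1)[OF that] True by blast
    have "(\<forall>x\<in>I. N x \<inter> I = {}) = (\<forall>x\<in>I. N' x \<inter> I = {})" using NI True by (intro ball_cong) auto
    moreover have "(\<forall>x\<in>S. (\<forall>u\<in>N x \<inter> S. b u < b x) \<longrightarrow> x \<in> I) = (\<forall>x\<in>S. (\<forall>u\<in>N' x \<inter> S. b' u < b' x) \<longrightarrow> x \<in> I)"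
      using assms by (intro ball_cong refl imp_cong) auto
    moreover have "(\<forall>x\<in>S. x \<in> I \<or> N x \<inter> I \<noteq> {}) = (\<forall>x\<in>S. x \<in> I \<or> N' x \<inter> I \<noteq> {})"
      using NI by (intro ball_cong) auto
    ultimately show ?thesis by (simp add: is_indep_ext_def)
  qed (simp add: is_indep_ext_def)
  then have "is_indep_ext S N b = is_indep_ext S N' b'" by (rule ext)
  then show ?thesis by (simp add: indep_ext_def)
qed

text \<open>A state consists of the independent set built so far, an auxiliary vertex set and a counter
  of the supersteps of the current attempt; the empty state also encodes counter \<open>0\<close>.\<close>

definition enc :: "nat \<Rightarrow> nat set \<Rightarrow> nat set \<Rightarrow> nat \<Rightarrow> nat set" where
  "enc n I A c = I \<union> (\<lambda>v. n + v) ` A \<union> {2 * n + c}"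

definition dec_set :: "nat \<Rightarrow> nat set \<Rightarrow> nat set" where
  "dec_set n g = {v. v < n \<and> v \<in> g}"

definition dec_aux :: "nat \<Rightarrow> nat set \<Rightarrow> nat set" where
  "dec_aux n g = {v. v < n \<and> n + v \<in> g}"

text \<open>Truncated subtraction sends all other words to \<open>0\<close>, so the supremum is the
  counter. The supremum of the empty set of naturals is \<open>0\<close>, the counter of the empty
  state.\<close>

definition dec_count :: "nat \<Rightarrow> nat set \<Rightarrow> nat" where
  "dec_count n g = Sup ((\<lambda>x. x - 2 * n) ` g)"

lemma dec_empty [simp]: "dec_set n {} = {}" "dec_aux n {} = {}" "dec_count n {} = 0"
  by (auto simp: dec_set_def dec_aux_def dec_count_def)

lemma dec_enc:
  assumes "I \<subseteq> {..<n}" "A \<subseteq> {..<n}"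
  shows "dec_set n (enc n I A c) = I" "dec_aux n (enc n I A c) = A" "dec_count n (enc n I A c) = c"
proof -
  show "dec_set n (enc n I A c) = I" "dec_aux n (enc n I A c) = A"
    using assms by (auto simp: dec_set_def dec_aux_def enc_def)
  have fin: "finite (enc n I A c)"
    using finite_subset[OF assms(1)] finite_subset[OF assms(2)] by (simp add: enc_def)
  have "x - 2 * n \<le> c" if "x \<in> enc n I A c" for x using that assms by (auto simp: enc_def)
  moreover have "c \<in> (\<lambda>x. x - 2 * n) ` enc n I A c"
    by (rule image_eqI[of _ _ "2 * n + c"]) (auto simp: enc_def)
  ultimately have "Max ((\<lambda>x. x - 2 * n) ` enc n I A c) = c"
    using fin by (intro Max_eqI) auto
  then show "dec_count n (enc n I A c) = c" by (auto simp: dec_count_def Sup_nat_def enc_def)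
qed

text \<open>Adjacency and degree information is sent in words \<open>r * n + x\<close> with \<open>x < n\<close>: row \<open>v\<close>
  contains neighbours of \<open>v\<close>, row \<open>n + v\<close> its degree.\<close>

definition row :: "nat \<Rightarrow> nat set \<Rightarrow> nat \<Rightarrow> nat set" where
  "row n W r = {x. x < n \<and> r * n + x \<in> W}"

lemma code_inj: "x < (n::nat) \<Longrightarrow> y < n \<Longrightarrow> r * n + x = s * n + y \<longleftrightarrow> r = s \<and> x = y"
proof
  assume *: "x < n" "y < n" "r * n + x = s * n + y"
  have "(r * n + x) div n = r" "(s * n + y) div n = s" using *(1,2) by simp_all
  then have "r = s" using *(3) by simp
  then show "r = s \<and> x = y" using *(3) by simp
qed simp

definition row_deg :: "nat \<Rightarrow> nat set \<Rightarrow> nat \<Rightarrow> nat" where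
  "row_deg n W v = the_elem (row n W (n + v))"

text \<open>The threshold comes from \<open>584 = 2 * 4 * 73\<close>: below it, \<open>K^4\<close>
  is at most a constant times the square root of \<open>n\<close>. Nine stages treat the upper
  range, nine more the lower one.\<close>

definition active :: "nat \<Rightarrow> nat \<Rightarrow> nat \<Rightarrow> bool" where
  "active n j d \<longleftrightarrow> (if j < 9 then n \<le> degree_class d ^ 584 else degree_class d ^ 584 < n)"

text \<open>Superstep \<open>c\<close> belongs to stage \<open>c div 3\<close>. Depending on \<open>c mod 3\<close>, the vertices report whether they
  are in the closed neighbourhood of the independent set (so that the uncovered ones can be recognised
  next); or, if uncovered, their degrees, upon which the hub samples; or, if sampled, the sampled
  subgraph. Superstep \<open>55\<close> only tests whether all vertices are covered.\<close>

definition hub_post :: post_rule where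
  "hub_post n g v Nv =
    (if dec_count n g mod 3 = 0 then (if v \<in> dec_set n g \<or> Nv \<inter> dec_set n g \<noteq> {} then [v] else [])
     else if dec_count n g mod 3 = 1 then (if v \<in> dec_aux n g \<or> Nv \<inter> dec_aux n g \<noteq> {} then [] else [(n + v) * n + card Nv])
     else if v \<in> dec_aux n g then ((n + v) * n + card Nv) # map (\<lambda>u. v * n + u) (sorted_list_of_set (Nv \<inter> dec_aux n g))
     else [])"

text \<open>Each vertex posts at most one word except when sampled subgraphs are sent, so
  \<open>the\<close> is applied only where posting is never refused. A failed final test returns the
  empty state, which restarts everything with fresh coins.\<close>

definition hub_upd :: update_rule where
  "hub_upd n g W =
    (if dec_count n g = 55 then
       return_pmf (if \<forall>v<n. row n (the W) (n + v) = {} then enc n (dec_set n g) {} 56 else {})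
     else if dec_count n g mod 3 = 0 then return_pmf (enc n (dec_set n g) (the W) (Suc (dec_count n g)))
     else if dec_count n g mod 3 = 1 then
       map_pmf (\<lambda>S. enc n (dec_set n g) S (Suc (dec_count n g)))
         (random_subset {v. v < n \<and> row n (the W) (n + v) \<noteq> {} \<and> active n (dec_count n g div 3) (row_deg n (the W) v)}
           (\<lambda>v. 1 / real (degree_class (row_deg n (the W) v)) ^ stage_exp ((dec_count n g div 3) mod 9)))
     else return_pmf (enc n
       (case W of None \<Rightarrow> dec_set n g
        | Some W \<Rightarrow> dec_set n g \<union> indep_ext (dec_aux n g) (row n W) (\<lambda>v. degree_class (row_deg n W v)))
       {} (Suc (dec_count n g))))"

text \<open>Eighteen stages of three supersteps lead to counter \<open>54\<close>; two more
  supersteps compute the dominated set and test coverage.\<close>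

definition hub_fin :: "nat \<Rightarrow> nat set \<Rightarrow> bool" where
  "hub_fin n g \<longleftrightarrow> dec_count n g = 56"

locale ruling_protocol =
  fixes n L :: nat and E :: "nat set set"
  assumes n1: "n \<ge> 1" and L1: "L \<ge> 1" and graph: "simple_graph {..<n} E"
begin

abbreviation N :: "nat \<Rightarrow> nat set" where "N \<equiv> nbrs E"
abbreviation b :: "nat \<Rightarrow> nat" where "b v \<equiv> degree_class (card (N v))"

lemma N_sub: "N v \<subseteq> {..<n}"
  using graph by (auto simp: simple_graph_def nbrs_def)

lemma N_sym: "u \<in> N v \<Longrightarrow> v \<in> N u"
  by (simp add: nbrs_def insert_commute)

lemma N_irrefl: "v \<notin> N v"
  using graph by (force simp: simple_graph_def nbrs_def)

lemma finN: "finite (N v)"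
  by (rule finite_subset[OF N_sub]) simp

text \<open>Makes a degree a valid digit in base \<open>n\<close>, so that it can be sent in a
  row.\<close>

lemma deg_less: "card (N v) < n"
proof -
  have "N v \<subseteq> {..<n} - {if v < n then v else 0}"
  proof
    fix u assume u: "u \<in> N v"
    then have "v < n" using N_sub[of u] N_sym by blast
    then show "u \<in> {..<n} - {if v < n then v else 0}" using u N_sub[of v] N_irrefl[of v] by auto
  qed
  then have "card (N v) \<le> card ({..<n} - {if v < n then v else 0})" by (intro card_mono) auto
  also have "\<dots> < n" using n1 by simp
  finally show ?thesis .
qed

definition dominated :: "nat set \<Rightarrow> nat set" where
  "dominated X = {v. v < n \<and> (v \<in> X \<or> N v \<inter> X \<noteq> {})}"

text \<open>Exactly the vertices at distance more than \<open>2\<close> from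
  \<open>I\<close>.\<close>

definition uncovered :: "nat set \<Rightarrow> nat set" where
  "uncovered I = {v. v < n \<and> v \<notin> dominated I \<and> N v \<inter> dominated I = {}}"

definition indep :: "nat set \<Rightarrow> bool" where
  "indep I \<longleftrightarrow> I \<subseteq> {..<n} \<and> (\<forall>v\<in>I. N v \<inter> I = {})"

definition pick :: "nat set \<Rightarrow> nat set" where
  "pick S = indep_ext S N b"

definition next_set :: "nat set \<Rightarrow> nat set \<Rightarrow> nat set" where
  "next_set I S = (if card S + degree_sum N S \<le> L * n then I \<union> pick S else I)"

definition sample :: "nat \<Rightarrow> nat set \<Rightarrow> nat set pmf" where
  "sample j I = random_subset {v\<in>uncovered I. active n j (card (N v))} (\<lambda>v. 1 / real (b v) ^ stage_exp (j mod 9))"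

text \<open>The clause for counter \<open>56\<close> makes correctness of the output an invariant;
  probability matters only for the running time.\<close>

definition good :: "nat set \<Rightarrow> bool" where
  "good g \<longleftrightarrow> g = {} \<or> (\<exists>I A c. g = enc n I A c \<and> indep I \<and> A \<subseteq> {..<n} \<and> c \<le> 56 \<and>
     (c mod 3 = 1 \<longrightarrow> A = dominated I) \<and> (c mod 3 = 2 \<longrightarrow> A \<subseteq> uncovered I) \<and> (c = 56 \<longrightarrow> uncovered I = {}))"

definition total :: "nat set \<Rightarrow> nat" where
  "total g = (\<Sum>v<n. length (hub_post n g v (N v)))"

definition resp :: "nat set \<Rightarrow> nat set" where
  "resp g = (\<Union>v<n. set (hub_post n g v (N v)))"

definition step :: "nat set \<Rightarrow> nat set pmf" where
  "step g = hub_upd n g (if total g \<le> L * n then Some (resp g) else None)"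

section \<open>Coverage and the growing independent set\<close>

lemma indep_sub: "indep I \<Longrightarrow> I \<subseteq> {..<n}" by (simp add: indep_def)

lemma dominated_sub: "dominated X \<subseteq> {..<n}" by (auto simp: dominated_def)

lemma uncovered_sub: "uncovered X \<subseteq> {..<n}" by (auto simp: uncovered_def)

lemma dominated_mono: "X \<subseteq> Y \<Longrightarrow> dominated X \<subseteq> dominated Y" by (auto simp: dominated_def)

lemma uncovered_antimono: "X \<subseteq> Y \<Longrightarrow> uncovered Y \<subseteq> uncovered X" using dominated_mono[of X Y] by (auto simp: uncovered_def)

lemma pick:
  assumes "S \<subseteq> {..<n}"
  shows "pick S \<subseteq> S" "\<And>x. x \<in> pick S \<Longrightarrow> N x \<inter> pick S = {}"
    "\<And>x. x \<in> S \<Longrightarrow> (\<And>u. u \<in> N x \<inter> S \<Longrightarrow> b u < b x) \<Longrightarrow> x \<in> pick S"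
    "\<And>x. x \<in> S \<Longrightarrow> x \<in> pick S \<or> N x \<inter> pick S \<noteq> {}"
proof -
  have "finite S" by (rule finite_subset[OF assms]) simp
  then have "is_indep_ext S N b (pick S)" unfolding pick_def by (rule is_indep_ext) (use N_sym N_irrefl in auto)
  then show "pick S \<subseteq> S" "\<And>x. x \<in> pick S \<Longrightarrow> N x \<inter> pick S = {}"
    "\<And>x. x \<in> S \<Longrightarrow> (\<And>u. u \<in> N x \<inter> S \<Longrightarrow> b u < b x) \<Longrightarrow> x \<in> pick S"
    "\<And>x. x \<in> S \<Longrightarrow> x \<in> pick S \<or> N x \<inter> pick S \<noteq> {}"
    unfolding is_indep_ext_def by blast+
qed

text \<open>The sampled vertices are at distance more than \<open>2\<close> from \<open>I\<close>,
  so no edge joins the new part to the old one.\<close>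

lemma indep_next_set:
  assumes "indep I" "S \<subseteq> uncovered I"
  shows "indep (next_set I S)"
proof (cases "card S + degree_sum N S \<le> L * n")
  case True
  have SV: "S \<subseteq> {..<n}" using assms(2) uncovered_sub by blast
  have far: "N v \<inter> I = {}" "\<And>u. u \<in> I \<Longrightarrow> v \<notin> N u" if "v \<in> pick S" for v
  proof -
    have "v \<in> uncovered I" using that pick(1)[OF SV] assms(2) by auto
    then show "N v \<inter> I = {}" by (auto simp: uncovered_def dominated_def)
    then show "\<And>u. u \<in> I \<Longrightarrow> v \<notin> N u" using N_sym by blast
  qed
  have "N v \<inter> (I \<union> pick S) = {}" if "v \<in> I \<union> pick S" for v
  proof (cases "v \<in> pick S")
    case True
    then show ?thesis using far(1)[OF True] pick(2)[OF SV True] by auto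
  next
    case False
    then have "v \<in> I" using that by simp
    then show ?thesis using far(2) assms(1) by (auto simp: indep_def)
  qed
  moreover have "I \<union> pick S \<subseteq> {..<n}" using indep_sub[OF assms(1)] pick(1)[OF SV] SV by blast
  ultimately show ?thesis using True by (simp add: next_set_def indep_def)
qed (use assms in \<open>simp add: next_set_def\<close>)

lemma next_set_sub: "I \<subseteq> next_set I S"
  by (auto simp: next_set_def)

text \<open>These are the clauses of \<open>alive\<close>. Every sampled vertex is dominated by
  \<open>pick S\<close>, which covers its neighbours; and if \<open>x\<close> has only sampled
  neighbours of smaller \<open>b\<close>, it is picked itself, so that every neighbour of
  \<open>w\<close> is covered.\<close>

lemma uncovered_next_set:
  assumes "card S + degree_sum N S \<le> L * n" "S \<subseteq> uncovered I" "v \<in> uncovered (next_set I S)"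
  shows "v \<in> uncovered I" "v \<notin> S" "N v \<inter> S = {}"
    "\<And>w x. w \<in> N v \<Longrightarrow> x \<in> N w \<inter> S \<Longrightarrow> \<exists>u\<in>N x \<inter> S. b x \<le> b u"
proof -
  have SV: "S \<subseteq> {..<n}" using assms(2) uncovered_sub by blast
  have pc: "pick S \<subseteq> dominated (next_set I S)"
    using pick(1)[OF SV] SV assms(1) by (auto simp: dominated_def next_set_def)
  have Sc: "S \<subseteq> dominated (next_set I S)" if True
    using pick(4)[OF SV] SV assms(1) by (fastforce simp: dominated_def next_set_def)
  show "v \<in> uncovered I" using assms(3) uncovered_antimono[OF next_set_sub] by blast
  show "v \<notin> S" "N v \<inter> S = {}" using Sc assms(3) by (auto simp: uncovered_def)
  fix w x assume w: "w \<in> N v" "x \<in> N w \<inter> S"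
  show "\<exists>u\<in>N x \<inter> S. b x \<le> b u"
  proof (rule ccontr)
    assume "\<not> ?thesis"
    then have "x \<in> pick S" using w by (intro pick(3)[OF SV]) (auto simp: not_le)
    then have "w \<in> dominated (next_set I S)" using w(2) N_sub[of v] w(1) assms(1) by (auto simp: dominated_def next_set_def)
    then show False using assms(3) w(1) by (auto simp: uncovered_def)
  qed
qed

section \<open>The supersteps of the protocol\<close>

lemma row_codes:
  assumes "\<And>r. F r \<subseteq> {..<n}"
  shows "row n {r * n + x |r x. x \<in> F r} r = F r"
proof -
  have "x \<in> F r" if "x < n" "r * n + x = r' * n + x'" "x' \<in> F r'" for x r' x'
    using code_inj[of x n x' r r'] that assms[of r'] by auto
  then show ?thesis using assms[THEN subsetD] by (auto simp: row_def)
qed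

lemma step_0:
  assumes "indep I" "A \<subseteq> {..<n}" "g = enc n I A c \<or> (g = {} \<and> I = {} \<and> c = 0)" "c mod 3 = 0"
  shows "step g = return_pmf (enc n I (dominated I) (Suc c))"
proof -
  have d: "dec_set n g = I" "dec_count n g = c" using dec_enc[OF indep_sub[OF assms(1)] assms(2)] assms(3) by auto
  have p: "hub_post n g v (N v) = (if v \<in> I \<or> N v \<inter> I \<noteq> {} then [v] else [])" for v
    using assms(4) by (simp add: hub_post_def d)
  have "total g \<le> (\<Sum>v<n. 1)" unfolding total_def p by (intro sum_mono) auto
  then have "total g \<le> L * n" using L1 order_trans[of "total g" n "L * n"] by simp
  moreover have "resp g = dominated I" by (auto simp: resp_def p dominated_def split: if_splits)
  moreover have "c \<noteq> 55" using assms(4) by auto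
  ultimately show ?thesis using assms(4) by (simp add: step_def hub_upd_def d)
qed

lemma resp_1:
  assumes "indep I" "c mod 3 = 1"
  shows "total (enc n I (dominated I) c) \<le> L * n"
    and "\<And>v. row n (resp (enc n I (dominated I) c)) (n + v) = (if v \<in> uncovered I then {card (N v)} else {})"
proof -
  let ?g = "enc n I (dominated I) c"
  note d = dec_enc[OF indep_sub[OF assms(1)] dominated_sub, of I c]
  have p: "hub_post n ?g v (N v) = (if v \<in> dominated I \<or> N v \<inter> dominated I \<noteq> {} then [] else [(n + v) * n + card (N v)])" for v
    using assms(2) by (simp add: hub_post_def d)
  have "total ?g \<le> (\<Sum>v<n. 1)" unfolding total_def p by (intro sum_mono) auto
  then show "total ?g \<le> L * n" using L1 order_trans[of "total ?g" n "L * n"] by simp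
  define F where "F r = (if n \<le> r \<and> r - n \<in> uncovered I then {card (N (r - n))} else {})" for r
  have "resp ?g = {r * n + x |r x. x \<in> F r}"
  proof (intro equalityI subsetI)
    fix y assume "y \<in> resp ?g"
    then obtain v where "v \<in> uncovered I" "y = (n + v) * n + card (N v)"
      by (auto simp: resp_def p uncovered_def split: if_splits)
    then show "y \<in> {r * n + x |r x. x \<in> F r}"
      by (intro CollectI exI[of _ "n + v"] exI[of _ "card (N v)"]) (auto simp: F_def)
  next
    fix y assume "y \<in> {r * n + x |r x. x \<in> F r}"
    then obtain r where r: "n \<le> r" "r - n \<in> uncovered I" "y = r * n + card (N (r - n))"
      by (auto simp: F_def split: if_splits)
    then show "y \<in> resp ?g" unfolding resp_def p
      by (intro UN_I[of "r - n"]) (auto simp: uncovered_def)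
  qed
  moreover have "F r \<subseteq> {..<n}" for r using deg_less by (simp add: F_def)
  ultimately have "row n (resp ?g) r = F r" for r by (simp add: row_codes)
  then show "row n (resp ?g) (n + v) = (if v \<in> uncovered I then {card (N v)} else {})" for v
    by (simp add: F_def)
qed

lemma step_1:
  assumes "indep I" "c mod 3 = 1" "c \<noteq> 55"
  shows "step (enc n I (dominated I) c) = map_pmf (\<lambda>S. enc n I S (Suc c)) (sample (c div 3) I)"
proof -
  note d = dec_enc[OF indep_sub[OF assms(1)] dominated_sub, of I c]
  let ?W = "resp (enc n I (dominated I) c)"
  have deg: "row_deg n ?W v = card (N v)" if "v \<in> uncovered I" for v
    using that by (simp add: row_deg_def resp_1[OF assms(1,2)])
  have S: "{v. v < n \<and> row n ?W (n + v) \<noteq> {} \<and> active n (c div 3) (row_deg n ?W v)} =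
      {v\<in>uncovered I. active n (c div 3) (card (N v))}"
    using deg uncovered_sub[of I] by (auto simp: resp_1[OF assms(1,2)] split: if_splits)
  have "random_subset {v\<in>uncovered I. active n (c div 3) (card (N v))} (\<lambda>v. 1 / real (degree_class (row_deg n ?W v)) ^ stage_exp ((c div 3) mod 9))
     = sample (c div 3) I"
    unfolding sample_def random_subset_def using deg
    by (intro map_pmf_cong Pi_pmf_cong) auto
  then show ?thesis using assms(2,3) resp_1(1)[OF assms(1,2)] by (simp add: step_def hub_upd_def d S)
qed

lemma step_55:
  assumes "indep I"
  shows "step (enc n I (dominated I) 55) = return_pmf (if uncovered I = {} then enc n I {} 56 else {})"
proof -
  note d = dec_enc[OF indep_sub[OF assms(1)] dominated_sub, of I 55]
  have "(\<forall>v<n. row n (resp (enc n I (dominated I) 55)) (n + v) = {}) = (uncovered I = {})"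
    using uncovered_sub[of I] by (auto simp: resp_1[OF assms(1)])
  then show ?thesis using resp_1(1)[OF assms(1), of 55] by (simp add: step_def hub_upd_def d)
qed

lemma step_2:
  assumes "indep I" "S \<subseteq> uncovered I" "c mod 3 = 2" 
  shows "step (enc n I S c) = return_pmf (enc n (next_set I S) {} (Suc c))"
proof -
  let ?g = "enc n I S c"
  have SV: "S \<subseteq> {..<n}" using assms(2) uncovered_sub by blast
  note d = dec_enc[OF indep_sub[OF assms(1)] SV, of c]
  have p: "hub_post n ?g v (N v) = (if v \<in> S then ((n + v) * n + card (N v)) # map (\<lambda>u. v * n + u) (sorted_list_of_set (N v \<inter> S)) else [])" for v
    using assms(3) by (simp add: hub_post_def d)
  have "total ?g = (\<Sum>v\<in>S. 1 + card (N v \<inter> S))"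
    unfolding total_def p using SV by (intro sum.mono_neutral_cong_right) auto
  also have "\<dots> = card S + degree_sum N S" by (simp only: sum.distrib degree_sum_def sum_constant mult_1_right of_nat_id)
  finally have t: "total ?g = card S + degree_sum N S" .
  \<comment> \<open>Sampled vertices are below \<open>n\<close>, so the degree rows and the
    adjacency rows do not overlap.\<close>
  define F where "F r = (if n \<le> r \<and> r - n \<in> S then {card (N (r - n))} else if r \<in> S then N r \<inter> S else {})" for r
  have "resp ?g = {r * n + x |r x. x \<in> F r}"
  proof (intro equalityI subsetI)
    fix y assume "y \<in> resp ?g"
    then obtain v where v: "v \<in> S" "v < n" and "y = (n + v) * n + card (N v) \<or> (\<exists>u\<in>N v \<inter> S. y = v * n + u)"
      using finN by (auto simp: resp_def p split: if_splits)
    then consider "y = (n + v) * n + card (N v)" | u where "u \<in> N v \<inter> S" "y = v * n + u" by blast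
    then show "y \<in> {r * n + x |r x. x \<in> F r}"
    proof cases
      case 1 then show ?thesis using v
        by (intro CollectI exI[of _ "n + v"] exI[of _ "card (N v)"]) (auto simp: F_def)
    next
      case 2 then show ?thesis using v
        by (intro CollectI exI[of _ v] exI[of _ u]) (auto simp: F_def)
    qed
  next
    fix y assume "y \<in> {r * n + x |r x. x \<in> F r}"
    then obtain r x where y: "y = r * n + x" "x \<in> F r" by auto
    then consider "n \<le> r" "r - n \<in> S" "x = card (N (r - n))" | "r \<in> S" "x \<in> N r \<inter> S"
      by (auto simp: F_def split: if_splits)
    then show "y \<in> resp ?g"
    proof cases
      case 1 then show ?thesis unfolding resp_def p using SV y
        by (intro UN_I[of "r - n"]) auto
    next
      case 2 then show ?thesis unfolding resp_def p using SV y finN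
        by (intro UN_I[of r]) auto
    qed
  qed
  moreover have "F r \<subseteq> {..<n}" for r using deg_less SV by (auto simp: F_def)
  ultimately have r: "row n (resp ?g) r = F r" for r by (simp add: row_codes)
  have "indep_ext S (row n (resp ?g)) (\<lambda>v. degree_class (row_deg n (resp ?g) v)) = pick S"
    unfolding pick_def
    using SV by (intro indep_ext_cong) (auto simp: row_deg_def r F_def)
  moreover have "c \<noteq> 55" using assms(3) by auto
  ultimately show ?thesis using assms(3) by (simp add: step_def hub_upd_def d t next_set_def)
qed

section \<open>Invariance, size bounds and correctness of the result\<close>

definition kernel :: "nat set \<Rightarrow> nat set pmf" where
  "kernel g = (if hub_fin n g then return_pmf g else step g)"

lemma good_cases:
  assumes "good g"
  obtains I A c where "indep I" "A \<subseteq> {..<n}" "c \<le> 56" "g = enc n I A c \<or> (g = {} \<and> I = {} \<and> c = 0)"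
    "dec_set n g = I" "dec_count n g = c"
    "c mod 3 = 1 \<Longrightarrow> g = enc n I (dominated I) c" "c mod 3 = 2 \<Longrightarrow> A \<subseteq> uncovered I" "c = 56 \<Longrightarrow> uncovered I = {}"
proof (cases "g = {}")
  case True
  show ?thesis by (rule that[of "{}" "{}" 0]) (use True in \<open>auto simp: indep_def\<close>)
next
  case False
  then obtain I A c where *: "g = enc n I A c" "indep I" "A \<subseteq> {..<n}" "c \<le> 56"
     "c mod 3 = 1 \<longrightarrow> A = dominated I" "c mod 3 = 2 \<longrightarrow> A \<subseteq> uncovered I" "c = 56 \<longrightarrow> uncovered I = {}"
    using assms by (auto simp: good_def)
  show ?thesis
    by (rule that[of I A c]) (use * dec_enc[OF indep_sub[OF *(2)] *(3), of c] in auto)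
qed

lemma goodI: "indep I \<Longrightarrow> A \<subseteq> {..<n} \<Longrightarrow> c \<le> 56 \<Longrightarrow> (c mod 3 = 1 \<Longrightarrow> A = dominated I) \<Longrightarrow>
    (c mod 3 = 2 \<Longrightarrow> A \<subseteq> uncovered I) \<Longrightarrow> (c = 56 \<Longrightarrow> uncovered I = {}) \<Longrightarrow> good (enc n I A c)"
  unfolding good_def by blast

lemma good_empty: "good {}" by (simp add: good_def)

lemma set_sample: "S \<in> set_pmf (sample j I) \<Longrightarrow> S \<subseteq> {v\<in>uncovered I. active n j (card (N v))}"
  using set_random_subset by (fastforce simp: sample_def)

lemma good_step:
  assumes g: "good g" "\<not> hub_fin n g" and g': "g' \<in> set_pmf (step g)"
  shows "good g'" "dec_count n g < 55 \<Longrightarrow> dec_count n g' = Suc (dec_count n g)"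
    "dec_count n g = 55 \<Longrightarrow> g' = {} \<or> hub_fin n g'"
proof -
  obtain I A c where c: "indep I" "A \<subseteq> {..<n}" "c \<le> 56" "g = enc n I A c \<or> (g = {} \<and> I = {} \<and> c = 0)"
    "dec_set n g = I" "dec_count n g = c"
    "c mod 3 = 1 \<Longrightarrow> g = enc n I (dominated I) c" "c mod 3 = 2 \<Longrightarrow> A \<subseteq> uncovered I" "c = 56 \<Longrightarrow> uncovered I = {}"
    by (rule good_cases[OF g(1)]) blast
  have c56: "c < 56" using c(3,6) g(2) by (auto simp: hub_fin_def)
  note IV = indep_sub[OF c(1)]
  consider "c mod 3 = 0" | "c mod 3 = 1" "c \<noteq> 55" | "c = 55" | "c mod 3 = 2" by linarith
  then have "good g' \<and> (c < 55 \<longrightarrow> dec_count n g' = Suc c) \<and> (c = 55 \<longrightarrow> g' = {} \<or> hub_fin n g')"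
  proof cases
    case 1
    then have "g' = enc n I (dominated I) (Suc c)" using step_0[OF c(1,2,4)] g' by simp
    moreover have "Suc c mod 3 = 1" "c \<noteq> 55" using 1 by presburger+
    moreover have "Suc c \<noteq> 56" using \<open>c \<noteq> 55\<close> by simp
    ultimately show ?thesis using c(1) c56 dec_enc[OF IV dominated_sub, of I "Suc c"]
      by (auto intro!: goodI dominated_sub)
  next
    case 2
    then obtain S where S: "S \<in> set_pmf (sample (c div 3) I)" "g' = enc n I S (Suc c)"
      using step_1[OF c(1) 2] c(7) g' by auto
    have SU: "S \<subseteq> uncovered I" using set_sample[OF S(1)] by auto
    then have SV: "S \<subseteq> {..<n}" using uncovered_sub by blast
    have "Suc c mod 3 = 2" "Suc c \<noteq> 56" using 2 by presburger+
    then show ?thesis using S(2) SU SV c(1) c56 2 dec_enc[OF IV SV, of "Suc c"]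
      by (auto intro!: goodI)
  next
    case 3
    then have "g = enc n I (dominated I) 55" using c(7) by simp
    then have "g' = (if uncovered I = {} then enc n I {} 56 else {})" using step_55[OF c(1)] g' by simp
    then show ?thesis using 3 c(1) dec_enc[OF IV, of "{}" 56] good_empty
      by (auto intro!: goodI simp: hub_fin_def)
  next
    case 4
    then have gA: "g = enc n I A c" using c(4) by auto
    have "g' = enc n (next_set I A) {} (Suc c)" using step_2[OF c(1) c(8)[OF 4] 4] gA g' by simp
    moreover have "Suc c mod 3 = 0" "Suc c \<noteq> 56" "c \<noteq> 55" using 4 by presburger+
    moreover have "indep (next_set I A)" using indep_next_set[OF c(1) c(8)[OF 4]] .
    ultimately show ?thesis using c56 dec_enc[OF indep_sub, of "next_set I A" "{}" "Suc c"]
      by (auto intro!: goodI)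
  qed
  then show "good g'" "dec_count n g < 55 \<Longrightarrow> dec_count n g' = Suc (dec_count n g)"
    "dec_count n g = 55 \<Longrightarrow> g' = {} \<or> hub_fin n g'" using c(6) by auto
qed

text \<open>The largest possible word is \<open>2 * n + 56\<close>, and it is below
  \<open>60 * n\<close> because \<open>n >= 1\<close>; this is the source of the constant
  \<open>60\<close>.\<close>

lemma good_bound: "good g \<Longrightarrow> g \<subseteq> {..<60 * n}"
proof -
  assume "good g"
  then show ?thesis
  proof (cases "g = {}")
    case False
    then obtain I A c where "g = enc n I A c" "indep I" "A \<subseteq> {..<n}" "c \<le> 56"
      using \<open>good g\<close> by (auto simp: good_def)
    then show ?thesis using indep_sub[of I] n1 by (auto simp: enc_def)
  qed simp
qed

lemma length_hub_post: "length (hub_post n g v (N v)) \<le> 60 * n"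
proof -
  have "card (N v \<inter> dec_aux n g) \<le> card (N v)" using finN by (intro card_mono) auto
  then show ?thesis using deg_less[of v] n1 by (auto simp: hub_post_def)
qed

lemma words_hub_post:
  assumes "v < n"
  shows "set (hub_post n g v (N v)) \<subseteq> {..<60 * n\<^sup>2}"
proof -
  have code: "r * n + x < 60 * n\<^sup>2" if "r < 2 * n" "x < n" for r x
  proof -
    have "r * n + x < Suc r * n" using that by simp
    also have "\<dots> \<le> (2 * n) * n" using that by (intro mult_right_mono) auto
    also have "\<dots> \<le> 60 * n\<^sup>2" by (simp add: power2_eq_square)
    finally show ?thesis .
  qed
  have "v < 60 * n\<^sup>2" using code[of 0 v] assms by simp
  moreover have "(n + v) * n + card (N v) < 60 * n\<^sup>2" using assms deg_less by (intro code) auto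
  moreover have "v * n + u < 60 * n\<^sup>2" if "u \<in> N v" for u using assms that N_sub[of v] by (intro code) auto
  ultimately show ?thesis using finN by (auto simp: hub_post_def)
qed

lemma ruling_of_uncovered_empty:
  assumes "indep I" "uncovered I = {}"
  shows "ruling_set 2 {..<n} E I"
  unfolding ruling_set_def
proof (intro conjI ballI)
  show "I \<subseteq> {..<n}" using assms(1) by (rule indep_sub)
  show "(u, v) \<notin> adj E" if "u \<in> I" "v \<in> I" for u v
    using assms(1) that by (auto simp: indep_def adj_def nbrs_def)
  fix v assume v: "v \<in> {..<n}"
  \<comment> \<open>Dominated vertices have distance at most \<open>1\<close>; any other vertex has
    a dominated neighbour, since none is uncovered.\<close>
  have near: "\<exists>u\<in>I. \<exists>k\<le>1. (u, w) \<in> adj E ^^ k" if w: "w \<in> dominated I" for w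
  proof -
    consider "w \<in> I" | u where "u \<in> I" "u \<in> N w" using w unfolding dominated_def by blast
    then show ?thesis
    proof cases
      case 1 then show ?thesis by (intro bexI[of _ w] exI[of _ 0]) auto
    next
      case 2 then show ?thesis using N_sym
        by (intro bexI[of _ u] exI[of _ 1]) (auto simp: adj_def nbrs_def)
    qed
  qed
  have "\<exists>u\<in>I. \<exists>k\<le>2. (u, v) \<in> adj E ^^ k"
  proof (cases "v \<in> dominated I")
    case True
    then show ?thesis using near by (meson order_trans one_le_numeral)
  next
    case False
    then obtain w where w: "w \<in> N v" "w \<in> dominated I" using v assms(2) by (auto simp: uncovered_def)
    then obtain u k where u: "u \<in> I" "k \<le> 1" "(u, w) \<in> adj E ^^ k" using near by blast
    have "(w, v) \<in> adj E" using N_sym[OF w(1)] by (simp add: adj_def nbrs_def)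
    then have "(u, v) \<in> adj E ^^ Suc k" using u(3) by auto
    then show ?thesis using u by (intro bexI[of _ u] exI[of _ "Suc k"]) auto
  qed
  then obtain u k where u: "u \<in> I" "k \<le> 2" "(u, v) \<in> adj E ^^ k" by blast
  have "graph_dist E u v \<le> enat k" unfolding graph_dist_def using u(3) by (intro Inf_lower) auto
  also have "\<dots> \<le> enat 2" using u(2) by simp
  finally show "\<exists>u\<in>I. graph_dist E u v \<le> enat 2" using u(1) by blast
qed

lemma good_res: "good g \<Longrightarrow> hub_fin n g \<Longrightarrow> ruling_set 2 {..<n} E (dec_set n g)"
  by (erule good_cases) (auto simp: hub_fin_def intro: ruling_of_uncovered_empty)

section \<open>Repeated trials\<close>

lemma attempt_counter:
  assumes "t \<le> 55" "g \<in> set_pmf (iterate_pmf kernel t {})"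
  shows "good g \<and> dec_count n g = t"
  using assms
proof (induction t arbitrary: g)
  case 0 then show ?case by (simp add: good_empty)
next
  case (Suc t)
  then obtain h where h: "h \<in> set_pmf (iterate_pmf kernel t {})" "g \<in> set_pmf (kernel h)" by auto
  then have *: "good h" "dec_count n h = t" using Suc by auto
  then have "\<not> hub_fin n h" using Suc.prems by (auto simp: hub_fin_def)
  then show ?case using good_step[OF *(1)] h(2) * Suc.prems by (auto simp: kernel_def)
qed

lemma attempt_end:
  assumes "g \<in> set_pmf (iterate_pmf kernel 56 {})"
  shows "g = {} \<or> hub_fin n g"
proof -
  have "56 = Suc 55" by simp
  then obtain h where h: "h \<in> set_pmf (iterate_pmf kernel 55 {})" "g \<in> set_pmf (kernel h)"
    using assms by (metis (no_types, lifting) iterate_pmf.simps(2) set_bind_pmf UN_E)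
  then have *: "good h" "dec_count n h = 55" using attempt_counter by auto
  then have "\<not> hub_fin n h" by (auto simp: hub_fin_def)
  then show ?thesis using good_step(3)[OF *(1)] h(2) * by (auto simp: kernel_def)
qed

abbreviation unfinished :: "nat set set" where
  "unfinished \<equiv> - {g. hub_fin n g}"

lemma iterate_fin: "hub_fin n g \<Longrightarrow> iterate_pmf kernel t g = return_pmf g"
  by (induction t) (auto simp: bind_return_pmf kernel_def)

text \<open>After \<open>56\<close> supersteps an unsuccessful trial is back in the empty state
  exactly. The next trial is therefore an independent copy, and the failure probabilities
  multiply.\<close>

lemma attempts:
  "pr (iterate_pmf kernel (56 * a) {}) unfinished = pr (iterate_pmf kernel 56 {}) unfinished ^ a
   \<and> set_pmf (iterate_pmf kernel (56 * a) {}) \<subseteq> {{}} \<union> {g. hub_fin n g}"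
proof (induction a)
  case 0
  show ?case by (simp add: measure_return_pmf hub_fin_def)
next
  case (Suc a)
  let ?q = "pr (iterate_pmf kernel 56 {}) unfinished"
  have e: "iterate_pmf kernel (56 * Suc a) {} = bind_pmf (iterate_pmf kernel (56 * a) {}) (iterate_pmf kernel 56)"
    using iterate_pmf_add[of kernel "56 * a" 56] by (simp add: add.commute)
  have "pr (iterate_pmf kernel (56 * Suc a) {}) unfinished =
     expect (iterate_pmf kernel (56 * a) {}) (\<lambda>g. pr (iterate_pmf kernel 56 g) unfinished)"
    unfolding e by (rule pr_bind)
  also have "\<dots> = expect (iterate_pmf kernel (56 * a) {}) (\<lambda>g. indicator unfinished g * ?q)"
  proof (intro integral_cong_AE)
    show "AE g in measure_pmf (iterate_pmf kernel (56 * a) {}).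
      pr (iterate_pmf kernel 56 g) unfinished = indicator unfinished g * ?q"
      unfolding AE_measure_pmf_iff
    proof
      fix g assume "g \<in> set_pmf (iterate_pmf kernel (56 * a) {})"
      then have "hub_fin n g \<or> (g = {} \<and> \<not> hub_fin n g)" using Suc by (auto simp: hub_fin_def)
      then show "pr (iterate_pmf kernel 56 g) unfinished = indicator unfinished g * ?q"
      proof
        assume "hub_fin n g"
        then show ?thesis by (simp add: iterate_fin measure_return_pmf)
      qed (auto simp: indicator_def)
    qed
  qed auto
  also have "\<dots> = ?q ^ Suc a" using Suc by simp
  finally have 1: "pr (iterate_pmf kernel (56 * Suc a) {}) unfinished = ?q ^ Suc a" .
  have "set_pmf (iterate_pmf kernel (56 * Suc a) {}) \<subseteq> {{}} \<union> {g. hub_fin n g}"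
  proof
    fix g assume "g \<in> set_pmf (iterate_pmf kernel (56 * Suc a) {})"
    then obtain h where h: "h \<in> set_pmf (iterate_pmf kernel (56 * a) {})" "g \<in> set_pmf (iterate_pmf kernel 56 h)"
      unfolding e by auto
    then consider "h = {}" | "hub_fin n h" using Suc by auto
    then show "g \<in> {{}} \<union> {g. hub_fin n g}"
      using attempt_end h(2) by cases (auto simp: iterate_fin)
  qed
  then show ?case using 1 by simp
qed

definition at_stage :: "(nat \<Rightarrow> nat set \<Rightarrow> bool) \<Rightarrow> nat \<Rightarrow> nat set set" where
  "at_stage P j = {g. \<exists>I. indep I \<and> P j I \<and> (g = enc n I {} (3 * j) \<or> (g = {} \<and> I = {} \<and> j = 0))}"

lemma kernel_stage:
  assumes "indep I" "g = enc n I {} (3 * j) \<or> (g = {} \<and> I = {} \<and> j = 0)" "j < 18"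
  shows "iterate_pmf kernel 3 g = map_pmf (\<lambda>S. enc n (next_set I S) {} (3 * Suc j)) (sample j I)"
proof -
  note IV = indep_sub[OF assms(1)]
  have "\<not> hub_fin n g" using assms(2,3) dec_enc[OF IV, of "{}" "3 * j"] by (auto simp: hub_fin_def)
  then have k0: "kernel g = return_pmf (enc n I (dominated I) (Suc (3 * j)))"
    using step_0[OF assms(1), of "{}" g "3 * j"] assms(2) by (auto simp: kernel_def)
  have "\<not> hub_fin n (enc n I (dominated I) (Suc (3 * j)))"
    using assms(3) dec_enc[OF IV dominated_sub, of I "Suc (3 * j)"] by (auto simp: hub_fin_def)
  moreover have "Suc (3 * j) mod 3 = 1" "Suc (3 * j) div 3 = j" "Suc (3 * j) \<noteq> 55" using assms(3) by presburger+
  ultimately have k1: "kernel (enc n I (dominated I) (Suc (3 * j))) = map_pmf (\<lambda>S. enc n I S (Suc (Suc (3 * j)))) (sample j I)"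
    using step_1[OF assms(1), of "Suc (3 * j)"] by (simp add: kernel_def)
  have k2: "kernel (enc n I S (Suc (Suc (3 * j)))) = return_pmf (enc n (next_set I S) {} (3 * Suc j))"
    if "S \<in> set_pmf (sample j I)" for S
  proof -
    have SU: "S \<subseteq> uncovered I" using set_sample[OF that] by auto
    then have SV: "S \<subseteq> {..<n}" using uncovered_sub by blast
    have "\<not> hub_fin n (enc n I S (Suc (Suc (3 * j))))"
      using assms(3) dec_enc[OF IV SV, of "Suc (Suc (3 * j))"] by (auto simp: hub_fin_def)
    moreover have "Suc (Suc (3 * j)) mod 3 = 2" by presburger
    moreover have "3 * Suc j = Suc (Suc (Suc (3 * j)))" by simp
    ultimately show ?thesis
      using step_2[OF assms(1) SU, of "Suc (Suc (3 * j))"] by (simp only: kernel_def if_False)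
  qed
  have "iterate_pmf kernel 3 g = bind_pmf (kernel g) (\<lambda>g. bind_pmf (kernel g) kernel)"
    by (simp add: numeral_3_eq_3 bind_return_pmf bind_assoc_pmf)
  also have "\<dots> = bind_pmf (sample j I) (\<lambda>S. kernel (enc n I S (Suc (Suc (3 * j)))))"
    by (simp add: k0 k1 bind_return_pmf bind_map_pmf)
  also have "\<dots> = bind_pmf (sample j I) (\<lambda>S. return_pmf (enc n (next_set I S) {} (3 * Suc j)))"
    using k2 by (intro bind_pmf_cong) auto
  finally show ?thesis by (simp add: map_pmf_def)
qed

text \<open>A union bound over the stages for an abstract invariant \<open>P\<close>, so that it
  serves both the probabilistic analysis for large \<open>n\<close> and the deterministic one for
  small \<open>n\<close>.\<close>

lemma attempt_stages:
  assumes P0: "P 0 {}" and e: "e \<ge> 0"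
    and P: "\<And>j I. j < 18 \<Longrightarrow> indep I \<Longrightarrow> P j I \<Longrightarrow> pr (sample j I) {S. \<not> P (Suc j) (next_set I S)} \<le> e"
    and j: "j \<le> 18"
  shows "pr (iterate_pmf kernel (3 * j) {}) (- at_stage P j) \<le> j * e"
  using j
proof (induction j)
  case 0
  have "{} \<in> at_stage P 0" using P0 by (auto simp: at_stage_def indep_def)
  then show ?case by (simp add: measure_return_pmf)
next
  case (Suc j)
  have "iterate_pmf kernel (3 * Suc j) {} = bind_pmf (iterate_pmf kernel (3 * j) {}) (iterate_pmf kernel 3)"
    using iterate_pmf_add[of kernel "3 * j" 3] by (simp add: add.commute)
  moreover have "pr (bind_pmf (iterate_pmf kernel (3 * j) {}) (iterate_pmf kernel 3)) (- at_stage P (Suc j))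
      \<le> pr (iterate_pmf kernel (3 * j) {}) (- at_stage P j) + e"
  proof (rule pr_bind_le[OF _ e])
    fix g assume "g \<in> at_stage P j"
    then obtain I where I: "indep I" "P j I" "g = enc n I {} (3 * j) \<or> (g = {} \<and> I = {} \<and> j = 0)"
      by (auto simp: at_stage_def)
    have "pr (iterate_pmf kernel 3 g) (- at_stage P (Suc j)) =
      pr (sample j I) {S. enc n (next_set I S) {} (3 * Suc j) \<notin> at_stage P (Suc j)}"
      using Suc.prems by (simp add: kernel_stage[OF I(1,3)] vimage_def)
    also have "\<dots> \<le> pr (sample j I) {S. \<not> P (Suc j) (next_set I S)}"
    proof (intro measure_pmf.finite_measure_mono_AE, unfold AE_measure_pmf_iff, intro ballI impI)
      fix S assume S: "S \<in> set_pmf (sample j I)" "S \<in> {S. enc n (next_set I S) {} (3 * Suc j) \<notin> at_stage P (Suc j)}"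
      have "indep (next_set I S)" using set_sample[OF S(1)] by (intro indep_next_set I) auto
      then show "S \<in> {S. \<not> P (Suc j) (next_set I S)}" using S(2) by (auto simp: at_stage_def)
    qed simp
    also have "\<dots> \<le> e" using Suc.prems by (intro P I) auto
    finally show "pr (iterate_pmf kernel 3 g) (- at_stage P (Suc j)) \<le> e" .
  qed
  ultimately show ?case using Suc by (simp add: algebra_simps)
qed

text \<open>Given full coverage after \<open>54\<close> supersteps, the two remaining supersteps
  finish with certainty.\<close>

lemma attempt_fails_le:
  assumes P0: "P 0 {}" and e: "e \<ge> 0"
    and P: "\<And>j I. j < 18 \<Longrightarrow> indep I \<Longrightarrow> P j I \<Longrightarrow> pr (sample j I) {S. \<not> P (Suc j) (next_set I S)} \<le> e"
    and P18: "\<And>I. P 18 I \<Longrightarrow> uncovered I = {}"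
  shows "pr (iterate_pmf kernel 56 {}) unfinished \<le> 18 * e"
proof -
  have "pr (bind_pmf (iterate_pmf kernel 54 {}) (iterate_pmf kernel 2)) unfinished
      \<le> pr (iterate_pmf kernel 54 {}) (- at_stage P 18) + 0"
  proof (rule pr_bind_le)
    fix g assume "g \<in> at_stage P 18"
    then obtain I where I: "indep I" "P 18 I" "g = enc n I {} 54" by (auto simp: at_stage_def)
    note IV = indep_sub[OF I(1)]
    have "kernel g = return_pmf (enc n I (dominated I) 55)"
      using step_0[OF I(1), of "{}" g 54] I(3) dec_enc[OF IV, of "{}" 54] by (auto simp: kernel_def hub_fin_def)
    moreover have "kernel (enc n I (dominated I) 55) = return_pmf (enc n I {} 56)"
      using step_55[OF I(1)] P18[OF I(2)] dec_enc[OF IV dominated_sub, of I 55] by (auto simp: kernel_def hub_fin_def)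
    ultimately have "iterate_pmf kernel 2 g = return_pmf (enc n I {} 56)"
      by (simp add: numeral_2_eq_2 bind_return_pmf)
    moreover have "hub_fin n (enc n I {} 56)" using dec_enc[OF IV, of "{}" 56] by (simp add: hub_fin_def)
    ultimately show "pr (iterate_pmf kernel 2 g) unfinished \<le> 0" by (simp add: measure_return_pmf)
  qed simp
  moreover have "iterate_pmf kernel 56 {} = bind_pmf (iterate_pmf kernel 54 {}) (iterate_pmf kernel 2)"
    using iterate_pmf_add[of kernel 54 2] by simp
  moreover have "pr (iterate_pmf kernel 54 {}) (- at_stage P 18) \<le> 18 * e"
    using attempt_stages[of P e 18, OF P0 e P] by simp
  ultimately show ?thesis by simp
qed

end

section \<open>Success probability of an attempt\<close>

context ruling_protocol begin

section \<open>Bounds for one trial in the two ranges of classes\<close>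

definition active_set :: "nat \<Rightarrow> nat set \<Rightarrow> nat set" where
  "active_set j I = {v\<in>uncovered I. active n j (card (N v))}"

text \<open>Neither \<open>lo\<close>, \<open>hi\<close> nor \<open>eps\<close> occurs in
  \<open>stage_inv\<close>, so both ranges of classes share one predicate.\<close>

abbreviation inv :: "real \<Rightarrow> nat \<Rightarrow> nat set \<Rightarrow> bool" where
  "inv \<equiv> degree_scale.stage_inv {..<n} N b"

lemma active_set_cong: "j < 9 \<Longrightarrow> active_set j I = active_set 0 I" "9 \<le> j \<Longrightarrow> active_set j I = active_set 9 I"
  by (auto simp: active_set_def active_def)

lemma active_set_next_set: "active_set j (next_set I S) \<subseteq> active_set j I"
  using uncovered_antimono[OF next_set_sub] by (auto simp: active_set_def)

lemma uncovered_active_set: "active_set 0 I = {} \<Longrightarrow> active_set 9 I = {} \<Longrightarrow> uncovered I = {}"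
  by (auto simp: active_set_def active_def not_le)

lemma card_ecount_le:
  assumes "S \<subseteq> {..<n}"
  shows "card S \<le> n" "degree_sum N S \<le> n * n"
proof -
  show c: "card S \<le> n" using card_mono[OF _ assms] by simp
  have "degree_sum N S \<le> (\<Sum>v\<in>S. n)"
    unfolding degree_sum_def
  proof (intro sum_mono)
    fix v
    have "card (N v \<inter> S) \<le> card (N v)" using finN by (intro card_mono) auto
    then show "card (N v \<inter> S) \<le> n" using deg_less[of v] by linarith
  qed
  also have "\<dots> = card S * n" by simp
  also have "\<dots> \<le> n * n" using c by (rule mult_right_mono) simp
  finally show "degree_sum N S \<le> n * n" .
qed

lemma degree_scaleI:
  assumes "lo \<ge> 1" "hi \<ge> 1" "1 / lo \<le> eps \<or> (2 ^ 55 * hi ^ 73) ^ 4 / real n \<le> eps"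
  shows "degree_scale {..<n} N b lo hi eps"
proof
  show "b v ^ 27 \<le> card (N v)" if "N v \<noteq> {}" for v
  proof -
    have "max 1 (card (N v)) = card (N v)" using that finN by (simp add: Suc_le_eq card_gt_0_iff)
    then show ?thesis using degree_class(1)[of "card (N v)"] by simp
  qed
  show "{..<n} \<noteq> {}" using n1 by (auto simp: lessThan_empty_iff)
qed (use assms N_sub N_sym N_irrefl degree_class_pos le_cls in auto)

text \<open>Outside the bad event the sampled subgraph is small enough to be accepted by the hub.
  Then the true survivors are among the alive vertices, and the invariant passes to subsets.\<close>

lemma stage_success:
  assumes "degree_scale {..<n} N b lo hi eps" and sc: "degree_scale.scale {..<n} b lo hi (active_set j I)"
    and C: "C \<ge> 1" and i: "inv C (j mod 9) (active_set j I)" and L: "growth * C + 1 \<le> real L"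
  shows "pr (sample j I) {S. \<not> inv (growth * C) (Suc (j mod 9)) (active_set j (next_set I S))} \<le> 2 * eps"
proof -
  interpret degree_scale "{..<n}" N b lo hi eps by fact
  have s: "sample j I = random_subset (active_set j I) (sprob (stage_exp (j mod 9)))"
    by (simp add: sample_def active_set_def sprob_def[abs_def])
  have "pr (sample j I) {S. \<not> inv (growth * C) (Suc (j mod 9)) (active_set j (next_set I S))}
      \<le> pr (sample j I) (bad (growth * C) (Suc (j mod 9)) (active_set j I))"
  proof (intro measure_pmf.finite_measure_mono_AE, unfold AE_measure_pmf_iff, intro ballI impI)
    fix S assume S: "S \<in> set_pmf (sample j I)" "S \<in> {S. \<not> inv (growth * C) (Suc (j mod 9)) (active_set j (next_set I S))}"
    have SA: "S \<subseteq> active_set j I" using set_sample[OF S(1)] by (simp add: active_set_def)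
    have SU: "S \<subseteq> uncovered I" using SA by (auto simp: active_set_def)
    have SV: "S \<subseteq> {..<n}" using SU uncovered_sub by blast
    show "S \<in> bad (growth * C) (Suc (j mod 9)) (active_set j I)"
    proof (rule ccontr)
      assume "S \<notin> bad (growth * C) (Suc (j mod 9)) (active_set j I)"
      then have nb: "real (ecount S) \<le> growth * C * real n" "inv (growth * C) (Suc (j mod 9)) (alive (active_set j I) S)"
        using SA by (auto simp: bad_def)
      \<comment> \<open>Besides the edges, each sampled vertex sends one word for its degree, at
        most \<open>n\<close> words in all.\<close>
      have "real (card S + degree_sum N S) \<le> real n + growth * C * real n"
        using nb(1) card_ecount_le(1)[OF SV] by simp
      also have "\<dots> = (growth * C + 1) * real n" by (simp add: algebra_simps)
      also have "\<dots> \<le> real L * real n" using L by (intro mult_right_mono) auto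
      finally have fit: "card S + degree_sum N S \<le> L * n" by (simp only: of_nat_mult[symmetric] of_nat_le_iff)
      have "active_set j (next_set I S) \<subseteq> alive (active_set j I) S"
        using uncovered_next_set[OF fit SU] by (auto simp: alive_def active_set_def)
      then have "inv (growth * C) (Suc (j mod 9)) (active_set j (next_set I S))"
        by (rule stage_inv_antimono[OF nb(2)]) (use alive_subset[of "active_set j I" S] uncovered_sub in \<open>auto simp: active_set_def\<close>)
      then show False using S(2) by simp
    qed
  qed simp
  also have "\<dots> \<le> 2 * eps"
    unfolding s using i by (intro stage[OF sc C]) auto
  finally show ?thesis .
qed

lemma b_le_n: "b v \<le> n"
proof -
  have "b v \<le> b v ^ 27" using degree_class_pos by (intro self_le_power) auto
  also have "\<dots> \<le> max 1 (card (N v))" by (rule degree_class(1))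
  also have "\<dots> \<le> n" using deg_less[of v] n1 by simp
  finally show ?thesis .
qed

lemma root_bounds:
  fixes x :: nat
  shows "n \<le> x ^ 584 \<Longrightarrow> real n powr (1 / 584) \<le> real x"
    "x ^ 584 < n \<Longrightarrow> real x \<le> real n powr (1 / 584)"
proof -
  have x: "(real x ^ 584) powr (1 / 584) = real x"
  proof (cases "x = 0")
    case False
    have "(real x ^ 584) powr (1 / 584) = (real x powr 584) powr (1 / 584)"
      by (subst powr_numeral) (use False in auto)
    also have "\<dots> = real x powr (584 * (1 / 584))" by (rule powr_powr)
    finally show ?thesis using False by simp
  qed simp
  show "real n powr (1 / 584) \<le> real x" if "n \<le> x ^ 584"
  proof -
    have "real n \<le> real x ^ 584" unfolding of_nat_power[symmetric] using that by (rule of_nat_mono)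
    then have "real n powr (1 / 584) \<le> (real x ^ 584) powr (1 / 584)" by (intro powr_mono2) auto
    then show ?thesis by (simp only: x)
  qed
  show "real x \<le> real n powr (1 / 584)" if "x ^ 584 < n"
  proof -
    have "real x ^ 584 \<le> real n" unfolding of_nat_power[symmetric] using that by (intro of_nat_mono) simp
    then have "(real x ^ 584) powr (1 / 584) \<le> real n powr (1 / 584)" by (intro powr_mono2) auto
    then show ?thesis by (simp only: x)
  qed
qed

text \<open>There are \<open>18\<close> stages with failure probability at most
  \<open>2 * eps\<close> each, one \<open>eps\<close> for the edges and one for the
  invariant.\<close>

lemma attempt_fails_large:
  assumes L: "growth ^ 9 + 1 \<le> real L"
  shows "pr (iterate_pmf kernel 56 {}) unfinished \<le> 36 * (2 ^ 220 * real n powr (- 1 / 584))"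
proof -
  define eps where "eps = 2 ^ 220 * real n powr (- 1 / 584)"
  define rt where "rt = real n powr (1 / 584)"
  have nR: "real n \<ge> 1" using n1 by simp
  have rt: "rt \<ge> 1" using powr_mono2[of "1 / 584" 1 "real n"] nR by (simp add: rt_def)
  have eps0: "eps \<ge> 0" by (simp add: eps_def)
  have H: "degree_scale {..<n} N b rt (real n) eps"
  proof (rule degree_scaleI[OF rt nR disjI1])
    have "1 / rt = real n powr (- 1 / 584)" using nR by (simp add: rt_def powr_minus_divide)
    also have "\<dots> = 1 * real n powr (- 1 / 584)" by simp
    also have "\<dots> \<le> eps" unfolding eps_def by (intro mult_right_mono) auto
    finally show "1 / rt \<le> eps" .
  qed
  \<comment> \<open>Since \<open>292 = 4 * 73\<close>, \<open>rt^292\<close> is the square root of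
    \<open>n\<close>, and Chebyshev's bound is a constant times \<open>n powr (- 1 / 2)\<close>. The
    weaker \<open>eps\<close> is dictated by Markov's inequality in the upper range.\<close>
  have Lo: "degree_scale {..<n} N b 1 rt eps"
  proof (rule degree_scaleI[OF order_refl rt disjI2])
    have "(2 ^ 55 * rt ^ 73) ^ 4 / real n = 2 ^ 220 * (rt ^ 292 / real n)"
      by (simp add: power_mult_distrib flip: power_mult)
    also have "rt ^ 292 = rt powr 292" by (subst powr_numeral) (use rt in auto)
    also have "\<dots> = real n powr (1 / 584 * 292)" unfolding rt_def by (rule powr_powr)
    also have "\<dots> = real n powr (1 / 2)" by simp
    also have "real n powr (1 / 2) / real n = real n powr (- 1 / 2)"
      using nR powr_diff[of "real n" "1 / 2" 1] by simp
    also have "2 ^ 220 * real n powr (- 1 / 2) \<le> eps"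
      unfolding eps_def using nR by (intro mult_left_mono powr_mono) auto
    finally show "(2 ^ 55 * rt ^ 73) ^ 4 / real n \<le> eps" by simp
  qed
  interpret H: degree_scale "{..<n}" N b rt "real n" eps by (rule H)
  interpret Lo: degree_scale "{..<n}" N b 1 rt eps by (rule Lo)
  have scH: "H.scale (active_set 0 I)" for I
    unfolding H.scale_def using uncovered_sub[of I] root_bounds(1) b_le_n by (auto simp: active_set_def active_def rt_def)
  have scL: "Lo.scale (active_set 9 I)" for I
    unfolding Lo.scale_def using uncovered_sub[of I] root_bounds(2) degree_class_pos by (auto simp: active_set_def active_def rt_def)
  define P where "P j I \<longleftrightarrow> (if j < 9 then inv (growth ^ j) j (active_set 0 I)
     else active_set 0 I = {} \<and> inv (growth ^ (j - 9)) (j - 9) (active_set 9 I))" for j I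
  have kk1: "growth \<ge> 1" by (rule growth_bounds)
  have kC: "growth * growth ^ i + 1 \<le> real L" if "i < 9" for i
  proof -
    have "growth ^ Suc i \<le> growth ^ 9" using that kk1 by (intro power_increasing) auto
    then show ?thesis using L by simp
  qed
  have "pr (iterate_pmf kernel 56 {}) unfinished \<le> 18 * (2 * eps)"
  proof (rule attempt_fails_le[of P])
    show "P 0 {}" by (simp add: P_def H.stage_inv_def)
    show "uncovered I = {}" if "P 18 I" for I using that by (intro uncovered_active_set) (auto simp: P_def H.stage_inv_def)
    fix j I assume j: "j < 18" and Pj: "P j I"
    show "pr (sample j I) {S. \<not> P (Suc j) (next_set I S)} \<le> 2 * eps"
    proof (cases "j < 9")
      case True
      have "pr (sample j I) {S. \<not> P (Suc j) (next_set I S)} \<le>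
        pr (sample j I) {S. \<not> inv (growth * growth ^ j) (Suc (j mod 9)) (active_set j (next_set I S))}"
      proof (intro measure_pmf.finite_measure_mono subsetI CollectI notI)
        fix S assume "S \<in> {S. \<not> P (Suc j) (next_set I S)}" "inv (growth * growth ^ j) (Suc (j mod 9)) (active_set j (next_set I S))"
        then show False using True active_set_cong(1)[OF True, of "next_set I S"]
          \<comment> \<open>At \<open>j = 8\<close> the next invariant says that the upper range is
            empty, while the lower range starts afresh with the trivial invariant of stage
            \<open>0\<close>.\<close>
          by (cases "j = 8") (auto simp: P_def H.stage_inv_def)
      qed simp
      also have "\<dots> \<le> 2 * eps"
        using True Pj scH[of I] kk1 kC[of j]
        by (intro stage_success[OF H]) (auto simp: active_set_cong(1)[OF True] P_def)
      finally show ?thesis .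
    next
      case False
      then have j9: "9 \<le> j" "j mod 9 = j - 9" using j by (auto simp: mod_if)
      have j8: "j - 8 = Suc (j - 9)" using j9(1) by simp
      have "pr (sample j I) {S. \<not> P (Suc j) (next_set I S)} \<le>
        pr (sample j I) {S. \<not> inv (growth * growth ^ (j - 9)) (Suc (j mod 9)) (active_set j (next_set I S))}"
      proof (intro measure_pmf.finite_measure_mono subsetI CollectI notI)
        fix S assume "S \<in> {S. \<not> P (Suc j) (next_set I S)}" "inv (growth * growth ^ (j - 9)) (Suc (j mod 9)) (active_set j (next_set I S))"
        then show False using False Pj j9 active_set_cong(2)[OF j9(1), of "next_set I S"] active_set_next_set[of 0 I S] j8
          by (auto simp: P_def)
      qed simp
      also have "\<dots> \<le> 2 * eps"
        using False Pj scL[of I] kk1 kC[of "j - 9"] j j9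
        by (intro stage_success[OF Lo]) (auto simp: active_set_cong(2)[OF j9(1)] P_def)
      finally show ?thesis .
    qed
  qed (use eps0 in simp)
  then show ?thesis by (simp add: eps_def)
qed

text \<open>If \<open>n + 1 <= L\<close>, every sample fits, and the last stage of each range
  samples all its active vertices with certainty. This covers the values of \<open>n\<close> for
  which the asymptotic estimate says nothing.\<close>

lemma attempt_fails_small:
  assumes L: "n + 1 \<le> L"
  shows "pr (iterate_pmf kernel 56 {}) unfinished \<le> 0"
proof -
  define P where "P j I \<longleftrightarrow> (9 \<le> j \<longrightarrow> active_set 0 I = {}) \<and> (18 \<le> j \<longrightarrow> active_set 9 I = {})" for j :: nat and I
  have last: "active_set j (next_set I S) = {}" if S: "S \<in> set_pmf (sample j I)" and j: "j mod 9 = 8" for j I S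
  proof -
    have fin: "finite (active_set j I)" using finite_subset[OF uncovered_sub] by (simp add: active_set_def)
    have "sample j I = return_pmf (active_set j I)"
      using j fin by (simp add: sample_def active_set_def[symmetric] stage_exp_def random_subset_def bernoulli_1)
    then have SA: "S = active_set j I" using S by simp
    then have SU: "S \<subseteq> uncovered I" by (auto simp: active_set_def)
    then have SV: "S \<subseteq> {..<n}" using uncovered_sub by blast
    have "card S + degree_sum N S \<le> (n + 1) * n" using card_ecount_le[OF SV] by simp
    also have "\<dots> \<le> L * n" using L by (intro mult_right_mono) auto
    finally have fit: "card S + degree_sum N S \<le> L * n" .
    show ?thesis
    proof (rule equals0I)
      fix v assume v: "v \<in> active_set j (next_set I S)"
      then have "v \<in> active_set j I" using active_set_next_set by blast
      moreover have "v \<in> uncovered (next_set I S)" using v by (simp add: active_set_def)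
      ultimately show False using uncovered_next_set(2)[OF fit SU] SA by simp
    qed
  qed
  have "pr (iterate_pmf kernel 56 {}) unfinished \<le> 18 * 0"
  proof (rule attempt_fails_le[of P])
    show "uncovered I = {}" if "P 18 I" for I using that by (intro uncovered_active_set) (auto simp: P_def)
    fix j I assume j: "j < 18" and Pj: "P j I"
    have "set_pmf (sample j I) \<inter> {S. \<not> P (Suc j) (next_set I S)} = {}"
    proof (safe, simp)
      fix S assume S: "S \<in> set_pmf (sample j I)" "\<not> P (Suc j) (next_set I S)"
      have "P (Suc j) (next_set I S)"
      proof (cases "j = 8 \<or> j = 17")
        case True
        then have "active_set j (next_set I S) = {}" using S(1) by (intro last) auto
        then show ?thesis using True Pj active_set_cong[of j "next_set I S"] active_set_next_set[of 0 I S] by (auto simp: P_def)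
      next
        case False
        then show ?thesis using Pj j active_set_next_set[of 0 I S] by (auto simp: P_def)
      qed
      then show False using S(2) by simp
    qed
    then have "pr (sample j I) {S. \<not> P (Suc j) (next_set I S)} = 0" by (simp add: measure_pmf_zero_iff)
    then show "pr (sample j I) {S. \<not> P (Suc j) (next_set I S)} \<le> 0" by simp
  qed (auto simp: P_def)
  then show ?thesis by simp
qed

lemma prob_unfinished_tendsto:
  assumes "pr (iterate_pmf kernel 56 {}) unfinished < 1"
  shows "(\<lambda>t. pr (iterate_pmf kernel t {}) {g. hub_fin n g}) \<longlonglongrightarrow> 1"
proof -
  let ?u = "\<lambda>t. pr (iterate_pmf kernel t {}) unfinished"
  have mono: "?u (s + t) \<le> ?u s + 0" for s t
    unfolding iterate_pmf_add by (rule pr_bind_le) (auto simp: iterate_fin measure_return_pmf)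
  have "?u \<longlonglongrightarrow> 0"
  proof (rule LIMSEQ_I)
    fix r :: real assume "r > 0"
    \<comment> \<open>A failure probability below \<open>1\<close> per trial suffices for almost
      sure termination.\<close>
    have "(\<lambda>a. ?u 56 ^ a) \<longlonglongrightarrow> 0" using assms by (intro LIMSEQ_realpow_zero) auto
    then obtain a where a: "\<And>i. i \<ge> a \<Longrightarrow> norm (?u 56 ^ i - 0) < r" using LIMSEQ_D \<open>r > 0\<close> by blast
    show "\<exists>no. \<forall>t\<ge>no. norm (?u t - 0) < r"
    proof (intro exI allI impI)
      fix t assume "56 * a \<le> t"
      then have "?u t \<le> ?u (56 * a)" using mono[of "56 * a" "t - 56 * a"] by simp
      also have "\<dots> = ?u 56 ^ a" using attempts[of a] by simp
      also have "\<dots> < r" using a[of a] by simp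
      finally show "norm (?u t - 0) < r" by simp
    qed
  qed
  then have "(\<lambda>t. 1 - ?u t) \<longlonglongrightarrow> 1 - 0" by (intro tendsto_diff tendsto_const)
  moreover have "1 - ?u t = pr (iterate_pmf kernel t {}) {g. hub_fin n g}" for t
    using measure_pmf.prob_compl[of "{g. hub_fin n g}" "iterate_pmf kernel t {}"] by (simp add: Compl_eq_Diff_UNIV)
  ultimately show ?thesis by simp
qed

end

section \<open>Numerical bounds and assembly of the parameters\<close>

lemma card_edges_le:
  assumes "simple_graph {..<n} E"
  shows "card E \<le> n * n"
proof -
  have "E \<subseteq> (\<lambda>(u, v). {u, v}) ` ({..<n} \<times> {..<n})"
  proof
    fix e assume "e \<in> E"
    then have "e \<subseteq> {..<n}" "card e = 2" using assms by (auto simp: simple_graph_def)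
    then obtain u v where "e = {u, v}" by (auto simp: card_2_iff)
    then show "e \<in> (\<lambda>(u, v). {u, v}) ` ({..<n} \<times> {..<n})" using \<open>e \<subseteq> {..<n}\<close> by auto
  qed
  then have "card E \<le> card ((\<lambda>(u, v). {u, v}) ` ({..<n} \<times> {..<n}))" by (intro card_mono) auto
  also have "\<dots> \<le> card ({..<n} \<times> {..<n})" by (intro card_image_le) auto
  finally show ?thesis by simp
qed

text \<open>The power \<open>2 ^ floorlog 2 n\<close> exceeds \<open>n\<close> and is at least
  \<open>2\<close>; seven factors dominate \<open>2^7 > 66\<close>, and two more dominate
  \<open>n^2\<close>.\<close>

lemma word_size_bound:
  assumes "n \<ge> 1"
  shows "(60 + 6) * n ^ 2 < 2 ^ (9 * floorlog 2 n)"
proof -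
  let ?p = "2 ^ floorlog 2 n :: nat"
  have np: "n < ?p" using floorlog_bounds[of n 2] assms by simp
  then have "2 \<le> ?p" using assms by linarith
  have "(60 + 6) * n ^ 2 < 2 ^ 7 * n ^ 2" using assms by simp
  also have "\<dots> \<le> ?p ^ 7 * ?p ^ 2" using np \<open>2 \<le> ?p\<close> by (intro mult_mono power_mono) auto
  also have "\<dots> = 2 ^ (9 * floorlog 2 n)" by (simp add: mult.commute flip: power_add power_mult)
  finally show ?thesis .
qed

theorem theorem13:
  fixes c :: real and lam kap :: nat
  assumes "c \<ge> 1"
  shows "\<exists>(P :: algorithm) (sig :: nat) (tau :: nat) (bet :: nat) (R :: nat).
    \<forall>(n :: nat) (E :: nat set set) (M :: nat) (place :: nat \<Rightarrow> nat).
      n \<ge> 1 \<longrightarrow> simple_graph {..<n} E \<longrightarrow>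
      M * n \<le> kap * max n (card E) \<longrightarrow>
      placement n E M (lam * n) place \<longrightarrow>
      (let S = sig * n; B = bet * floorlog 2 n in
         M * S \<le> tau * max n (card E) \<and>
         finds_ruling_set 2 P S B n E M place \<and>
         prob_halted_within R P n E M place \<ge> 1 - 1 / real n powr c)"
proof -
  \<comment> \<open>Halving the exponent absorbs the constant factor for large
    \<open>n\<close>.\<close>
  have "eventually (\<lambda>n. 36 * (2 ^ 220 * real n powr (- 1 / 584)) \<le> real n powr (- 1 / 1168)) at_top"
    by real_asymp
  then obtain n0 where n0: "\<And>n. n \<ge> n0 \<Longrightarrow> 36 * (2 ^ 220 * real n powr (- 1 / 584)) \<le> real n powr (- 1 / 1168)"
    by (auto simp: eventually_at_top_linorder)
  \<comment> \<open>Large enough for nine stages of growth starting from \<open>1\<close>, and at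
    least \<open>n + 1\<close> for every \<open>n\<close> below \<open>n0 + 2\<close>.\<close>
  define L where "L = n0 + 3 + nat \<lceil>growth ^ 9\<rceil>"
  \<comment> \<open>With failure probability at most \<open>n powr (- 1 / 1168)\<close> per trial,
    this many trials reach the exponent \<open>c\<close>.\<close>
  define a where "a = nat \<lceil>1168 * c\<rceil>"
  define sig where "sig = lam + 3 * 60 + L + kap + 6"
  define P where "P = hub_algorithm hub_post hub_upd hub_fin dec_set L 60"
  have ac: "1168 * c \<le> real a" unfolding a_def by linarith
  have Lk: "growth ^ 9 + 1 \<le> real L"
  proof -
    have "growth ^ 9 \<le> real (nat \<lceil>growth ^ 9\<rceil>)" by linarith
    then show ?thesis by (simp add: L_def)
  qed
  show ?thesis
  proof (rule exI[of _ P], rule exI[of _ sig], rule exI[of _ "sig * kap"], rule exI[of _ 9],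
      rule exI[of _ "Suc (5 * (56 * a))"], intro allI impI)
    fix n :: nat and E :: "nat set set" and M place
    assume n: "n \<ge> 1" and E: "simple_graph {..<n} E" and M: "M * n \<le> kap * max n (card E)"
      and pl: "placement n E M (lam * n) place"
    interpret ruling_protocol n L E by standard (use n E in \<open>auto simp: L_def\<close>)
    have "M * n \<le> kap * max n (card E)" by (rule M)
    also have "\<dots> \<le> kap * (n * n)" using card_edges_le[OF E] n by (intro mult_left_mono) auto
    finally have Mn: "M \<le> kap * n" using n by simp
    interpret hub_run hub_post hub_upd hub_fin dec_set L 60 lam kap n E M place good "sig * n" "9 * floorlog 2 n"
    proof
      show "(60 + 6) * n\<^sup>2 < 2 ^ (9 * floorlog 2 n)" by (rule word_size_bound[OF n])
      show "good g'" if "good g" "\<not> hub_fin n g"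
        "g' \<in> set_pmf (hub_upd n g (if (\<Sum>v<n. length (hub_post n g v (nbrs E v))) \<le> L * n
         then Some (\<Union>v<n. set (hub_post n g v (nbrs E v))) else None))" for g g'
        using good_step(1)[OF that(1,2), unfolded step_def total_def resp_def, OF that(3)] .
    qed (use n E Mn pl good_empty good_bound length_hub_post words_hub_post good_res in \<open>auto simp: sig_def\<close>)
    have kern: "kern = kernel"
      by (auto simp: fun_eq_iff kern_def kernel_def step_def fits_def total_def resp_def)
    let ?q = "pr (iterate_pmf kernel 56 {}) unfinished"
    have q: "?q < 1 \<and> ?q ^ a \<le> 1 / real n powr c"
    proof (cases "n < n0 + 2")
      case True
      then have q0: "?q = 0" using attempt_fails_small measure_nonneg[of _ unfinished] by (simp add: L_def antisym)
      \<comment> \<open>Positivity matters because \<open>0 ^ 0 = 1\<close>.\<close>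
      have "a > 0" using ac assms by (simp add: a_def)
      then show ?thesis unfolding q0 by (simp add: zero_power)
    next
      case False
      have "?q \<le> 36 * (2 ^ 220 * real n powr (- 1 / 584))" by (rule attempt_fails_large[OF Lk])
      also have "\<dots> \<le> real n powr (- 1 / 1168)" using False by (intro n0) simp
      finally have q1: "?q \<le> real n powr (- 1 / 1168)" .
      \<comment> \<open>Strictness uses \<open>n >= 2\<close>, the reason for splitting at
        \<open>n0 + 2\<close>.\<close>
      also have "\<dots> < real n powr 0" using False by (intro powr_less_mono) auto
      finally have "?q < 1" using n by simp
      have "?q ^ a \<le> (real n powr (- 1 / 1168)) ^ a" using q1 by (intro power_mono) auto
      also have "\<dots> = real n powr (- 1 / 1168 * real a)" using n by (simp add: powr_powr flip: powr_realpow)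
      also have "\<dots> \<le> real n powr (- c)" using ac n by (intro powr_mono) auto
      also have "\<dots> = 1 / real n powr c" by (simp add: powr_minus_divide)
      finally show ?thesis using \<open>?q < 1\<close> by simp
    qed
    have "M * (sig * n) = sig * (M * n)" by simp
    also have "\<dots> \<le> sig * (kap * max n (card E))" using M by (rule mult_left_mono) simp
    finally have "M * (sig * n) \<le> sig * kap * max n (card E)" by (simp only: mult.assoc)
    moreover have "finds_ruling_set 2 P (sig * n) (9 * floorlog 2 n) n E M place"
      unfolding P_def using prob_unfinished_tendsto q by (intro hub_finds_ruling_set) (simp add: kern)
    moreover have "prob_halted_within (Suc (5 * (56 * a))) P n E M place \<ge> 1 - 1 / real n powr c"
    proof -
      have "prob_halted_within (Suc (5 * (56 * a))) P n E M place = pr (iterate_pmf kernel (56 * a) {}) {g. hub_fin n g}"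
        unfolding prob_halted_within_def P_def prob_halted_chain kern ..
      also have "\<dots> = 1 - pr (iterate_pmf kernel (56 * a) {}) unfinished"
        using measure_pmf.prob_compl[of "{g. hub_fin n g}" "iterate_pmf kernel (56 * a) {}"]
        by (simp add: Compl_eq_Diff_UNIV)
      also have "\<dots> = 1 - ?q ^ a" using attempts[of a] by simp
      finally show ?thesis using q by simp
    qed
    ultimately show "let S = sig * n; B = 9 * floorlog 2 n in
         M * S \<le> sig * kap * max n (card E) \<and>
         finds_ruling_set 2 P S B n E M place \<and>
         prob_halted_within (Suc (5 * (56 * a))) P n E M place \<ge> 1 - 1 / real n powr c"
      by (simp only: Let_def)
  qed
qed

end
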